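(* Let $\mathbb{K}$ be a local field. Suppose that Boman's Theorem holds for functions from $\mathbb{K}^2$ to $\mathbb{K}$, i.e., assume the validity of the following statement: if $f\colon\mathbb{K}^2\to\mathbb{K}$ is a function such that $f\circ\gamma\colon\mathbb{K}\to\mathbb{K}$ is $C^\infty_{\mathbb{K}}$ for each $C^\infty_{\mathbb{K}}$-curve $\gamma\colon\mathbb{K}\to\mathbb{K}^2$, then $f$ is of class $C^\infty_{\mathbb{K}}$. Then Boman's theorem holds for mappings $f\colon U\to F$ from open subsets $U\subseteq E$ of metrizable topological $\mathbb{K}$-vector spaces $E$ to Mackey complete, locally convex topological $\mathbb{K}$-vector spaces $F$, i.e., smoothness ($C^\infty_{\mathbb{K}}$) of $f\circ\gamma\colon\mathbb{K}\to F$ for each smooth curve $\gamma\colon\mathbb{K}\to U$ entails smoothness of $f$.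
   Context: All topological spaces, fields and topological vector spaces are Hausdorff. A local field is a totally disconnected, locally compact, non-discrete topological field; its topology is given by an ultrametric absolute value with valuation ring $\mathbb{O}=\{x:|x|\le1\}$. $F$ is locally convex if every zero-neighbourhood contains an open $\mathbb{O}$-submodule. $F$ is Mackey complete if every Mackey–Cauchy sequence converges, where $(x_n)_{n\in\mathbb{N}}$ is Mackey–Cauchy if there are a bounded set $B\subseteq F$ and $\mu_{n,m}\in\mathbb{K}$ with $x_n-x_m\in\mu_{n,m}B$ for all $n,m$ and $\mu_{n,m}\to0$ as both $n,m\to\infty$. Differential calculus over $\mathbb{K}$: For $U$ open in a topological $\mathbb{K}$-vector space $E$, put $U^{[0]}:=U$, $U^{[1]}:=\{(x,y,t)\in U\times E\times\mathbb{K}: x+ty\in U\}$, $U^{[j+1]}:=(U^{[j]})^{[1]}$. A map $f\colon U\to F$ is $C^0_{\mathbb{K}}$ if it is continuous ($f^{[0]}:=f$); $C^1_{\mathbb{K}}$ if it is continuous and there is a (unique) continuous $f^{[1]}\colon U^{[1]}\to F$ with $f^{[1]}(x,y,t)=\frac1t(f(x+ty)-f(x))$ whenever $t\ne0$; $C^k_{\mathbb{K}}$ ($k\ge2$) if it is $C^{k-1}_{\mathbb{K}}$ and $f^{[k-1]}$ is $C^1_{\mathbb{K}}$, with $f^{[k]}:=(f^{[k-1]})^{[1]}$; smooth ($C^\infty_{\mathbb{K}}$) if $C^k_{\mathbb{K}}$ for all $k\in\mathbb{N}_0$. A smooth curve $\mathbb{K}\to U$ is a $C^\infty_{\mathbb{K}}$-map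 $\mathbb{K}\to E$ with image in $U$. *)

theory Defs
  imports "HOL-Analysis.Analysis"
begin

subsection \<open>Local fields\<close>

class topological_field =
  field + t2_space + topological_ab_group_add + topological_semigroup_mult +
  assumes tendsto_inverse_nhds: "a \<noteq> 0 \<Longrightarrow> (inverse \<longlongrightarrow> inverse a) (nhds a)"

class local_field = topological_field +
  assumes totally_disconnected: "connected S \<Longrightarrow> x \<in> S \<Longrightarrow> y \<in> S \<Longrightarrow> x = y"
    and locally_compact: "\<exists>V C. open V \<and> compact C \<and> x \<in> V \<and> V \<subseteq> C"
    and not_discrete: "\<exists>S. \<not> open S"

definition ultrametric_absolute_value :: "('k::topological_field \<Rightarrow> real) \<Rightarrow> bool" where
  "ultrametric_absolute_value v \<longleftrightarrow>
     (\<forall>x. 0 \<le> v x) \<and> (\<forall>x. v x = 0 \<longleftrightarrow> x = 0) \<and>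
     (\<forall>x y. v (x * y) = v x * v y) \<and>
     (\<forall>x y. v (x + y) \<le> max (v x) (v y))"

definition defines_topology :: "('k::topological_field \<Rightarrow> real) \<Rightarrow> bool" where
  "defines_topology v \<longleftrightarrow>
     (\<forall>S. open S \<longleftrightarrow> (\<forall>x\<in>S. \<exists>e>0. \<forall>y. v (y - x) < e \<longrightarrow> y \<in> S))"

definition valuation_ring :: "('k::topological_field \<Rightarrow> real) \<Rightarrow> 'k set" where
  "valuation_ring v = {x. v x \<le> 1}"


subsection \<open>Topological vector spaces\<close>

locale topological_vector_space = vector_space scale
  for scale :: "'k::topological_field \<Rightarrow> 'e::{topological_ab_group_add, t2_space} \<Rightarrow> 'e" +
  assumes continuous_on_scale: "continuous_on UNIV (\<lambda>(a, x). scale a x)"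

text \<open>Closure under negation is implied below, since \<open>- 1\<close> belongs to the valuation ring.\<close>

definition valuation_submodule ::
  "('k::topological_field \<Rightarrow> real) \<Rightarrow> ('k \<Rightarrow> 'e::ab_group_add \<Rightarrow> 'e) \<Rightarrow> 'e set \<Rightarrow> bool" where
  "valuation_submodule v s M \<longleftrightarrow>
     0 \<in> M \<and> (\<forall>x\<in>M. \<forall>y\<in>M. x + y \<in> M) \<and> (\<forall>a\<in>valuation_ring v. \<forall>x\<in>M. s a x \<in> M)"

definition locally_convex_tvs ::
  "('k::topological_field \<Rightarrow> real) \<Rightarrow> ('k \<Rightarrow> 'e::{ab_group_add, topological_space} \<Rightarrow> 'e) \<Rightarrow> bool" where
  "locally_convex_tvs v s \<longleftrightarrow>
     (\<forall>W. open W \<and> 0 \<in> W \<longrightarrow> (\<exists>M. open M \<and> valuation_submodule v s M \<and> M \<subseteq> W))"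

definition bounded_tvs ::
  "('k::topological_field \<Rightarrow> 'e::{ab_group_add, topological_space} \<Rightarrow> 'e) \<Rightarrow> 'e set \<Rightarrow> bool" where
  "bounded_tvs s B \<longleftrightarrow> (\<forall>W. open W \<and> 0 \<in> W \<longrightarrow> (\<exists>a. B \<subseteq> s a ` W))"

definition Mackey_Cauchy ::
  "('k::topological_field \<Rightarrow> 'e::{ab_group_add, topological_space} \<Rightarrow> 'e) \<Rightarrow> (nat \<Rightarrow> 'e) \<Rightarrow> bool" where
  "Mackey_Cauchy s x \<longleftrightarrow>
     (\<exists>B \<mu>. bounded_tvs s B \<and> (\<forall>n m. x n - x m \<in> s (\<mu> n m) ` B) \<and>
        ((\<lambda>(n, m). \<mu> n m) \<longlongrightarrow> 0) (sequentially \<times>\<^sub>F sequentially))"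

definition Mackey_complete ::
  "('k::topological_field \<Rightarrow> 'e::{ab_group_add, topological_space} \<Rightarrow> 'e) \<Rightarrow> bool" where
  "Mackey_complete s \<longleftrightarrow> (\<forall>x. Mackey_Cauchy s x \<longrightarrow> convergent x)"


subsection \<open>Differential calculus\<close>

text \<open>
  Put \<open>E\<^sub>0 = E\<close> and \<open>E\<^sub>j\<^sub>+\<^sub>1 = E\<^sub>j \<times> E\<^sub>j \<times> K\<close>, so that the iterated domain \<open>U\<^sup>[\<^sup>j\<^sup>]\<close> of a set
  \<open>U \<subseteq> E\<close> lies in \<open>E\<^sub>j\<close>. As the type of \<open>E\<^sub>j\<close> would depend on \<open>j\<close>, all the spaces \<open>E\<^sub>j\<close> are
  realised inside one type of trees: \<open>E\<^sub>j\<close> consists of the complete binary trees of depth \<open>j\<close>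
  with leaves in \<open>E\<close> and inner nodes labelled by \<open>K\<close>. The node \<open>Incr x y t\<close> is the triple
  \<open>(x, y, t)\<close>, and \<open>Pt x\<close> is the element \<open>x\<close> of \<open>E\<close>.
\<close>

datatype ('e, 'k) iter_pt =
    Pt (pt_val: 'e)
  | Incr (inc_base: "('e, 'k) iter_pt") (inc_dir: "('e, 'k) iter_pt") (inc_par: 'k)

primrec iter_space :: "nat \<Rightarrow> ('e, 'k) iter_pt set" where
  "iter_space 0 = range Pt"
| "iter_space (Suc j) = {Incr x y t | x y t. x \<in> iter_space j \<and> y \<in> iter_space j}"

primrec iter_top :: "nat \<Rightarrow> ('e::topological_space, 'k::topological_space) iter_pt topology" where
  "iter_top 0 = pullback_topology (iter_space 0) pt_val euclidean"
| "iter_top (Suc j) =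
     pullback_topology (iter_space (Suc j)) (\<lambda>p. (inc_base p, inc_dir p, inc_par p))
       (prod_topology (iter_top j) (prod_topology (iter_top j) euclidean))"

text \<open>Addition is only meaningful (and only used) for trees of equal depth.\<close>

fun iter_add :: "('e::plus, 'k::plus) iter_pt \<Rightarrow> ('e, 'k) iter_pt \<Rightarrow> ('e, 'k) iter_pt" where
  "iter_add (Pt x) (Pt x') = Pt (x + x')"
| "iter_add (Incr x y t) (Incr x' y' t') = Incr (iter_add x x') (iter_add y y') (t + t')"
| "iter_add _ _ = undefined"

primrec iter_scale ::
  "('k::times \<Rightarrow> 'e \<Rightarrow> 'e) \<Rightarrow> 'k \<Rightarrow> ('e, 'k) iter_pt \<Rightarrow> ('e, 'k) iter_pt" where
  "iter_scale s a (Pt x) = Pt (s a x)"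
| "iter_scale s a (Incr x y t) = Incr (iter_scale s a x) (iter_scale s a y) (a * t)"

text \<open>\<open>iter_dom s U j\<close> is \<open>U\<^sup>[\<^sup>j\<^sup>]\<close>.\<close>

primrec iter_dom ::
  "('k::topological_field \<Rightarrow> 'e::plus \<Rightarrow> 'e) \<Rightarrow> 'e set \<Rightarrow> nat \<Rightarrow> ('e, 'k) iter_pt set" where
  "iter_dom s U 0 = Pt ` U"
| "iter_dom s U (Suc j) =
     {Incr x y t | x y t. x \<in> iter_dom s U j \<and> y \<in> iter_space j \<and>
        iter_add x (iter_scale s t y) \<in> iter_dom s U j}"

definition iter_continuous ::
  "('k::topological_field \<Rightarrow> 'e::{plus, topological_space} \<Rightarrow> 'e) \<Rightarrow> 'e set \<Rightarrow> nat \<Rightarrow>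
     (('e, 'k) iter_pt \<Rightarrow> 'f::topological_space) \<Rightarrow> bool" where
  "iter_continuous s U j g \<longleftrightarrow>
     continuous_map (subtopology (iter_top j) (iter_dom s U j)) euclidean g"

text \<open>
  \<open>iter_dq s s' U f k g\<close> says that \<open>f\<close> is of class \<open>C\<^sup>k\<close> on \<open>U\<close> and that \<open>g\<close> restricts to
  \<open>f\<^sup>[\<^sup>k\<^sup>]\<close> on \<open>U\<^sup>[\<^sup>k\<^sup>]\<close>; here \<open>s\<close> and \<open>s'\<close> are the scalar multiplications of domain and range.
  Over a non-discrete field with Hausdorff range, \<open>f\<^sup>[\<^sup>k\<^sup>]\<close> is unique on the open set \<open>U\<^sup>[\<^sup>k\<^sup>]\<close>, so
  the existential quantifier only names \<open>f\<^sup>[\<^sup>k\<^sup>-\<^sup>1\<^sup>]\<close>.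
\<close>

primrec iter_dq ::
  "('k::topological_field \<Rightarrow> 'e::{plus, topological_space} \<Rightarrow> 'e) \<Rightarrow>
   ('k \<Rightarrow> 'f::{ab_group_add, topological_space} \<Rightarrow> 'f) \<Rightarrow>
   'e set \<Rightarrow> ('e \<Rightarrow> 'f) \<Rightarrow> nat \<Rightarrow> (('e, 'k) iter_pt \<Rightarrow> 'f) \<Rightarrow> bool" where
  "iter_dq s s' U f 0 g \<longleftrightarrow>
     iter_continuous s U 0 g \<and> (\<forall>x\<in>U. g (Pt x) = f x)"
| "iter_dq s s' U f (Suc k) g \<longleftrightarrow>
     iter_continuous s U (Suc k) g \<and>
     (\<exists>h. iter_dq s s' U f k h \<and>
        (\<forall>x y t. Incr x y t \<in> iter_dom s U (Suc k) \<and> t \<noteq> 0 \<longrightarrow>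
           g (Incr x y t) = s' (1 / t) (h (iter_add x (iter_scale s t y)) - h x)))"

definition C_k_on ::
  "nat \<Rightarrow> ('k::topological_field \<Rightarrow> 'e::{plus, topological_space} \<Rightarrow> 'e) \<Rightarrow>
   ('k \<Rightarrow> 'f::{ab_group_add, topological_space} \<Rightarrow> 'f) \<Rightarrow> 'e set \<Rightarrow> ('e \<Rightarrow> 'f) \<Rightarrow> bool" where
  "C_k_on k s s' U f \<longleftrightarrow> (\<exists>g. iter_dq s s' U f k g)"

definition C_infinity_on ::
  "('k::topological_field \<Rightarrow> 'e::{plus, topological_space} \<Rightarrow> 'e) \<Rightarrow>
   ('k \<Rightarrow> 'f::{ab_group_add, topological_space} \<Rightarrow> 'f) \<Rightarrow> 'e set \<Rightarrow> ('e \<Rightarrow> 'f) \<Rightarrow> bool" where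
  "C_infinity_on s s' U f \<longleftrightarrow> (\<forall>k. C_k_on k s s' U f)"

definition smooth_curve_in ::
  "('k::topological_field \<Rightarrow> 'e::{ab_group_add, topological_space} \<Rightarrow> 'e) \<Rightarrow>
   'e set \<Rightarrow> ('k \<Rightarrow> 'e) \<Rightarrow> bool" where
  "smooth_curve_in s U \<gamma> \<longleftrightarrow> C_infinity_on (*) s UNIV \<gamma> \<and> range \<gamma> \<subseteq> U"

definition scale_plane :: "'k::times \<Rightarrow> 'k \<times> 'k \<Rightarrow> 'k \<times> 'k" where
  "scale_plane a p = (a * fst p, a * snd p)"

end

(*
  Smoothness along smooth curves is passed on from a function f to its difference quotient
  f^[1](x, y, t): along a smooth curve (a, b, t), the latter is f^[1] of the function
  (u, t) |-> f (a u + t b u) on an open part of the plane, and this function is smooth by Boman's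
  theorem on the plane. As a function on a metrizable space that is smooth along smooth curves is
  continuous (any sequence that converges fast enough lies on a smooth curve), it follows inductively
  that all f^[k] exist and are continuous, provided that f is scalar-valued.

  For values in F one passes to the compositions with continuous linear functionals. By the
  Hahn-Banach theorem and uniform boundedness, weakly bounded sets in F are bounded; hence the
  difference quotients of a weakly smooth map form Mackey-Cauchy sequences as t tends to 0, and their
  limits are again weakly smooth maps.
*)
theory Submission
  imports Defs "HOL-Library.Function_Algebras"
begin

text \<open>All inductions have one shape: a class of pairs (V, f) with V open consists of smooth
  maps once each f is continuous and its difference quotient at t \<noteq> 0 extends to another
  member of the class on the next domain. So two things must be supplied each time: continuity, and
  the values at t = 0. Since balls and annuli are clopen, maps can be cut off and glued freely. This
  produces the curves through sequences and allows a map given near one point of the plane to be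
  extended by zero. Hahn-Banach and uniform boundedness rest on the compactness of balls in K:
  families of pairwise intersecting balls have a common point, which gives extension values for
  functionals and pointwise limits of functionals. Weak smoothness forgets the topology of F and the
  values at t = 0. Continuity is recovered from the boundedness of (f(x + p^n y_n) - f(x)) / p^n
  with y_n tending to 0; a discontinuity would provide such y_n with large numerators, by
  metrizability. The values at t = 0 exist because the quotients at t and t' differ by t - t' times
  a second order quotient, and such quotients stay in a bounded set.\<close>

instance prod :: (topological_monoid_add, topological_monoid_add) topological_monoid_add
proof
  fix a b :: "'a \<times> 'b"
  have f: "(fst \<longlongrightarrow> a) (nhds a \<times>\<^sub>F nhds b)" "(snd \<longlongrightarrow> b) (nhds a \<times>\<^sub>F nhds b)"
    by (auto intro: filterlim_fst filterlim_snd)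
  have "((\<lambda>x. (fst (fst x) + fst (snd x), snd (fst x) + snd (snd x))) \<longlongrightarrow> (fst a + fst b, snd a + snd b))
      (nhds a \<times>\<^sub>F nhds b)"
    by (intro tendsto_intros f)
  then show "((\<lambda>x. fst x + snd x) \<longlongrightarrow> a + b) (nhds a \<times>\<^sub>F nhds b)"
    by (simp add: plus_prod_def case_prod_beta)
qed

instance prod :: (topological_comm_monoid_add, topological_comm_monoid_add) topological_comm_monoid_add ..

instance prod :: (topological_group_add, topological_group_add) topological_group_add
proof
  fix a :: "'a \<times> 'b"
  have i: "((\<lambda>x. x) \<longlongrightarrow> a) (nhds a)"
    by (rule filterlim_ident)
  have "((\<lambda>x. (- fst x, - snd x)) \<longlongrightarrow> (- fst a, - snd a)) (nhds a)"
    by (intro tendsto_intros i)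
  moreover have "(\<lambda>x. (- fst x, - snd x)) = (uminus :: 'a \<times> 'b \<Rightarrow> _)"
    by (auto simp: fun_eq_iff)
  ultimately show "(uminus \<longlongrightarrow> - a) (nhds a)"
    by (simp flip: uminus_prod_def)
qed

instance prod :: (topological_ab_group_add, topological_ab_group_add) topological_ab_group_add ..

section \<open>Function spaces with the product topology as Hausdorff topological groups\<close>

lemma tendsto_fun_iff:
  fixes f :: "'a \<Rightarrow> 'i \<Rightarrow> 'b::topological_space"
  shows "(f \<longlongrightarrow> l) F \<longleftrightarrow> (\<forall>i. ((\<lambda>x. f x i) \<longlongrightarrow> l i) F)"
proof -
  have "(f \<longlongrightarrow> l) F \<longleftrightarrow> limitin (product_topology (\<lambda>i. euclidean) UNIV) f l F"
    by (simp flip: euclidean_product_topology limitin_canonical_iff)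
  also have "\<dots> \<longleftrightarrow> (\<forall>i. ((\<lambda>x. f x i) \<longlongrightarrow> l i) F)"
    by (simp add: limitin_componentwise extensional_def)
  finally show ?thesis .
qed

lemma open_coordinate_vimage:
  fixes W :: "'b::topological_space set"
  shows "open W \<Longrightarrow> open ((\<lambda>z::'a \<Rightarrow> 'b. z i) -` W)"
  by (intro open_vimage) auto

instance "fun" :: (type, t0_space) t0_space
proof
  fix x y :: "'a \<Rightarrow> 'b" assume "x \<noteq> y"
  then obtain i where "x i \<noteq> y i" by auto
  then obtain U where "open U" "\<not> (x i \<in> U \<longleftrightarrow> y i \<in> U)"
    by (metis separation_t0)
  then show "\<exists>U. open U \<and> \<not> (x \<in> U \<longleftrightarrow> y \<in> U)"
    by (intro exI[of _ "(\<lambda>z. z i) -` U"]) (auto intro: open_coordinate_vimage)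
qed

instance "fun" :: (type, t1_space) t1_space
proof
  fix x y :: "'a \<Rightarrow> 'b" assume "x \<noteq> y"
  then obtain i where "x i \<noteq> y i" by auto
  then obtain U where "open U" "x i \<in> U" "y i \<notin> U"
    by (metis separation_t1)
  then show "\<exists>U. open U \<and> x \<in> U \<and> y \<notin> U"
    by (intro exI[of _ "(\<lambda>z. z i) -` U"]) (auto intro: open_coordinate_vimage)
qed

instance "fun" :: (type, t2_space) t2_space
proof
  fix x y :: "'a \<Rightarrow> 'b" assume "x \<noteq> y"
  then obtain i where "x i \<noteq> y i" by auto
  then obtain U V where "open U" "open V" "x i \<in> U" "y i \<in> V" "U \<inter> V = {}"
    by (metis separation_t2)
  then show "\<exists>U V. open U \<and> open V \<and> x \<in> U \<and> y \<in> V \<and> U \<inter> V = {}"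
    by (intro exI[of _ "(\<lambda>z. z i) -` U"] exI[of _ "(\<lambda>z. z i) -` V"]) (auto intro: open_coordinate_vimage)
qed

instance "fun" :: (type, topological_monoid_add) topological_monoid_add
proof
  fix a b :: "'a \<Rightarrow> 'b"
  have f: "(fst \<longlongrightarrow> a) (nhds a \<times>\<^sub>F nhds b)" "(snd \<longlongrightarrow> b) (nhds a \<times>\<^sub>F nhds b)"
    by (auto intro: filterlim_fst filterlim_snd)
  show "((\<lambda>x. fst x + snd x) \<longlongrightarrow> a + b) (nhds a \<times>\<^sub>F nhds b)"
    using f unfolding tendsto_fun_iff by (auto intro!: tendsto_add)
qed

instance "fun" :: (type, topological_comm_monoid_add) topological_comm_monoid_add ..

instance "fun" :: (type, topological_group_add) topological_group_add
proof
  fix a :: "'a \<Rightarrow> 'b"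
  have "((\<lambda>x. x) \<longlongrightarrow> a) (nhds a)"
    by (rule filterlim_ident)
  then show "(uminus \<longlongrightarrow> - a) (nhds a)"
    unfolding tendsto_fun_iff by (auto intro!: tendsto_minus)
qed

instance "fun" :: (type, topological_ab_group_add) topological_ab_group_add ..

text \<open>
  As simplification rules these expand sums of function-typed terms into abstractions, even where
  no argument is present, because instantiation of a function variable eta-expands it.
\<close>

lemmas fun_ops = plus_fun_apply zero_fun_apply minus_apply uminus_apply

declare fun_ops [simp del]


section \<open>Topological vector spaces\<close>

lemma tvs_tendsto:
  assumes "topological_vector_space s" "(f \<longlongrightarrow> a) F" "(g \<longlongrightarrow> x) F"
  shows "((\<lambda>t. s (f t) (g t)) \<longlongrightarrow> s a x) F"
proof -
  have "isCont (\<lambda>(a, x). s a x) (a, x)"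
    using topological_vector_space.continuous_on_scale[OF assms(1)]
    by (simp add: continuous_on_eq_continuous_at)
  from isCont_tendsto_compose[OF this tendsto_Pair[OF assms(2,3)]] show ?thesis
    by simp
qed

lemma tvs_continuous_on:
  assumes "topological_vector_space s" "continuous_on A f" "continuous_on A g"
  shows "continuous_on A (\<lambda>x. s (f x) (g x))"
  using assms unfolding continuous_on_def by (auto intro: tvs_tendsto)

lemma tvs_algebra:
  assumes "topological_vector_space s"
  shows "s a (x + y) = s a x + s a y" "s (a + b) x = s a x + s b x" "s a (s b x) = s (a * b) x"
    "s 1 x = x" "s 0 x = 0" "s a 0 = 0" "s (- a) x = - s a x" "s a (- x) = - s a x"
    "s a (x - y) = s a x - s a y" "s (a - b) x = s a x - s b x"
    "s a (sum f A) = (\<Sum>i\<in>A. s a (f i))"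
proof -
  interpret topological_vector_space s by fact
  show "s a (x + y) = s a x + s a y" "s (a + b) x = s a x + s b x" "s a (s b x) = s (a * b) x"
    "s 1 x = x" "s 0 x = 0" "s a 0 = 0" "s (- a) x = - s a x" "s a (- x) = - s a x"
    "s a (x - y) = s a x - s a y" "s (a - b) x = s a x - s b x"
    "s a (sum f A) = (\<Sum>i\<in>A. s a (f i))"
    by (simp_all add: scale_right_distrib scale_left_distrib scale_right_diff_distrib
        scale_left_diff_distrib scale_sum_right)
qed

lemma tvsI:
  fixes s :: "'k::topological_field \<Rightarrow> 'e::{topological_ab_group_add, t2_space} \<Rightarrow> 'e"
  assumes "\<And>a x y. s a (x + y) = s a x + s a y" "\<And>a b x. s (a + b) x = s a x + s b x"
    "\<And>a b x. s a (s b x) = s (a * b) x" "\<And>x. s 1 x = x"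
    "continuous_on UNIV (\<lambda>p. s (fst p) (snd p))"
  shows "topological_vector_space s"
  using assms by unfold_locales (simp_all add: case_prod_beta')

lemma tvs_mult [simp]: "topological_vector_space ((*) :: 'k \<Rightarrow> 'k \<Rightarrow> 'k::topological_field)"
  by (rule tvsI) (auto simp: algebra_simps intro!: continuous_intros)

definition pair_scale :: "('k \<Rightarrow> 'a \<Rightarrow> 'a) \<Rightarrow> ('k \<Rightarrow> 'b \<Rightarrow> 'b) \<Rightarrow> 'k \<Rightarrow> 'a \<times> 'b \<Rightarrow> 'a \<times> 'b" where
  "pair_scale s s' a p = (s a (fst p), s' a (snd p))"

lemma tvs_pair [simp]:
  assumes "topological_vector_space s" "topological_vector_space s'"
  shows "topological_vector_space (pair_scale s s')"
  unfolding pair_scale_def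
  by (rule tvsI)
    (auto simp: tvs_algebra[OF assms(1)] tvs_algebra[OF assms(2)]
      intro!: continuous_intros tvs_continuous_on[OF assms(1)] tvs_continuous_on[OF assms(2)])

lemma scale_plane_eq: "scale_plane = pair_scale (*) (*)"
  by (simp add: fun_eq_iff scale_plane_def pair_scale_def)

definition cont_linear ::
  "('k \<Rightarrow> 'a::{plus,topological_space} \<Rightarrow> 'a) \<Rightarrow> ('k \<Rightarrow> 'b::{plus,topological_space} \<Rightarrow> 'b) \<Rightarrow> ('a \<Rightarrow> 'b) \<Rightarrow> bool" where
  "cont_linear s s' A \<longleftrightarrow>
     (\<forall>x y. A (x + y) = A x + A y) \<and> (\<forall>a x. A (s a x) = s' a (A x)) \<and> continuous_on UNIV A"

lemma cont_linearI:
  assumes "\<And>x y. A (x + y) = A x + A y" "\<And>a x. A (s a x) = s' a (A x)" "continuous_on UNIV A"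
  shows "cont_linear s s' A"
  using assms by (simp add: cont_linear_def)

lemma cont_linearD:
  assumes "cont_linear s s' A"
  shows "A (x + y) = A x + A y" "A (s a x) = s' a (A x)" "continuous_on S A"
  using assms continuous_on_subset by (auto simp: cont_linear_def)

lemma cont_linear_diff:
  fixes A :: "'a::{ab_group_add,topological_space} \<Rightarrow> 'b::{ab_group_add,topological_space}"
  assumes "cont_linear s s' A"
  shows "A (x - y) = A x - A y" "A 0 = 0"
proof -
  have *: "A (x + y) = A x + A y" for x y
    using assms by (simp add: cont_linear_def)
  show "A (x - y) = A x - A y" using *[of "x - y" y] by (simp add: algebra_simps)
  show "A 0 = 0" using *[of 0 0] by simp
qed

lemma cont_linear_comp: "cont_linear s s' A \<Longrightarrow> cont_linear s' s'' B \<Longrightarrow> cont_linear s s'' (\<lambda>x. B (A x))"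
  by (auto simp: cont_linear_def intro!: continuous_on_compose2[of UNIV B])

lemma cont_linear_continuous_compose:
  "cont_linear s s' A \<Longrightarrow> continuous_on V f \<Longrightarrow> continuous_on V (\<lambda>x. A (f x))"
  by (auto simp: cont_linear_def intro!: continuous_on_compose2[of UNIV A])

lemma cont_linear_tendsto:
  assumes "cont_linear s s' A" "(f \<longlongrightarrow> l) F"
  shows "((\<lambda>x. A (f x)) \<longlongrightarrow> A l) F"
  using continuous_on_tendsto_compose[of UNIV A f l F] assms by (simp add: cont_linear_def)

text \<open>If 0 were isolated, translations would make every point isolated and the field discrete.
  Limits at 0 are therefore unique.\<close>

lemma at_0_neq_bot [simp]: "at (0::'k::local_field) \<noteq> bot"
proof
  assume "at (0::'k) = bot"
  then have "open {0::'k}" by (simp add: at_eq_bot_iff)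
  have "open {a}" for a :: 'k
  proof -
    have "open ((\<lambda>x. x - a) -` {0::'k})"
      by (rule open_vimage[OF \<open>open {0}\<close>]) (intro continuous_intros)
    moreover have "(\<lambda>x. x - a) -` {0::'k} = {a}" by auto
    ultimately show ?thesis by simp
  qed
  then have "open (\<Union>a\<in>S. {a})" for S :: "'k set" by blast
  then show False using not_discrete[where 'a='k] by simp
qed

section \<open>Iterated difference quotients in a universal space\<close>

text \<open>
  The space \<open>X = (B \<times> K)\<^sup>\<nat>\<close> has \<open>X \<times> X \<times> K\<close> as a retract and contains \<open>B\<close> as a retract. Hence all
  the iterated domains live in a single topological vector space, and smoothness can be
  proved by coinduction.
\<close>

definition uscale :: "('k \<Rightarrow> 'b \<Rightarrow> 'b) \<Rightarrow> 'k \<Rightarrow> (nat \<Rightarrow> 'b \<times> 'k::times) \<Rightarrow> nat \<Rightarrow> 'b \<times> 'k" where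
  "uscale s a z = (\<lambda>n. pair_scale s (*) a (z n))"

text \<open>The indices are split by residues modulo 3: residue 0 stores the base point, residue 1
  the direction, and the parameter is the field coordinate at index 2.\<close>

definition ubase :: "(nat \<Rightarrow> 'b \<times> 'k) \<Rightarrow> nat \<Rightarrow> 'b \<times> 'k" where
  "ubase z = (\<lambda>n. z (3 * n))"

definition udir :: "(nat \<Rightarrow> 'b \<times> 'k) \<Rightarrow> nat \<Rightarrow> 'b \<times> 'k" where
  "udir z = (\<lambda>n. z (3 * n + 1))"

definition upar :: "(nat \<Rightarrow> 'b \<times> 'k) \<Rightarrow> 'k" where
  "upar z = snd (z 2)"

text \<open>A linear right inverse of the projection \<open>(ubase, udir, upar)\<close>, so triples
  form a retract of X. It is not a two-sided inverse, since the projection forgets most entries of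
  residue 2.\<close>

definition uinc :: "(nat \<Rightarrow> 'b::zero \<times> 'k) \<Rightarrow> (nat \<Rightarrow> 'b \<times> 'k) \<Rightarrow> 'k \<Rightarrow> nat \<Rightarrow> 'b \<times> 'k" where
  "uinc x y t = (\<lambda>n. if n mod 3 = 0 then x (n div 3) else if n mod 3 = 1 then y (n div 3) else (0, t))"

definition uemb :: "'b \<Rightarrow> nat \<Rightarrow> 'b \<times> 'k::zero" where
  "uemb x = (\<lambda>n. (x, 0))"

definition uret :: "(nat \<Rightarrow> 'b \<times> 'k) \<Rightarrow> 'b" where
  "uret z = fst (z 0)"

lemma uinc_simps [simp]: "ubase (uinc x y t) = x" "udir (uinc x y t) = y" "upar (uinc x y t) = t"
proof -
  have "(3 * n + 1) mod 3 = 1" "(3 * n + 1) div 3 = n" for n :: nat by presburger+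
  then show "udir (uinc x y t) = y"
    unfolding udir_def uinc_def by (simp only: if_False one_neq_zero if_True refl)
qed (simp_all add: ubase_def upar_def uinc_def fun_eq_iff fun_ops)

lemma uret_uemb [simp]: "uret (uemb x) = x"
  by (simp add: uret_def uemb_def)

lemma tvs_uscale [simp]:
  assumes "topological_vector_space s"
  shows "topological_vector_space (uscale s)"
proof -
  note t = tvs_pair[OF assms tvs_mult]
  show ?thesis
    unfolding uscale_def
    by (rule tvsI)
      (auto simp: fun_eq_iff fun_ops tvs_algebra[OF t]
        intro!: continuous_on_coordinatewise_then_product tvs_continuous_on[OF t] continuous_intros
          continuous_on_compose2[OF continuous_on_product_coordinates continuous_on_snd])
qed

lemma cont_linear_ubase [simp]: "cont_linear (uscale s) (uscale s) ubase"
  by (rule cont_linearI)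
    (auto simp: ubase_def uscale_def fun_eq_iff fun_ops intro!: continuous_on_coordinatewise_then_product)

lemma cont_linear_udir [simp]: "cont_linear (uscale s) (uscale s) udir"
  by (rule cont_linearI)
    (auto simp: udir_def uscale_def fun_eq_iff fun_ops intro!: continuous_on_coordinatewise_then_product)

lemma cont_linear_upar [simp]: "cont_linear (uscale s) (*) upar"
  by (rule cont_linearI)
    (auto simp: upar_def uscale_def fun_eq_iff fun_ops pair_scale_def intro!: continuous_on_snd)

lemma cont_linear_uret [simp]: "cont_linear (uscale s) s uret"
  by (rule cont_linearI)
    (auto simp: uret_def uscale_def fun_eq_iff fun_ops pair_scale_def intro!: continuous_on_fst)

lemma cont_linear_uemb [simp]:
  fixes s :: "'k::topological_field \<Rightarrow> 'b::{plus,topological_space} \<Rightarrow> 'b"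
  shows "cont_linear s (uscale s) uemb"
proof (rule cont_linearI)
  show "continuous_on UNIV (uemb :: 'b \<Rightarrow> nat \<Rightarrow> 'b \<times> 'k)"
    unfolding uemb_def
    by (intro continuous_on_coordinatewise_then_product continuous_on_Pair continuous_on_id continuous_on_const)
qed (simp_all add: uemb_def uscale_def fun_eq_iff fun_ops pair_scale_def)

lemma continuous_on_uinc:
  assumes "continuous_on S f" "continuous_on S g" "continuous_on S h"
  shows "continuous_on S (\<lambda>x. uinc (f x) (g x) (h x))"
proof (rule continuous_on_coordinatewise_then_product)
  fix n
  show "continuous_on S (\<lambda>x. uinc (f x) (g x) (h x) n)"
    using continuous_on_product_then_coordinatewise[OF assms(1), of "n div 3"]
      continuous_on_product_then_coordinatewise[OF assms(2), of "n div 3"]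
      continuous_on_Pair[OF continuous_on_const assms(3), of 0]
    by (cases "n mod 3 = 0"; cases "n mod 3 = 1") (simp_all add: uinc_def)
qed

lemma uinc_add:
  fixes x :: "nat \<Rightarrow> 'b::monoid_add \<times> 'k::plus"
  shows "uinc x y t + uinc x' y' t' = uinc (x + x') (y + y') (t + t')"
  by (auto simp: uinc_def fun_eq_iff fun_ops)

lemma uinc_scale:
  assumes "topological_vector_space s"
  shows "uscale s a (uinc x y t) = uinc (uscale s a x) (uscale s a y) (a * t)"
  by (auto simp: uinc_def uscale_def fun_eq_iff fun_ops pair_scale_def tvs_algebra[OF assms])

lemma cont_linear_uinc:
  assumes s: "topological_vector_space s"
    and "cont_linear r (uscale s) A" "cont_linear r (uscale s) B" "cont_linear r (*) C"
  shows "cont_linear r (uscale s) (\<lambda>x. uinc (A x) (B x) (C x))"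
proof (rule cont_linearI)
  show "continuous_on UNIV (\<lambda>x. uinc (A x) (B x) (C x))"
    using assms by (intro continuous_on_uinc) (auto simp: cont_linear_def)
qed (use assms(2-) in \<open>simp_all add: uinc_add uinc_scale[OF s] cont_linear_def\<close>)

definition ustep :: "('k \<Rightarrow> 'b \<Rightarrow> 'b) \<Rightarrow> (nat \<Rightarrow> 'b::plus \<times> 'k::{plus,times}) \<Rightarrow> nat \<Rightarrow> 'b \<times> 'k" where
  "ustep s z = ubase z + uscale s (upar z) (udir z)"

definition uext ::
  "('k \<Rightarrow> 'b \<Rightarrow> 'b) \<Rightarrow> (nat \<Rightarrow> 'b::plus \<times> 'k::{plus,times}) set \<Rightarrow> (nat \<Rightarrow> 'b \<times> 'k) set" where
  "uext s V = {z. ubase z \<in> V \<and> ustep s z \<in> V}"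

text \<open>The value at parameter 0 is a default when the limit fails to exist. Continuity of
  \<open>udq s s' f\<close> on \<open>uext s V\<close>, V open, excludes that case: near such a
  point the parameter can be varied alone, and the quotients must then converge.\<close>

definition udq ::
  "('k::topological_field \<Rightarrow> 'b \<Rightarrow> 'b) \<Rightarrow> ('k \<Rightarrow> 'f \<Rightarrow> 'f) \<Rightarrow> ((nat \<Rightarrow> 'b::plus \<times> 'k) \<Rightarrow> 'f::{ab_group_add,t2_space})
    \<Rightarrow> (nat \<Rightarrow> 'b \<times> 'k) \<Rightarrow> 'f" where
  "udq s s' f z =
     (let q = \<lambda>t. s' (1 / t) (f (ubase z + uscale s t (udir z)) - f (ubase z))
      in if upar z \<noteq> 0 then q (upar z) else Lim (at 0) q)"

definition usmooth ::
  "('k::topological_field \<Rightarrow> 'b \<Rightarrow> 'b) \<Rightarrow> ('k \<Rightarrow> 'f \<Rightarrow> 'f) \<Rightarrow> (nat \<Rightarrow> 'b::{plus,topological_space} \<times> 'k) set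
    \<Rightarrow> ((nat \<Rightarrow> 'b \<times> 'k) \<Rightarrow> 'f::{ab_group_add,t2_space}) \<Rightarrow> bool" where
  "usmooth s s' V f \<longleftrightarrow> (\<forall>k. continuous_on ((uext s ^^ k) V) ((udq s s' ^^ k) f))"

lemma in_uext_iff: "z \<in> uext s V \<longleftrightarrow> ubase z \<in> V \<and> ustep s z \<in> V"
  by (simp add: uext_def)

lemma udq_nonzero: "upar z \<noteq> 0 \<Longrightarrow> udq s s' f z = s' (1 / upar z) (f (ustep s z) - f (ubase z))"
  by (simp add: udq_def ustep_def Let_def)

lemma continuous_on_ustep:
  assumes "topological_vector_space s"
  shows "continuous_on S (ustep s)"
  unfolding ustep_def
  by (intro continuous_intros tvs_continuous_on[OF tvs_uscale[OF assms]]
     cont_linearD[OF cont_linear_ubase] cont_linearD[OF cont_linear_udir] cont_linearD[OF cont_linear_upar])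

lemma open_uext:
  assumes "topological_vector_space s" "open V"
  shows "open (uext s V)"
proof -
  have "uext s V = ubase -` V \<inter> ustep s -` V" by (auto simp: uext_def)
  then show ?thesis
    using assms continuous_on_ustep[OF assms(1), of UNIV] cont_linearD(3)[OF cont_linear_ubase, of UNIV]
    by (auto intro!: open_Int open_vimage)
qed

lemma uext_mono: "W \<subseteq> V \<Longrightarrow> uext s W \<subseteq> uext s V"
  by (auto simp: uext_def)

lemma ustep_upar_0:
  assumes "topological_vector_space s" "upar z = 0"
  shows "ustep s z = ubase z"
  using assms(2) by (simp add: ustep_def tvs_algebra[OF tvs_uscale[OF assms(1)]])

text \<open>Openness of V matters at parameter 0: only then does the limit see nothing but values of
  the function on V.\<close>

lemma udq_cong:
  fixes s :: "'k::local_field \<Rightarrow> 'b::{topological_ab_group_add,t2_space} \<Rightarrow> 'b"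
  assumes s: "topological_vector_space s" and V: "open V" and eq: "\<And>x. x \<in> V \<Longrightarrow> f x = g x"
    and z: "z \<in> uext s V"
  shows "udq s s' f z = udq s s' g z"
proof (cases "upar z = 0")
  case False
  then show ?thesis using z eq by (auto simp: udq_nonzero uext_def)
next
  case True
  have b: "ubase z \<in> V" using z by (simp add: uext_def)
  have "((\<lambda>t. ubase z + uscale s t (udir z)) \<longlongrightarrow> ubase z + uscale s 0 (udir z)) (at 0)"
    by (intro tendsto_intros tvs_tendsto[OF tvs_uscale[OF s]])
  then have "((\<lambda>t. ubase z + uscale s t (udir z)) \<longlongrightarrow> ubase z) (at 0)"
    by (simp add: tvs_algebra[OF tvs_uscale[OF s]])
  then have ev: "\<forall>\<^sub>F t in at 0. ubase z + uscale s t (udir z) \<in> V"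
    using V b by (rule topological_tendstoD)
  have "((\<lambda>t. s' (1 / t) (f (ubase z + uscale s t (udir z)) - f (ubase z))) \<longlongrightarrow> l) (at 0) \<longleftrightarrow>
    ((\<lambda>t. s' (1 / t) (g (ubase z + uscale s t (udir z)) - g (ubase z))) \<longlongrightarrow> l) (at 0)" for l
    by (rule tendsto_cong, rule eventually_mono[OF ev]) (use eq b in simp)
  then show ?thesis using True by (simp add: udq_def t2_space_class.Lim_def)
qed

text \<open>A point with parameter 0 is approached along \<open>z + uinc 0 0 t\<close>, which
  changes the parameter only. There g is the quotient, so its continuity yields the limit in
  \<open>udq\<close>.\<close>

lemma udq_unique:
  fixes s :: "'k::local_field \<Rightarrow> 'b::{topological_ab_group_add,t2_space} \<Rightarrow> 'b"
  assumes s: "topological_vector_space s" and V: "open V" and g: "continuous_on (uext s V) g"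
    and q: "\<And>z. z \<in> uext s V \<Longrightarrow> upar z \<noteq> 0 \<Longrightarrow> g z = s' (1 / upar z) (f (ustep s z) - f (ubase z))"
    and z: "z \<in> uext s V"
  shows "udq s s' f z = g z"
proof (cases "upar z = 0")
  case False
  then show ?thesis using q[OF z] by (auto simp: udq_nonzero)
next
  case True
  define c where "c t = z + uinc 0 0 t" for t
  have c: "ubase (c t) = ubase z" "udir (c t) = udir z" "upar (c t) = t" for t
    using True by (simp_all add: c_def cont_linearD[OF cont_linear_ubase]
        cont_linearD[OF cont_linear_udir] cont_linearD[OF cont_linear_upar])
  have "isCont c 0"
  proof -
    have "continuous_on UNIV c"
      unfolding c_def by (intro continuous_on_add continuous_on_uinc continuous_intros)
    then show ?thesis by (simp add: continuous_on_eq_continuous_at)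
  qed
  moreover have "uinc 0 0 0 = (0 :: nat \<Rightarrow> 'b \<times> 'k)" by (auto simp: uinc_def fun_eq_iff fun_ops zero_prod_def)
  ultimately have lim: "(c \<longlongrightarrow> z) (at 0)" by (simp add: isCont_def c_def)
  then have ev: "\<forall>\<^sub>F t in at 0. c t \<in> uext s V"
    by (rule topological_tendstoD[OF _ open_uext[OF s V] z])
  have "((\<lambda>t. g (c t)) \<longlongrightarrow> g z) (at 0)"
    using continuous_on_tendsto_compose[OF g lim z ev] .
  moreover have "\<forall>\<^sub>F t in at 0. g (c t) = s' (1 / t) (f (ubase z + uscale s t (udir z)) - f (ubase z))"
    using ev eventually_neq_at_within[of "0::'k" 0 UNIV]
    by eventually_elim (use q[of "c _"] in \<open>simp add: c ustep_def\<close>)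
  ultimately have "((\<lambda>t. s' (1 / t) (f (ubase z + uscale s t (udir z)) - f (ubase z))) \<longlongrightarrow> g z) (at 0)"
    using tendsto_cong by fast
  then show ?thesis using True by (simp add: udq_def tendsto_Lim)
qed

lemma funpow_udq_cong:
  fixes s :: "'k::local_field \<Rightarrow> 'b::{topological_ab_group_add,t2_space} \<Rightarrow> 'b"
  assumes s: "topological_vector_space s" and V: "open V" and eq: "\<And>x. x \<in> V \<Longrightarrow> f x = g x"
  shows "open ((uext s ^^ k) V) \<and> (\<forall>z\<in>(uext s ^^ k) V. (udq s s' ^^ k) f z = (udq s s' ^^ k) g z)"
proof (induction k)
  case 0
  then show ?case using V eq by simp
next
  case (Suc k)
  then show ?case using open_uext[OF s] by (auto intro!: udq_cong[OF s, of "(uext s ^^ k) V"])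
qed

lemma usmooth_cong:
  fixes s :: "'k::local_field \<Rightarrow> 'b::{topological_ab_group_add,t2_space} \<Rightarrow> 'b"
  assumes s: "topological_vector_space s" and V: "open V" and eq: "\<And>x. x \<in> V \<Longrightarrow> f x = g x"
  shows "usmooth s s' V f \<longleftrightarrow> usmooth s s' V g"
  unfolding usmooth_def using funpow_udq_cong[OF assms]
  by (auto cong: continuous_on_cong)

lemma usmooth_unfold:
  "usmooth s s' V f \<longleftrightarrow> continuous_on V f \<and> usmooth s s' (uext s V) (udq s s' f)"
  unfolding usmooth_def
proof safe
  fix k
  assume *: "\<forall>k. continuous_on ((uext s ^^ k) V) ((udq s s' ^^ k) f)"
  show "continuous_on V f" using *[rule_format, of 0] by simp
  show "continuous_on ((uext s ^^ k) (uext s V)) ((udq s s' ^^ k) (udq s s' f))"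
    using *[rule_format, of "Suc k"] by (simp add: funpow_Suc_right del: funpow.simps)
next
  fix k
  assume "continuous_on V f" "\<forall>k. continuous_on ((uext s ^^ k) (uext s V)) ((udq s s' ^^ k) (udq s s' f))"
  then show "continuous_on ((uext s ^^ k) V) ((udq s s' ^^ k) f)"
    by (cases k) (simp_all add: funpow_Suc_right del: funpow.simps(2))
qed

lemma usmooth_continuous: "usmooth s s' V f \<Longrightarrow> continuous_on V f"
  using usmooth_unfold by blast

lemma usmooth_udq: "usmooth s s' V f \<Longrightarrow> usmooth s s' (uext s V) (udq s s' f)"
  using usmooth_unfold by blast

lemma usmooth_subset:
  assumes "usmooth s s' V f" "W \<subseteq> V"
  shows "usmooth s s' W f"
proof -
  have "(uext s ^^ k) W \<subseteq> (uext s ^^ k) V" for k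
    by (induction k) (use assms(2) in \<open>auto dest: uext_mono\<close>)
  then show ?thesis using assms(1) continuous_on_subset unfolding usmooth_def by blast
qed

text \<open>The next member g of the class is compared with the quotient at nonzero parameters only.
  Being in the class, g is continuous, and uniqueness identifies it with \<open>udq s s' f\<close>;
  no limit has to be computed when a formula for the extension is known.\<close>

lemma usmooth_coinduct:
  fixes s :: "'k::local_field \<Rightarrow> 'b::{topological_ab_group_add,t2_space} \<Rightarrow> 'b"
  assumes s: "topological_vector_space s" and "R V f"
    and step: "\<And>V f. R V f \<Longrightarrow> open V \<and> continuous_on V f \<and> (\<exists>g. R (uext s V) g \<and>
      (\<forall>z\<in>uext s V. upar z \<noteq> 0 \<longrightarrow> g z = s' (1 / upar z) (f (ustep s z) - f (ubase z))))"
  shows "usmooth s s' V f"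
proof -
  have "continuous_on ((uext s ^^ k) V) ((udq s s' ^^ k) f)" for k
    using \<open>R V f\<close>
  proof (induction k arbitrary: V f)
    case 0
    then show ?case using step by simp
  next
    case (Suc k)
    obtain g where V: "open V" and R: "R (uext s V) g" and
      g: "\<forall>z\<in>uext s V. upar z \<noteq> 0 \<longrightarrow> g z = s' (1 / upar z) (f (ustep s z) - f (ubase z))"
      using step[OF Suc.prems] by blast
    have "udq s s' f z = g z" if "z \<in> uext s V" for z
      using udq_unique[OF s V _ _ that] step[OF R] g by blast
    from funpow_udq_cong[OF s open_uext[OF s V] this] Suc.IH[OF R]
    show ?case by (auto simp: funpow_Suc_right simp del: funpow.simps cong: continuous_on_cong)
  qed
  then show ?thesis by (simp add: usmooth_def)
qed

section \<open>Closure properties of smooth maps on the universal space\<close>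

text \<open>The difference quotient of an affine map is its linear part applied to the direction,
  again an affine map. The constant c is carried along so that constant maps are covered.\<close>

lemma usmooth_affine:
  fixes s :: "'k::local_field \<Rightarrow> 'b::{topological_ab_group_add,t2_space} \<Rightarrow> 'b"
    and s' :: "'k \<Rightarrow> 'f::{topological_ab_group_add,t2_space} \<Rightarrow> 'f"
  assumes s: "topological_vector_space s" and s': "topological_vector_space s'"
    and "open V" "cont_linear (uscale s) s' A"
  shows "usmooth s s' V (\<lambda>z. A z + c)"
proof (rule usmooth_coinduct[OF s, where R = "\<lambda>V f. open V \<and> (\<exists>A c. cont_linear (uscale s) s' A \<and> f = (\<lambda>z. A z + c))"])
  fix V :: "(nat \<Rightarrow> 'b \<times> 'k) set" and f
  assume "open V \<and> (\<exists>A c. cont_linear (uscale s) s' A \<and> f = (\<lambda>z. A z + c))"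
  then obtain A c where V: "open V" and A: "cont_linear (uscale s) s' A" and f: "f = (\<lambda>z. A z + c)" by blast
  have "continuous_on V f"
    unfolding f by (intro continuous_intros cont_linearD[OF A])
  moreover have "cont_linear (uscale s) s' (\<lambda>z. A (udir z))"
    by (rule cont_linear_comp[OF cont_linear_udir A])
  moreover have "A (udir z) = s' (1 / upar z) (f (ustep s z) - f (ubase z))" if "upar z \<noteq> 0" for z
    using that by (simp add: f ustep_def cont_linearD[OF A] tvs_algebra[OF s'])
  ultimately show "open V \<and> continuous_on V f \<and>
    (\<exists>g. (open (uext s V) \<and> (\<exists>A c. cont_linear (uscale s) s' A \<and> g = (\<lambda>z. A z + c))) \<and>
       (\<forall>z\<in>uext s V. upar z \<noteq> 0 \<longrightarrow> g z = s' (1 / upar z) (f (ustep s z) - f (ubase z))))"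
    using V open_uext[OF s V] by (intro conjI exI[of _ "\<lambda>z. A (udir z)"] exI[of _ "0::'f"]) auto
qed (use assms in blast)

lemma usmooth_linear:
  fixes s :: "'k::local_field \<Rightarrow> 'b::{topological_ab_group_add,t2_space} \<Rightarrow> 'b"
    and s' :: "'k \<Rightarrow> 'f::{topological_ab_group_add,t2_space} \<Rightarrow> 'f"
  assumes "topological_vector_space s" "topological_vector_space s'" "open V" "cont_linear (uscale s) s' A"
  shows "usmooth s s' V A"
  using usmooth_affine[OF assms, of 0] by simp

lemma usmooth_const:
  fixes s :: "'k::local_field \<Rightarrow> 'b::{topological_ab_group_add,t2_space} \<Rightarrow> 'b"
    and s' :: "'k \<Rightarrow> 'f::{topological_ab_group_add,t2_space} \<Rightarrow> 'f"
  assumes s: "topological_vector_space s" and s': "topological_vector_space s'" and "open V"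
  shows "usmooth s s' V (\<lambda>z. c)"
proof -
  have "cont_linear (uscale s) s' (\<lambda>z. 0)"
    by (rule cont_linearI) (auto simp: tvs_algebra[OF s'])
  from usmooth_affine[OF assms this, of c] show ?thesis by simp
qed

lemma usmooth_precompose_linear:
  fixes s :: "'k::local_field \<Rightarrow> 'b::{topological_ab_group_add,t2_space} \<Rightarrow> 'b"
    and r :: "'k \<Rightarrow> 'c::{topological_ab_group_add,t2_space} \<Rightarrow> 'c"
    and s' :: "'k \<Rightarrow> 'f::{topological_ab_group_add,t2_space} \<Rightarrow> 'f"
  assumes s: "topological_vector_space s" and r: "topological_vector_space r"
    and "open V" "open W" "cont_linear (uscale s) (uscale r) A" "\<And>z. z \<in> V \<Longrightarrow> A z \<in> W" "usmooth r s' W f"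
  shows "usmooth s s' V (\<lambda>z. f (A z))"
proof -
  define R where "R V f \<longleftrightarrow> open V \<and> (\<exists>W g A. open W \<and> (\<forall>z\<in>V. A z \<in> W) \<and>
    cont_linear (uscale s) (uscale r) A \<and> usmooth r s' W g \<and> f = (\<lambda>z. g (A z)))" for V f
  show ?thesis
  proof (rule usmooth_coinduct[OF s, where R = R])
    show "R V (\<lambda>z. f (A z))" unfolding R_def using assms by blast
    fix V f assume "R V f"
    then obtain W g A where V: "open V" and W: "open W" and AV: "\<And>z. z \<in> V \<Longrightarrow> A z \<in> W"
      and A: "cont_linear (uscale s) (uscale r) A" and g: "usmooth r s' W g" and f: "f = (\<lambda>z. g (A z))"
      unfolding R_def by blast
    have c: "continuous_on V f"
      unfolding f using AV
      by (intro continuous_on_compose2[OF usmooth_continuous[OF g]] cont_linearD[OF A]) auto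
    \<comment> \<open>The map (x, y, t) -> (A x, A y, t), again linear; the quotient of
      \<open>g\<close> composed with \<open>A\<close> is the quotient of \<open>g\<close> composed
      with this map.\<close>
    define A' where "A' z = uinc (A (ubase z)) (A (udir z)) (upar z)" for z
    have A': "cont_linear (uscale s) (uscale r) A'"
      unfolding A'_def
      by (intro cont_linear_uinc[OF r] cont_linear_comp[OF _ A] cont_linear_ubase cont_linear_udir cont_linear_upar)
    have st: "ustep r (A' z) = A (ustep s z)" "ubase (A' z) = A (ubase z)" "upar (A' z) = upar z" for z
      by (simp_all add: A'_def ustep_def cont_linearD[OF A])
    have "R (uext s V) (\<lambda>z. udq r s' g (A' z))"
      unfolding R_def
      using open_uext[OF s V] open_uext[OF r W] A' usmooth_udq[OF g] AV
      by (intro conjI exI[of _ "uext r W"] exI[of _ "udq r s' g"] exI[of _ A']) (auto simp: uext_def st)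
    moreover have "udq r s' g (A' z) = s' (1 / upar z) (f (ustep s z) - f (ubase z))" if "upar z \<noteq> 0" for z
      using that by (simp add: udq_nonzero st f)
    ultimately show "open V \<and> continuous_on V f \<and> (\<exists>g. R (uext s V) g \<and>
      (\<forall>z\<in>uext s V. upar z \<noteq> 0 \<longrightarrow> g z = s' (1 / upar z) (f (ustep s z) - f (ubase z))))"
      using V c by blast
  qed
qed

lemma usmooth_postcompose_linear:
  fixes s :: "'k::local_field \<Rightarrow> 'b::{topological_ab_group_add,t2_space} \<Rightarrow> 'b"
    and s' :: "'k \<Rightarrow> 'f::{topological_ab_group_add,t2_space} \<Rightarrow> 'f"
    and s'' :: "'k \<Rightarrow> 'g::{topological_ab_group_add,t2_space} \<Rightarrow> 'g"
  assumes s: "topological_vector_space s"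
    and "open V" and A: "cont_linear s' s'' A" and "usmooth s s' V f"
  shows "usmooth s s'' V (\<lambda>z. A (f z))"
proof (rule usmooth_coinduct[OF s, where R = "\<lambda>V f. open V \<and> (\<exists>g. usmooth s s' V g \<and> f = (\<lambda>z. A (g z)))"])
  fix V f assume "open V \<and> (\<exists>g. usmooth s s' V g \<and> f = (\<lambda>z. A (g z)))"
  then obtain g where V: "open V" and g: "usmooth s s' V g" and f: "f = (\<lambda>z. A (g z))" by blast
  have "continuous_on V f"
    unfolding f by (intro cont_linear_continuous_compose[OF A] usmooth_continuous[OF g])
  moreover have "A (udq s s' g z) = s'' (1 / upar z) (f (ustep s z) - f (ubase z))" if "upar z \<noteq> 0" for z
    using that by (simp add: f udq_nonzero cont_linearD[OF A] cont_linear_diff[OF A])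
  ultimately show "open V \<and> continuous_on V f \<and>
    (\<exists>f'. (open (uext s V) \<and> (\<exists>g. usmooth s s' (uext s V) g \<and> f' = (\<lambda>z. A (g z)))) \<and>
       (\<forall>z\<in>uext s V. upar z \<noteq> 0 \<longrightarrow> f' z = s'' (1 / upar z) (f (ustep s z) - f (ubase z))))"
    using V open_uext[OF s V] usmooth_udq[OF g] by (intro conjI exI[of _ "\<lambda>z. A (udq s s' g z)"]) blast+
qed (use assms in blast)

lemma usmooth_add:
  fixes s :: "'k::local_field \<Rightarrow> 'b::{topological_ab_group_add,t2_space} \<Rightarrow> 'b"
    and s' :: "'k \<Rightarrow> 'f::{topological_ab_group_add,t2_space} \<Rightarrow> 'f"
  assumes s: "topological_vector_space s" and s': "topological_vector_space s'"
    and "open V" "usmooth s s' V f" "usmooth s s' V g"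
  shows "usmooth s s' V (\<lambda>z. f z + g z)"
proof -
  define R where "R V h \<longleftrightarrow> open V \<and> (\<exists>f g. usmooth s s' V f \<and> usmooth s s' V g \<and> h = (\<lambda>z. f z + g z))" for V h
  show ?thesis
  proof (rule usmooth_coinduct[OF s, where R = R])
    show "R V (\<lambda>z. f z + g z)" unfolding R_def using assms by blast
    fix V h assume "R V h"
    then obtain f g where V: "open V" and f: "usmooth s s' V f" and g: "usmooth s s' V g"
      and h: "h = (\<lambda>z. f z + g z)" unfolding R_def by blast
    have "continuous_on V h"
      unfolding h using f g by (intro continuous_intros usmooth_continuous)
    moreover have "R (uext s V) (\<lambda>z. udq s s' f z + udq s s' g z)"
      unfolding R_def using open_uext[OF s V] usmooth_udq[OF f] usmooth_udq[OF g] by blast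
    moreover have "udq s s' f z + udq s s' g z = s' (1 / upar z) (h (ustep s z) - h (ubase z))"
      if "upar z \<noteq> 0" for z
      using that by (simp add: udq_nonzero h tvs_algebra(1,9)[OF s'])
    ultimately show "open V \<and> continuous_on V h \<and> (\<exists>g. R (uext s V) g \<and>
      (\<forall>z\<in>uext s V. upar z \<noteq> 0 \<longrightarrow> g z = s' (1 / upar z) (h (ustep s z) - h (ubase z))))"
      using V by blast
  qed
qed

lemma usmooth_uinc:
  fixes s :: "'k::local_field \<Rightarrow> 'b::{topological_ab_group_add,t2_space} \<Rightarrow> 'b"
    and r :: "'k \<Rightarrow> 'c::{topological_ab_group_add,t2_space} \<Rightarrow> 'c"
  assumes s: "topological_vector_space s" and r: "topological_vector_space r" and V: "open V"
    and "usmooth s (uscale r) V f" "usmooth s (uscale r) V g" "usmooth s (*) V h"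
  shows "usmooth s (uscale r) V (\<lambda>z. uinc (f z) (g z) (h z))"
proof -
  note ur = tvs_uscale[OF r]
  have 0: "cont_linear q (uscale r) (\<lambda>x. 0)" "cont_linear q (*) (\<lambda>x. 0)"
    for q :: "'k \<Rightarrow> 'd::{topological_ab_group_add,t2_space} \<Rightarrow> 'd"
    by (rule cont_linearI, auto simp: tvs_algebra[OF ur])+
  have i: "cont_linear q q (\<lambda>x. x)" for q :: "'k \<Rightarrow> 'd::{topological_ab_group_add,t2_space} \<Rightarrow> 'd"
    by (rule cont_linearI) auto
  have "usmooth s (uscale r) V (\<lambda>z. uinc (f z) 0 0 + uinc 0 (g z) 0 + uinc 0 0 (h z))"
    by (intro usmooth_add[OF s ur V] usmooth_postcompose_linear[OF s V _ assms(4), of _ "\<lambda>x. uinc x 0 0"]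
        usmooth_postcompose_linear[OF s V _ assms(5), of _ "\<lambda>x. uinc 0 x 0"]
        usmooth_postcompose_linear[OF s V _ assms(6), of _ "\<lambda>x. uinc 0 0 x"]
        cont_linear_uinc[OF r] 0 i)
  then show ?thesis by (simp add: uinc_add)
qed

lemma usmooth_comp_ubase:
  fixes s :: "'k::local_field \<Rightarrow> 'b::{topological_ab_group_add,t2_space} \<Rightarrow> 'b"
    and s' :: "'k \<Rightarrow> 'f::{topological_ab_group_add,t2_space} \<Rightarrow> 'f"
  assumes "topological_vector_space s" "open V" "usmooth s s' V f"
  shows "usmooth s s' (uext s V) (\<lambda>z. f (ubase z))"
  by (rule usmooth_precompose_linear[OF assms(1,1) open_uext[OF assms(1,2)] assms(2) _ _ assms(3)])
    (auto simp: uext_def)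

lemma usmooth_upar:
  fixes s :: "'k::local_field \<Rightarrow> 'b::{topological_ab_group_add,t2_space} \<Rightarrow> 'b"
  assumes "topological_vector_space s" "open V"
  shows "usmooth s (*) V upar"
  by (rule usmooth_linear[OF assms(1) tvs_mult assms(2)]) simp

text \<open>Chain rule: (f o h)^[1](x, y, t) = f^[1](h x, h^[1](x, y, t), t). The inner map on the
  right is smooth again, so the class of compositions is invariant.\<close>

lemma usmooth_compose:
  fixes s :: "'k::local_field \<Rightarrow> 'b::{topological_ab_group_add,t2_space} \<Rightarrow> 'b"
    and r :: "'k \<Rightarrow> 'c::{topological_ab_group_add,t2_space} \<Rightarrow> 'c"
    and s' :: "'k \<Rightarrow> 'f::{topological_ab_group_add,t2_space} \<Rightarrow> 'f"
  assumes s: "topological_vector_space s" and r: "topological_vector_space r"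
    and "open V" "open W" "usmooth s (uscale r) V h" "\<And>z. z \<in> V \<Longrightarrow> h z \<in> W" "usmooth r s' W f"
  shows "usmooth s s' V (\<lambda>z. f (h z))"
proof -
  define R where "R V f \<longleftrightarrow> open V \<and> (\<exists>W g h. open W \<and> (\<forall>z\<in>V. h z \<in> W) \<and>
    usmooth s (uscale r) V h \<and> usmooth r s' W g \<and> f = (\<lambda>z. g (h z)))" for V f
  show ?thesis
  proof (rule usmooth_coinduct[OF s, where R = R])
    show "R V (\<lambda>z. f (h z))" unfolding R_def using assms by blast
    fix V f assume "R V f"
    then obtain W g h where V: "open V" and W: "open W" and hV: "\<And>z. z \<in> V \<Longrightarrow> h z \<in> W"
      and h: "usmooth s (uscale r) V h" and g: "usmooth r s' W g" and f: "f = (\<lambda>z. g (h z))"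
      unfolding R_def by blast
    have c: "continuous_on V f"
      unfolding f using hV
      by (intro continuous_on_compose2[OF usmooth_continuous[OF g]] usmooth_continuous[OF h]) auto
    define h' where "h' z = uinc (h (ubase z)) (udq s (uscale r) h z) (upar z)" for z
    have h': "usmooth s (uscale r) (uext s V) h'"
      unfolding h'_def using open_uext[OF s V]
      by (intro usmooth_uinc[OF s r] usmooth_comp_ubase[OF s V h] usmooth_udq[OF h] usmooth_upar[OF s])
    \<comment> \<open>At parameter 0 the direction is multiplied by 0, so the identity holds there
      whatever value \<open>udq\<close> has.\<close>
    have st: "ustep r (h' z) = h (ustep s z)" for z
      using ustep_upar_0[OF s, of z]
      by (cases "upar z = 0") (simp_all add: h'_def ustep_def[of r] udq_nonzero tvs_algebra[OF tvs_uscale[OF r]])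
    have st': "ubase (h' z) = h (ubase z)" "upar (h' z) = upar z" for z
      by (simp_all add: h'_def)
    have "R (uext s V) (\<lambda>z. udq r s' g (h' z))"
      unfolding R_def
      using open_uext[OF s V] open_uext[OF r W] h' usmooth_udq[OF g] hV
      by (intro conjI exI[of _ "uext r W"] exI[of _ "udq r s' g"] exI[of _ h']) (auto simp: uext_def st st')
    moreover have "udq r s' g (h' z) = s' (1 / upar z) (f (ustep s z) - f (ubase z))" if "upar z \<noteq> 0" for z
      using that by (simp add: udq_nonzero st st' f)
    ultimately show "open V \<and> continuous_on V f \<and> (\<exists>g. R (uext s V) g \<and>
      (\<forall>z\<in>uext s V. upar z \<noteq> 0 \<longrightarrow> g z = s' (1 / upar z) (f (ustep s z) - f (ubase z))))"
      using V c by blast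
  qed
qed

text \<open>
  The difference quotient of a product is a sum of threefold products, so the products have to be
  embedded in a class closed under difference quotients.
\<close>

inductive product_class ::
  "('k::local_field \<Rightarrow> 'b::{topological_ab_group_add,t2_space} \<Rightarrow> 'b) \<Rightarrow>
   ('k \<Rightarrow> 'f::{topological_ab_group_add,t2_space} \<Rightarrow> 'f) \<Rightarrow>
   (nat \<Rightarrow> 'b \<times> 'k) set \<Rightarrow> ((nat \<Rightarrow> 'b \<times> 'k) \<Rightarrow> 'f) \<Rightarrow> bool" for s s' V where
  base: "usmooth s s' V f \<Longrightarrow> product_class s s' V f"
| mult: "usmooth s (*) V a \<Longrightarrow> product_class s s' V f \<Longrightarrow> product_class s s' V (\<lambda>z. s' (a z) (f z))"
| add: "product_class s s' V f \<Longrightarrow> product_class s s' V g \<Longrightarrow> product_class s s' V (\<lambda>z. f z + g z)"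

lemma product_class_ubase:
  assumes "topological_vector_space s" "open V" "product_class s s' V f"
  shows "product_class s s' (uext s V) (\<lambda>z. f (ubase z))"
  using assms(3) by induction (auto intro: product_class.intros usmooth_comp_ubase[OF assms(1,2)])

lemma product_class_step:
  fixes s :: "'k::local_field \<Rightarrow> 'b::{topological_ab_group_add,t2_space} \<Rightarrow> 'b"
    and s' :: "'k \<Rightarrow> 'f::{topological_ab_group_add,t2_space} \<Rightarrow> 'f"
  assumes s: "topological_vector_space s" and s': "topological_vector_space s'" and V: "open V"
    and "product_class s s' V f"
  shows "continuous_on V f \<and> (\<exists>g. product_class s s' (uext s V) g \<and>
      (\<forall>z\<in>uext s V. upar z \<noteq> 0 \<longrightarrow> g z = s' (1 / upar z) (f (ustep s z) - f (ubase z))))"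
  using assms(4)
proof induction
  case (base f)
  then show ?case
    by (intro conjI exI[of _ "udq s s' f"]) (auto intro: usmooth_continuous usmooth_udq product_class.base udq_nonzero)
next
  case (mult a f)
  then obtain g where g: "product_class s s' (uext s V) g" and
    gq: "\<And>z. z\<in>uext s V \<Longrightarrow> upar z \<noteq> 0 \<Longrightarrow> g z = s' (1 / upar z) (f (ustep s z) - f (ubase z))" by blast
  define a1 where "a1 = udq s (*) a"
  have a1: "usmooth s (*) (uext s V) a1" unfolding a1_def using mult by (intro usmooth_udq)
  \<comment> \<open>Expansion of (a + t a1)(f + t g) - a f, divided by t; the last summand is the
    second order term.\<close>
  have "product_class s s' (uext s V)
     (\<lambda>z. s' (a (ubase z)) (g z) + s' (a1 z) (f (ubase z)) + s' (upar z) (s' (a1 z) (g z)))"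
    by (intro product_class.intros(2,3) g a1 usmooth_comp_ubase[OF s V mult.hyps(1)]
        product_class_ubase[OF s V mult.hyps(2)] usmooth_upar[OF s] open_uext[OF s V])
  moreover have "s' (a (ubase z)) (g z) + s' (a1 z) (f (ubase z)) + s' (upar z) (s' (a1 z) (g z)) =
     s' (1 / upar z) (s' (a (ustep s z)) (f (ustep s z)) - s' (a (ubase z)) (f (ubase z)))"
    if z: "z \<in> uext s V" "upar z \<noteq> 0" for z
  proof -
    have f': "f (ustep s z) = f (ubase z) + s' (upar z) (g z)"
      using z gq[OF z] by (simp add: tvs_algebra[OF s'])
    have a': "a (ustep s z) = a (ubase z) + upar z * a1 z"
      using z by (simp add: a1_def udq_nonzero)
    show ?thesis unfolding f' a' using z by (simp add: tvs_algebra[OF s'] algebra_simps)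
  qed
  moreover have "continuous_on V (\<lambda>z. s' (a z) (f z))"
    using mult by (intro tvs_continuous_on[OF s']) (auto intro: usmooth_continuous)
  ultimately show ?case by blast
next
  case (add f1 f2)
  then obtain g1 g2 where g: "product_class s s' (uext s V) g1" "product_class s s' (uext s V) g2"
    "\<And>z. z\<in>uext s V \<Longrightarrow> upar z \<noteq> 0 \<Longrightarrow> g1 z = s' (1 / upar z) (f1 (ustep s z) - f1 (ubase z))"
    "\<And>z. z\<in>uext s V \<Longrightarrow> upar z \<noteq> 0 \<Longrightarrow> g2 z = s' (1 / upar z) (f2 (ustep s z) - f2 (ubase z))" by metis
  then show ?case using add
    by (intro conjI exI[of _ "\<lambda>z. g1 z + g2 z"])
      (auto intro: product_class.add continuous_on_add simp: tvs_algebra(1,9)[OF s'])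
qed

lemma usmooth_scale:
  fixes s :: "'k::local_field \<Rightarrow> 'b::{topological_ab_group_add,t2_space} \<Rightarrow> 'b"
    and s' :: "'k \<Rightarrow> 'f::{topological_ab_group_add,t2_space} \<Rightarrow> 'f"
  assumes s: "topological_vector_space s" and s': "topological_vector_space s'" and V: "open V"
    and "usmooth s (*) V a" "usmooth s s' V f"
  shows "usmooth s s' V (\<lambda>z. s' (a z) (f z))"
proof (rule usmooth_coinduct[OF s, where R = "\<lambda>V f. open V \<and> product_class s s' V f"])
  show "open V \<and> product_class s s' V (\<lambda>z. s' (a z) (f z))"
    using assms by (auto intro: product_class.intros)
qed (use product_class_step[OF s s'] open_uext[OF s] in metis)

lemma usmooth_ustep:
  fixes s :: "'k::local_field \<Rightarrow> 'b::{topological_ab_group_add,t2_space} \<Rightarrow> 'b"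
  assumes s: "topological_vector_space s" and V: "open V"
  shows "usmooth s (uscale s) V (ustep s)"
  unfolding ustep_def using tvs_uscale[OF s]
  by (intro usmooth_add[OF s _ V] usmooth_scale[OF s _ V] usmooth_upar[OF s V] usmooth_linear[OF s _ V]) auto

lemma usmooth_comp_ustep:
  fixes s :: "'k::local_field \<Rightarrow> 'b::{topological_ab_group_add,t2_space} \<Rightarrow> 'b"
    and s' :: "'k \<Rightarrow> 'f::{topological_ab_group_add,t2_space} \<Rightarrow> 'f"
  assumes s: "topological_vector_space s" and V: "open V" and f: "usmooth s s' V f"
  shows "usmooth s s' (uext s V) (\<lambda>z. f (ustep s z))"
  by (rule usmooth_compose[OF s s open_uext[OF s V] V usmooth_ustep[OF s open_uext[OF s V]] _ f])
    (auto simp: uext_def)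

lemma usmooth_diff:
  fixes s :: "'k::local_field \<Rightarrow> 'b::{topological_ab_group_add,t2_space} \<Rightarrow> 'b"
    and s' :: "'k \<Rightarrow> 'f::{topological_ab_group_add,t2_space} \<Rightarrow> 'f"
  assumes s: "topological_vector_space s" and s': "topological_vector_space s'"
    and "open V" "usmooth s s' V f" "usmooth s s' V g"
  shows "usmooth s s' V (\<lambda>z. f z - g z)"
proof -
  have "cont_linear s' s' uminus"
    by (rule cont_linearI) (auto simp: tvs_algebra[OF s'] intro: continuous_intros)
  from usmooth_add[OF s s' assms(3,4) usmooth_postcompose_linear[OF s assms(3) this assms(5)]]
  show ?thesis by simp
qed

lemma continuous_on_inverse_field:
  fixes a :: "'x::topological_space \<Rightarrow> 'k::topological_field"
  assumes "continuous_on V a" "\<And>z. z \<in> V \<Longrightarrow> a z \<noteq> 0"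
  shows "continuous_on V (\<lambda>z. 1 / a z)"
  using assms unfolding continuous_on_def
  by (auto simp: inverse_eq_divide[symmetric] intro!: filterlim_compose[OF tendsto_inverse_nhds])

text \<open>With t the parameter, a+ = a + t a1 and b+ = b + t b1, the quotient of b / a is (a b1 -
  a1 b) / (a+ a). This is again a fraction with nowhere vanishing smooth denominator, so fractions
  form an invariant class.\<close>

lemma usmooth_divide:
  fixes s :: "'k::local_field \<Rightarrow> 'b::{topological_ab_group_add,t2_space} \<Rightarrow> 'b"
    and s' :: "'k \<Rightarrow> 'f::{topological_ab_group_add,t2_space} \<Rightarrow> 'f"
  assumes s: "topological_vector_space s" and s': "topological_vector_space s'" and "open V"
    and "usmooth s (*) V a" "usmooth s s' V f" "\<And>z. z \<in> V \<Longrightarrow> a z \<noteq> 0"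
  shows "usmooth s s' V (\<lambda>z. s' (1 / a z) (f z))"
proof -
  define R where "R V f \<longleftrightarrow> open V \<and> (\<exists>a b. usmooth s (*) V a \<and> usmooth s s' V b \<and> (\<forall>z\<in>V. a z \<noteq> 0) \<and>
    f = (\<lambda>z. s' (1 / a z) (b z)))" for V f
  show ?thesis
  proof (rule usmooth_coinduct[OF s, where R = R])
    show "R V (\<lambda>z. s' (1 / a z) (f z))" unfolding R_def using assms by blast
    fix V f assume "R V f"
    then obtain a b where V: "open V" and a: "usmooth s (*) V a" and b: "usmooth s s' V b"
      and nz: "\<And>z. z \<in> V \<Longrightarrow> a z \<noteq> 0" and f: "f = (\<lambda>z. s' (1 / a z) (b z))" unfolding R_def by blast
    have c: "continuous_on V f"
      unfolding f by (intro tvs_continuous_on[OF s'] continuous_on_inverse_field usmooth_continuous[OF a]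
          usmooth_continuous[OF b] nz)
    define a1 where "a1 = udq s (*) a"
    define b1 where "b1 = udq s s' b"
    define d where "d z = a (ustep s z) * a (ubase z)" for z
    define n where "n z = s' (a (ubase z)) (b1 z) - s' (a1 z) (b (ubase z))" for z
    have "usmooth s (*) (uext s V) d"
      unfolding d_def using open_uext[OF s V]
      by (intro usmooth_scale[OF s tvs_mult] usmooth_comp_ustep[OF s V a] usmooth_comp_ubase[OF s V a])
    moreover have "usmooth s s' (uext s V) n"
      unfolding n_def a1_def b1_def using open_uext[OF s V]
      by (intro usmooth_diff[OF s s'] usmooth_scale[OF s s'] usmooth_comp_ubase[OF s V] a b usmooth_udq)
    ultimately have "R (uext s V) (\<lambda>z. s' (1 / d z) (n z))"
      unfolding R_def using open_uext[OF s V] nz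
      by (intro conjI exI[of _ d] exI[of _ n]) (auto simp: d_def uext_def)
    moreover have "s' (1 / d z) (n z) = s' (1 / upar z) (f (ustep s z) - f (ubase z))"
      if z: "z \<in> uext s V" "upar z \<noteq> 0" for z
    proof -
      have nz': "a (ustep s z) \<noteq> 0" "a (ubase z) \<noteq> 0" using z nz by (auto simp: uext_def)
      have b': "b (ustep s z) = b (ubase z) + s' (upar z) (b1 z)"
        using z by (simp add: b1_def udq_nonzero tvs_algebra[OF s'])
      have a': "a (ustep s z) = a (ubase z) + upar z * a1 z"
        using z by (simp add: a1_def udq_nonzero)
      have e1: "1 / (upar z * a (ustep s z)) - 1 / (upar z * a (ubase z)) = - a1 z / (a (ustep s z) * a (ubase z))"
        using nz' z unfolding a' by (simp add: divide_simps)
      have "s' (1 / upar z) (f (ustep s z) - f (ubase z)) =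
         s' (1 / a (ustep s z)) (b1 z) +
         s' (1 / (upar z * a (ustep s z)) - 1 / (upar z * a (ubase z))) (b (ubase z))"
        unfolding f b' using nz' z by (simp add: tvs_algebra[OF s'])
      moreover have "1 / d z * a (ubase z) = 1 / a (ustep s z)" "1 / d z * a1 z = - (- a1 z / d z)"
        using nz' by (simp_all add: d_def)
      then have "s' (1 / d z) (n z) = s' (1 / a (ustep s z)) (b1 z) - s' (- (- a1 z / d z)) (b (ubase z))"
        unfolding n_def by (simp only: tvs_algebra(3,9)[OF s'])
      ultimately show ?thesis
        unfolding e1 d_def[symmetric] by (simp only: tvs_algebra(7)[OF s'] diff_minus_eq_add)
    qed
    ultimately show "open V \<and> continuous_on V f \<and> (\<exists>g. R (uext s V) g \<and>
      (\<forall>z\<in>uext s V. upar z \<noteq> 0 \<longrightarrow> g z = s' (1 / upar z) (f (ustep s z) - f (ubase z))))"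
      using V c by blast
  qed
qed

text \<open>At parameter 0 base and end point coincide, so a single piece W contains both. At a
  nonzero parameter they may lie in different pieces, but there the quotient is built from the two
  restrictions by subtraction and division.\<close>

lemma usmooth_local:
  fixes s :: "'k::local_field \<Rightarrow> 'b::{topological_ab_group_add,t2_space} \<Rightarrow> 'b"
    and s' :: "'k \<Rightarrow> 'f::{topological_ab_group_add,t2_space} \<Rightarrow> 'f"
  assumes s: "topological_vector_space s" and s': "topological_vector_space s'" and "open V"
    and "\<And>x. x \<in> V \<Longrightarrow> \<exists>W. open W \<and> x \<in> W \<and> W \<subseteq> V \<and> usmooth s s' W f"
  shows "usmooth s s' V f"
proof -
  define R where "R V f \<longleftrightarrow> open V \<and> (\<forall>x\<in>V. \<exists>W. open W \<and> x \<in> W \<and> W \<subseteq> V \<and> usmooth s s' W f)" for V f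
  show ?thesis
  proof (rule usmooth_coinduct[OF s, where R = R])
    show "R V f" unfolding R_def using assms by blast
    fix V f assume "R V f"
    then have V: "open V" and loc: "\<And>x. x \<in> V \<Longrightarrow> \<exists>W. open W \<and> x \<in> W \<and> W \<subseteq> V \<and> usmooth s s' W f"
      unfolding R_def by auto
    have c: "continuous_on V f"
      unfolding continuous_on_def
    proof
      fix x assume "x \<in> V"
      then obtain W where W: "open W" "x \<in> W" "W \<subseteq> V" "usmooth s s' W f" using loc by blast
      have "(f \<longlongrightarrow> f x) (at x within W)"
        using usmooth_continuous[OF W(4)] W(2) unfolding continuous_on_def by blast
      then have "(f \<longlongrightarrow> f x) (at x)"
        by (simp only: at_within_open[OF W(2,1)])
      then show "(f \<longlongrightarrow> f x) (at x within V)"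
        by (rule tendsto_within_subset) simp
    qed
    have "\<exists>N. open N \<and> z \<in> N \<and> N \<subseteq> uext s V \<and> usmooth s s' N (udq s s' f)" if z: "z \<in> uext s V" for z
    proof (cases "upar z = 0")
      case True
      obtain W where W: "open W" "ubase z \<in> W" "W \<subseteq> V" "usmooth s s' W f"
        using z loc[of "ubase z"] by (auto simp: uext_def)
      then have "z \<in> uext s W"
        using ustep_upar_0[OF s True] by (simp add: uext_def)
      then show ?thesis using W uext_mono[OF W(3)] usmooth_udq[OF W(4)] open_uext[OF s W(1)] by blast
    next
      case False
      obtain W1 where W1: "open W1" "ubase z \<in> W1" "W1 \<subseteq> V" "usmooth s s' W1 f"
        using z loc[of "ubase z"] by (auto simp: uext_def)
      obtain W2 where W2: "open W2" "ustep s z \<in> W2" "W2 \<subseteq> V" "usmooth s s' W2 f"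
        using z loc[of "ustep s z"] by (auto simp: uext_def)
      define N where "N = ubase -` W1 \<inter> ustep s -` W2 \<inter> upar -` (- {0})"
      have "open N"
        unfolding N_def using W1(1) W2(1)
        by (intro open_Int open_vimage continuous_on_ustep[OF s] cont_linearD(3)[OF cont_linear_ubase]
            cont_linearD(3)[OF cont_linear_upar]) auto
      have "usmooth s s' N (\<lambda>z. s' (1 / upar z) (f (ustep s z) - f (ubase z)))"
        by (intro usmooth_divide[OF s s' \<open>open N\<close>] usmooth_diff[OF s s' \<open>open N\<close>] usmooth_upar[OF s \<open>open N\<close>]
            usmooth_compose[OF s s \<open>open N\<close> W2(1) usmooth_ustep[OF s \<open>open N\<close>] _ W2(4)]
            usmooth_precompose_linear[OF s s \<open>open N\<close> W1(1) cont_linear_ubase _ W1(4)])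
          (auto simp: N_def)
      then have "usmooth s s' N (udq s s' f)"
        by (subst usmooth_cong[OF s \<open>open N\<close>, where g = "\<lambda>z. s' (1 / upar z) (f (ustep s z) - f (ubase z))"])
          (auto simp: N_def udq_nonzero)
      moreover have "N \<subseteq> uext s V" "z \<in> N"
        using W1 W2 False by (auto simp: N_def uext_def)
      ultimately show ?thesis using \<open>open N\<close> by blast
    qed
    then have "R (uext s V) (udq s s' f)"
      unfolding R_def using open_uext[OF s V] by blast
    then show "open V \<and> continuous_on V f \<and> (\<exists>g. R (uext s V) g \<and>
      (\<forall>z\<in>uext s V. upar z \<noteq> 0 \<longrightarrow> g z = s' (1 / upar z) (f (ustep s z) - f (ubase z))))"
      using V c udq_nonzero by blast
  qed
qed

section \<open>Trees and the universal space\<close>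

text \<open>On trees of depth j, \<open>tree_ret j\<close> is a left inverse of
  \<open>tree_emb\<close>. Both are continuous and respect sums and scalar multiples, hence
  transport iterated domains and difference quotients in both directions.\<close>

primrec tree_emb :: "('e::zero, 'k::zero) iter_pt \<Rightarrow> nat \<Rightarrow> 'e \<times> 'k" where
  "tree_emb (Pt x) = uemb x"
| "tree_emb (Incr x y t) = uinc (tree_emb x) (tree_emb y) t"

primrec tree_ret :: "nat \<Rightarrow> (nat \<Rightarrow> 'e \<times> 'k) \<Rightarrow> ('e, 'k) iter_pt" where
  "tree_ret 0 z = Pt (uret z)"
| "tree_ret (Suc j) z = Incr (tree_ret j (ubase z)) (tree_ret j (udir z)) (upar z)"

lemma topspace_iter_top [simp]: "topspace (iter_top j) = iter_space j"
  by (induction j) (auto simp: topspace_pullback_topology)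

lemma tree_ret_in_iter_space [simp]: "tree_ret j z \<in> iter_space j"
  by (induction j arbitrary: z) auto

lemma continuous_map_tree_emb:
  "continuous_map (iter_top j) euclidean
     (tree_emb :: ('e::{zero,topological_space}, 'k::{zero,topological_space}) iter_pt \<Rightarrow> _)"
proof (induction j)
  case 0
  have "continuous_on UNIV (uemb :: 'e \<Rightarrow> nat \<Rightarrow> 'e \<times> 'k)"
    unfolding uemb_def
    by (intro continuous_on_coordinatewise_then_product continuous_on_Pair continuous_on_id continuous_on_const)
  then have "continuous_map (iter_top 0) euclidean ((uemb :: 'e \<Rightarrow> nat \<Rightarrow> 'e \<times> 'k) \<circ> pt_val)"
    unfolding iter_top.simps by (intro continuous_map_pullback) simp
  then show ?case
    by (rule continuous_map_eq) (auto simp: topspace_pullback_topology)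
next
  case (Suc j)
  let ?T = "prod_topology (iter_top j) (prod_topology (iter_top j) (euclidean :: 'k topology))"
  let ?e = "tree_emb :: ('e, 'k) iter_pt \<Rightarrow> _"
  have f: "continuous_map ?T euclidean (\<lambda>p. ?e (fst p))"
    using continuous_map_compose[OF continuous_map_fst Suc.IH] by (simp add: o_def)
  have g: "continuous_map ?T euclidean (\<lambda>p. ?e (fst (snd p)))"
    using continuous_map_compose[OF continuous_map_compose[OF continuous_map_snd continuous_map_fst] Suc.IH]
    by (simp add: o_def)
  have h: "continuous_map ?T euclidean (\<lambda>p. snd (snd p))"
    using continuous_map_compose[OF continuous_map_snd continuous_map_snd] by (simp add: o_def)
  have u: "continuous_map euclidean euclidean
      (\<lambda>p. uinc (fst p) (fst (snd p)) (snd (snd p)) :: nat \<Rightarrow> 'e \<times> 'k)"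
    unfolding continuous_map_iff_continuous2 by (intro continuous_on_uinc continuous_intros)
  have "continuous_map ?T euclidean (\<lambda>p. uinc (?e (fst p)) (?e (fst (snd p))) (snd (snd p)))"
    using continuous_map_compose[OF _ u, of ?T "\<lambda>p. (?e (fst p), ?e (fst (snd p)), snd (snd p))"]
      continuous_map_pairedI[OF f continuous_map_pairedI[OF g h]] by (simp add: o_def)
  from continuous_map_pullback[OF this]
  have "continuous_map (iter_top (Suc j)) euclidean ((\<lambda>p. uinc (?e (fst p)) (?e (fst (snd p))) (snd (snd p)))
      \<circ> (\<lambda>p. (inc_base p, inc_dir p, inc_par p)))" unfolding iter_top.simps .
  then show ?case
    by (rule continuous_map_eq) (auto simp: topspace_pullback_topology)
qed

lemma continuous_map_tree_ret:
  "continuous_map euclidean (iter_top j)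
     (tree_ret j :: (nat \<Rightarrow> 'e::topological_space \<times> 'k::topological_space) \<Rightarrow> _)"
proof (induction j)
  case 0
  have "continuous_map euclidean euclidean (pt_val \<circ> (tree_ret 0 :: (nat \<Rightarrow> 'e \<times> 'k) \<Rightarrow> _))"
    by (auto simp: o_def uret_def intro!: continuous_on_fst)
  then show ?case unfolding iter_top.simps by (rule continuous_map_pullback') auto
next
  case (Suc j)
  have b: "continuous_map euclidean euclidean (ubase :: (nat \<Rightarrow> 'e \<times> 'k) \<Rightarrow> _)"
    "continuous_map euclidean euclidean (udir :: (nat \<Rightarrow> 'e \<times> 'k) \<Rightarrow> _)"
    "continuous_map euclidean euclidean (upar :: (nat \<Rightarrow> 'e \<times> 'k) \<Rightarrow> _)"
    by (auto simp: ubase_def udir_def upar_def intro!: continuous_on_coordinatewise_then_product continuous_on_snd)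
  have "continuous_map euclidean (prod_topology (iter_top j) (prod_topology (iter_top j) euclidean))
     (\<lambda>z :: nat \<Rightarrow> 'e \<times> 'k. (tree_ret j (ubase z), tree_ret j (udir z), upar z))"
    using continuous_map_compose[OF b(1) Suc.IH] continuous_map_compose[OF b(2) Suc.IH] b(3)
    by (intro continuous_map_pairedI) (simp_all add: o_def)
  then show ?case unfolding iter_top.simps
    by (intro continuous_map_pullback') (auto simp: o_def)
qed

lemma iter_space_add: "x \<in> iter_space j \<Longrightarrow> y \<in> iter_space j \<Longrightarrow> iter_add x y \<in> iter_space j"
proof (induction j arbitrary: x y)
  case 0
  then show ?case by auto
next
  case (Suc j)
  from Suc.prems show ?case by (auto intro: Suc.IH)
qed

lemma iter_space_scale: "x \<in> iter_space j \<Longrightarrow> iter_scale s a x \<in> iter_space j"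
proof (induction j arbitrary: x)
  case 0
  then show ?case by auto
next
  case (Suc j)
  from Suc.prems show ?case by (auto intro: Suc.IH)
qed

lemma tree_emb_add:
  fixes x :: "('e::monoid_add, 'k::monoid_add) iter_pt"
  assumes "x \<in> iter_space j" "y \<in> iter_space j"
  shows "tree_emb (iter_add x y) = tree_emb x + tree_emb y"
  using assms
proof (induction j arbitrary: x y)
  case 0
  then show ?case by (auto simp: uemb_def fun_eq_iff fun_ops)
next
  case (Suc j)
  from Suc.prems obtain x1 x2 t y1 y2 u where "x = Incr x1 x2 t" "y = Incr y1 y2 u"
    and "x1 \<in> iter_space j" "x2 \<in> iter_space j" "y1 \<in> iter_space j" "y2 \<in> iter_space j" by auto
  then show ?case by (simp only: iter_add.simps tree_emb.simps uinc_add Suc.IH)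
qed

lemma tree_emb_scale:
  assumes "topological_vector_space s"
  shows "tree_emb (iter_scale s a x) = uscale s a (tree_emb x)"
  by (induction x) (simp_all add: uinc_scale[OF assms], simp add: uemb_def uscale_def pair_scale_def fun_eq_iff fun_ops)

lemma tree_ret_add: "tree_ret j (z + w) = iter_add (tree_ret j z) (tree_ret j w)"
proof (induction j arbitrary: z w)
  case (Suc j)
  have "ubase (z + w) = ubase z + ubase w" "udir (z + w) = udir z + udir w" "upar (z + w) = upar z + upar w"
    by (auto simp: ubase_def udir_def upar_def fun_ops)
  then show ?case by (simp add: Suc.IH)
qed (simp add: uret_def fun_ops)

lemma tree_ret_scale: "tree_ret j (uscale s a z) = iter_scale s a (tree_ret j z)"
proof (induction j arbitrary: z)
  case (Suc j)
  have "ubase (uscale s a z) = uscale s a (ubase z)" "udir (uscale s a z) = uscale s a (udir z)"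
    "upar (uscale s a z) = a * upar z"
    by (auto simp: ubase_def udir_def upar_def uscale_def pair_scale_def)
  then show ?case by (simp add: Suc.IH)
qed (simp add: uret_def uscale_def pair_scale_def)

lemma iter_dom_subset: "iter_dom s U j \<subseteq> iter_space j"
  by (induction j) auto

lemma tree_emb_in_uext_iff:
  assumes s: "topological_vector_space s" and "p \<in> iter_space j"
  shows "tree_emb p \<in> (uext s ^^ j) (uret -` U) \<longleftrightarrow> p \<in> iter_dom s U j"
  using assms(2)
proof (induction j arbitrary: p)
  case 0
  then show ?case by auto
next
  case (Suc j)
  then obtain x y t where p: "p = Incr x y t" "x \<in> iter_space j" "y \<in> iter_space j" by auto
  then have "iter_add x (iter_scale s t y) \<in> iter_space j" by (intro iter_space_add iter_space_scale)
  from Suc.IH[OF this] Suc.IH[OF p(2)] p show ?case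
    by (auto simp: in_uext_iff ustep_def tree_emb_add[OF p(2) iter_space_scale[OF p(3)]] tree_emb_scale[OF s])
qed

lemma tree_ret_in_iter_dom_iff:
  "tree_ret j z \<in> iter_dom s U j \<longleftrightarrow> z \<in> (uext s ^^ j) (uret -` U)"
proof (induction j arbitrary: z)
  case (Suc j)
  have "z \<in> uext s V \<longleftrightarrow> ubase z \<in> V \<and> ubase z + uscale s (upar z) (udir z) \<in> V" for V
    by (simp add: in_uext_iff ustep_def)
  then show ?case using Suc.IH by (simp flip: tree_ret_scale tree_ret_add)
qed auto

lemma iter_dq_of_usmooth:
  assumes s: "topological_vector_space s" and f: "usmooth s s' (uret -` U) (\<lambda>z. f (uret z))"
  shows "iter_dq s s' U f k (\<lambda>p. (udq s s' ^^ k) (\<lambda>z. f (uret z)) (tree_emb p))"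
proof -
  let ?g = "\<lambda>k p. (udq s s' ^^ k) (\<lambda>z. f (uret z)) (tree_emb p)"
  have c: "iter_continuous s U k (?g k)" for k
  proof -
    have "continuous_map (subtopology (iter_top k) (iter_dom s U k))
        (subtopology euclidean ((uext s ^^ k) (uret -` U))) tree_emb"
      using tree_emb_in_uext_iff[OF s]
      by (intro continuous_map_into_subtopology continuous_map_from_subtopology continuous_map_tree_emb) auto
    from continuous_map_compose[OF this, of euclidean "(udq s s' ^^ k) (\<lambda>z. f (uret z))"] f
    show ?thesis by (auto simp: usmooth_def iter_continuous_def o_def)
  qed
  show ?thesis
  proof (induction k)
    case 0
    then show ?case using c[of 0] by simp
  next
    case (Suc k)
    have "?g (Suc k) (Incr x y t) = s' (1 / t) (?g k (iter_add x (iter_scale s t y)) - ?g k x)"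
      if "Incr x y t \<in> iter_dom s U (Suc k)" "t \<noteq> 0" for x y t
    proof -
      have "x \<in> iter_space k" "y \<in> iter_space k" using that iter_dom_subset[of s U k] by auto
      then have "tree_emb (iter_add x (iter_scale s t y)) = ustep s (tree_emb (Incr x y t))"
        using iter_space_scale
        by (subst tree_emb_add) (auto simp: tree_emb_scale[OF s] ustep_def)
      then show ?thesis using that by (simp add: udq_nonzero)
    qed
    then show ?case using Suc c[of "Suc k"] by (auto simp del: funpow.simps)
  qed
qed

text \<open>By induction on k, \<open>g\<close> composed with \<open>tree_ret k\<close> is a
  continuous extension of the quotient of the previous stage, so uniqueness identifies it with the
  iterate of \<open>udq\<close>. Continuity of the iterate is then inherited from
  \<open>g\<close>.\<close>

lemma usmooth_of_iter_dq:
  fixes s :: "'k::local_field \<Rightarrow> 'b::{topological_ab_group_add,t2_space} \<Rightarrow> 'b"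
    and s' :: "'k \<Rightarrow> 'f::{topological_ab_group_add,t2_space} \<Rightarrow> 'f"
  assumes s: "topological_vector_space s" and U: "open U" and "iter_dq s s' U f k g"
  shows "\<forall>z\<in>(uext s ^^ k) (uret -` U). (udq s s' ^^ k) (\<lambda>z. f (uret z)) z = g (tree_ret k z)"
    and "continuous_on ((uext s ^^ k) (uret -` U)) ((udq s s' ^^ k) (\<lambda>z. f (uret z)))"
proof -
  let ?V = "\<lambda>k. (uext s ^^ k) (uret -` U) :: (nat \<Rightarrow> 'b \<times> 'k) set"
  have o: "open (?V k)" for k
  proof (induction k)
    case 0
    have "open (uret -` U :: (nat \<Rightarrow> 'b \<times> 'k) set)"
      by (rule open_vimage[OF U]) (rule cont_linearD(3)[OF cont_linear_uret])
    then show ?case by simp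
  qed (use open_uext[OF s] in simp)
  have c: "continuous_on (?V k) (\<lambda>z. g (tree_ret k z))" if "iter_continuous s U k g" for k g
  proof -
    have "continuous_map (top_of_set (?V k)) (subtopology (iter_top k) (iter_dom s U k)) (tree_ret k)"
      by (intro continuous_map_into_subtopology continuous_map_from_subtopology continuous_map_tree_ret)
        (simp add: tree_ret_in_iter_dom_iff)
    from continuous_map_compose[OF this, of euclidean g] that
    show ?thesis by (simp add: iter_continuous_def o_def)
  qed
  show eq: "\<forall>z\<in>?V k. (udq s s' ^^ k) (\<lambda>z. f (uret z)) z = g (tree_ret k z)"
    using assms(3)
  proof (induction k arbitrary: g)
    case 0
    then show ?case by auto
  next
    case (Suc k)
    then obtain h where h: "iter_dq s s' U f k h" and
      q: "\<forall>x y t. Incr x y t \<in> iter_dom s U (Suc k) \<and> t \<noteq> 0 \<longrightarrow>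
           g (Incr x y t) = s' (1 / t) (h (iter_add x (iter_scale s t y)) - h x)" by auto
    note IH = Suc.IH[OF h]
    show ?case
    proof
      fix z assume z: "z \<in> ?V (Suc k)"
      have "udq s s' ((udq s s' ^^ k) (\<lambda>z. f (uret z))) z = g (tree_ret (Suc k) z)"
      proof (rule udq_unique[OF s o])
        show "continuous_on (uext s (?V k)) (\<lambda>z. g (tree_ret (Suc k) z))"
          using c[of "Suc k" g] Suc.prems by simp
        fix z assume z: "z \<in> uext s (?V k)" "upar z \<noteq> 0"
        then have "tree_ret (Suc k) z \<in> iter_dom s U (Suc k)"
          unfolding tree_ret_in_iter_dom_iff by simp
        then have "g (tree_ret (Suc k) z) = s' (1 / upar z) (h (tree_ret k (ustep s z)) - h (tree_ret k (ubase z)))"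
          using q[rule_format, of "tree_ret k (ubase z)" "tree_ret k (udir z)" "upar z"] z
          by (simp add: ustep_def tree_ret_scale tree_ret_add)
        then show "g (tree_ret (Suc k) z) = s' (1 / upar z)
           ((udq s s' ^^ k) (\<lambda>z. f (uret z)) (ustep s z) - (udq s s' ^^ k) (\<lambda>z. f (uret z)) (ubase z))"
          using IH z by (simp add: in_uext_iff)
      qed (use z in simp)
      then show "(udq s s' ^^ Suc k) (\<lambda>z. f (uret z)) z = g (tree_ret (Suc k) z)" by simp
    qed
  qed
  have "iter_continuous s U k g" using assms(3) by (cases k) auto
  from c[OF this] eq show "continuous_on (?V k) ((udq s s' ^^ k) (\<lambda>z. f (uret z)))"
    by (simp cong: continuous_on_cong)
qed

text \<open>The bridge between the tree formulation and the universal space; the calculus below is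
  obtained by transport along it.\<close>

lemma C_infinity_on_iff_usmooth:
  fixes s :: "'k::local_field \<Rightarrow> 'b::{topological_ab_group_add,t2_space} \<Rightarrow> 'b"
    and s' :: "'k \<Rightarrow> 'f::{topological_ab_group_add,t2_space} \<Rightarrow> 'f"
  assumes "topological_vector_space s" "open U"
  shows "C_infinity_on s s' U f \<longleftrightarrow> usmooth s s' (uret -` U) (\<lambda>z. f (uret z))"
  using iter_dq_of_usmooth[OF assms(1)] usmooth_of_iter_dq(2)[OF assms]
  unfolding C_infinity_on_def C_k_on_def usmooth_def by blast


section \<open>Calculus of smooth maps\<close>

lemma open_uret_vimage [simp]:
  "open U \<Longrightarrow> open (uret -` U :: (nat \<Rightarrow> 'b::{topological_ab_group_add,t2_space} \<times> 'k::local_field) set)"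
  by (rule open_vimage) (auto simp: uret_def intro!: continuous_on_fst)

context
  fixes s :: "'k::local_field \<Rightarrow> 'b::{topological_ab_group_add,t2_space} \<Rightarrow> 'b"
    and s' :: "'k \<Rightarrow> 'f::{topological_ab_group_add,t2_space} \<Rightarrow> 'f"
    and U :: "'b set"
  assumes s: "topological_vector_space s" and s': "topological_vector_space s'" and U: "open U"
begin

lemmas smooth_iff = C_infinity_on_iff_usmooth[OF s U, where 'f='f]
lemmas open_V = open_uret_vimage[OF U, where 'k='k]

lemma C_infinity_on_continuous:
  assumes "C_infinity_on s s' U f"
  shows "continuous_on U f"
proof -
  have "continuous_on (uret -` U :: (nat \<Rightarrow> 'b \<times> 'k) set) (\<lambda>z. f (uret z))"
    using assms unfolding smooth_iff by (rule usmooth_continuous)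
  moreover have "continuous_on U (uemb :: 'b \<Rightarrow> nat \<Rightarrow> 'b \<times> 'k)"
    by (rule cont_linearD[OF cont_linear_uemb])
  ultimately have "continuous_on U (\<lambda>x. f (uret (uemb x :: nat \<Rightarrow> 'b \<times> 'k)))"
    by (rule continuous_on_compose2) auto
  then show ?thesis by simp
qed

lemma C_infinity_on_const: "C_infinity_on s s' U (\<lambda>x. c)"
  unfolding smooth_iff by (rule usmooth_const[OF s s' open_V])

lemma C_infinity_on_linear: "cont_linear s s' A \<Longrightarrow> C_infinity_on s s' U A"
  unfolding smooth_iff by (rule usmooth_linear[OF s s' open_V]) (rule cont_linear_comp[OF cont_linear_uret])

lemma C_infinity_on_add:
  "C_infinity_on s s' U f \<Longrightarrow> C_infinity_on s s' U g \<Longrightarrow> C_infinity_on s s' U (\<lambda>x. f x + g x)"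
  unfolding smooth_iff by (rule usmooth_add[OF s s' open_V])

lemma C_infinity_on_diff:
  "C_infinity_on s s' U f \<Longrightarrow> C_infinity_on s s' U g \<Longrightarrow> C_infinity_on s s' U (\<lambda>x. f x - g x)"
  unfolding smooth_iff by (rule usmooth_diff[OF s s' open_V])

lemma C_infinity_on_scale:
  "C_infinity_on s (*) U a \<Longrightarrow> C_infinity_on s s' U f \<Longrightarrow> C_infinity_on s s' U (\<lambda>x. s' (a x) (f x))"
  unfolding smooth_iff C_infinity_on_iff_usmooth[OF s U] by (rule usmooth_scale[OF s s' open_V])

lemma C_infinity_on_divide:
  "C_infinity_on s (*) U a \<Longrightarrow> C_infinity_on s s' U f \<Longrightarrow> (\<And>x. x \<in> U \<Longrightarrow> a x \<noteq> 0) \<Longrightarrow>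
   C_infinity_on s s' U (\<lambda>x. s' (1 / a x) (f x))"
  unfolding smooth_iff C_infinity_on_iff_usmooth[OF s U] by (rule usmooth_divide[OF s s' open_V]) auto

lemma C_infinity_on_cong: "(\<And>x. x \<in> U \<Longrightarrow> f x = g x) \<Longrightarrow> C_infinity_on s s' U f \<longleftrightarrow> C_infinity_on s s' U g"
  unfolding smooth_iff by (rule usmooth_cong[OF s open_V]) auto

lemma C_infinity_on_subset: "C_infinity_on s s' U f \<Longrightarrow> open W \<Longrightarrow> W \<subseteq> U \<Longrightarrow> C_infinity_on s s' W f"
  unfolding smooth_iff C_infinity_on_iff_usmooth[OF s] by (erule usmooth_subset) auto

lemma C_infinity_on_local:
  assumes "\<And>x. x \<in> U \<Longrightarrow> \<exists>W. open W \<and> x \<in> W \<and> W \<subseteq> U \<and> C_infinity_on s s' W f"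
  shows "C_infinity_on s s' U f"
  unfolding smooth_iff
proof (rule usmooth_local[OF s s' open_V])
  fix z :: "nat \<Rightarrow> 'b \<times> 'k" assume "z \<in> uret -` U"
  then obtain W where "open W" "uret z \<in> W" "W \<subseteq> U" "C_infinity_on s s' W f" using assms by auto
  then show "\<exists>W. open W \<and> z \<in> W \<and> W \<subseteq> uret -` U \<and> usmooth s s' W (\<lambda>z. f (uret z))"
    by (intro exI[of _ "uret -` W"]) (auto simp: C_infinity_on_iff_usmooth[OF s])
qed

lemma C_infinity_on_compose:
  fixes r :: "'k \<Rightarrow> 'c::{topological_ab_group_add,t2_space} \<Rightarrow> 'c"
  assumes r: "topological_vector_space r" and W: "open W"
    and h: "C_infinity_on s r U h" and "\<And>x. x \<in> U \<Longrightarrow> h x \<in> W" and f: "C_infinity_on r s' W f"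
  shows "C_infinity_on s s' U (\<lambda>x. f (h x))"
proof -
  \<comment> \<open>The chain rule in the universal space expects an inner map with values in that
    space, so h is followed by \<open>uemb\<close> and f preceded by \<open>uret\<close>.\<close>
  have "usmooth s (uscale r) (uret -` U) (\<lambda>z. uemb (h (uret z)) :: nat \<Rightarrow> 'c \<times> 'k)"
    using h unfolding C_infinity_on_iff_usmooth[OF s U]
    by (rule usmooth_postcompose_linear[OF s open_V cont_linear_uemb])
  moreover have "usmooth r s' (uret -` W) (\<lambda>z. f (uret z))"
    using f unfolding C_infinity_on_iff_usmooth[OF r W] .
  ultimately have "usmooth s s' (uret -` U) (\<lambda>z. f (uret (uemb (h (uret z)) :: nat \<Rightarrow> 'c \<times> 'k)))"
    using assms(4) by (intro usmooth_compose[OF s r open_V open_uret_vimage[OF W], where f = "\<lambda>z. f (uret z)"]) auto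
  then show ?thesis unfolding smooth_iff by simp
qed

end

lemma C_infinity_on_postcompose_linear:
  fixes s :: "'k::local_field \<Rightarrow> 'b::{topological_ab_group_add,t2_space} \<Rightarrow> 'b"
    and r :: "'k \<Rightarrow> 'c::{topological_ab_group_add,t2_space} \<Rightarrow> 'c"
    and s' :: "'k \<Rightarrow> 'f::{topological_ab_group_add,t2_space} \<Rightarrow> 'f"
  assumes "topological_vector_space s" "topological_vector_space r" "topological_vector_space s'"
    "open U" "C_infinity_on s r U f" "cont_linear r s' A"
  shows "C_infinity_on s s' U (\<lambda>x. A (f x))"
  by (rule C_infinity_on_compose[OF assms(1,3,4,2) open_UNIV assms(5) UNIV_I])
    (intro C_infinity_on_linear assms open_UNIV)

lemma cont_linear_fst: "cont_linear (pair_scale s r) s fst"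
  by (rule cont_linearI) (auto simp: pair_scale_def intro!: continuous_intros)

lemma cont_linear_snd: "cont_linear (pair_scale s r) r snd"
  by (rule cont_linearI) (auto simp: pair_scale_def intro!: continuous_intros)

lemma C_infinity_on_Pair:
  fixes s :: "'k::local_field \<Rightarrow> 'b::{topological_ab_group_add,t2_space} \<Rightarrow> 'b"
    and r :: "'k \<Rightarrow> 'c::{topological_ab_group_add,t2_space} \<Rightarrow> 'c"
    and s' :: "'k \<Rightarrow> 'f::{topological_ab_group_add,t2_space} \<Rightarrow> 'f"
  assumes s: "topological_vector_space s" and r: "topological_vector_space r"
    and s': "topological_vector_space s'" and U: "open U"
    and f: "C_infinity_on s r U f" and g: "C_infinity_on s s' U g"
  shows "C_infinity_on s (pair_scale r s') U (\<lambda>x. (f x, g x))"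
proof -
  have "cont_linear r (pair_scale r s') (\<lambda>x. (x, 0))" "cont_linear s' (pair_scale r s') (\<lambda>x. (0, x))"
    by (rule cont_linearI, auto simp: pair_scale_def tvs_algebra[OF s'] tvs_algebra[OF r] intro!: continuous_intros)+
  then have "C_infinity_on s (pair_scale r s') U (\<lambda>x. (f x, 0) + (0, g x))"
    using C_infinity_on_postcompose_linear[OF s r tvs_pair[OF r s'] U f]
      C_infinity_on_postcompose_linear[OF s s' tvs_pair[OF r s'] U g]
    by (intro C_infinity_on_add[OF s tvs_pair[OF r s'] U]) auto
  then show ?thesis by simp
qed

text \<open>This is \<open>U\<^sup>[\<^sup>1\<^sup>]\<close> inside the honest product E x E x K, in
  contrast to its preimage \<open>uext\<close> in the universal space.\<close>

definition dq_domain :: "('k \<Rightarrow> 'b \<Rightarrow> 'b::plus) \<Rightarrow> 'b set \<Rightarrow> ('b \<times> 'b \<times> 'k) set" where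
  "dq_domain s U = {(x, y, t). x \<in> U \<and> x + s t y \<in> U}"

abbreviation dq_scale :: "('k \<Rightarrow> 'b \<Rightarrow> 'b) \<Rightarrow> 'k::times \<Rightarrow> 'b \<times> 'b \<times> 'k \<Rightarrow> 'b \<times> 'b \<times> 'k" where
  "dq_scale s \<equiv> pair_scale s (pair_scale s (*))"

lemma open_dq_domain:
  fixes s :: "'k::topological_field \<Rightarrow> 'b::{topological_ab_group_add,t2_space} \<Rightarrow> 'b"
  assumes s: "topological_vector_space s" and U: "open U"
  shows "open (dq_domain s U)"
proof -
  have "dq_domain s U = fst -` U \<inter> (\<lambda>p. fst p + s (snd (snd p)) (fst (snd p))) -` U"
    by (auto simp: dq_domain_def)
  then show ?thesis
    using U by (auto intro!: open_Int open_vimage continuous_intros tvs_continuous_on[OF s])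
qed

text \<open>The extended quotient is \<open>udq\<close> restricted along the continuous linear
  embedding of E x E x K into the universal space, so its smoothness comes from precomposition with
  a linear map.\<close>

lemma C_infinity_on_difference_quotient:
  fixes s :: "'k::local_field \<Rightarrow> 'b::{topological_ab_group_add,t2_space} \<Rightarrow> 'b"
    and s' :: "'k \<Rightarrow> 'f::{topological_ab_group_add,t2_space} \<Rightarrow> 'f"
  assumes s: "topological_vector_space s" and s': "topological_vector_space s'" and U: "open U"
    and f: "C_infinity_on s s' U f"
  obtains g where "C_infinity_on (dq_scale s) s' (dq_domain s U) g"
    "\<And>x y t. (x, y, t) \<in> dq_domain s U \<Longrightarrow> t \<noteq> 0 \<Longrightarrow> g (x, y, t) = s' (1 / t) (f (x + s t y) - f x)"
proof
  let ?A = "\<lambda>p. uinc (uemb (fst p)) (uemb (fst (snd p))) (snd (snd p)) :: nat \<Rightarrow> 'b \<times> 'k"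
  let ?g = "\<lambda>p. udq s s' (\<lambda>z. f (uret z)) (?A p)"
  note tv = tvs_pair[OF s tvs_pair[OF s tvs_mult]]
  have o: "open (uext s (uret -` U) :: (nat \<Rightarrow> 'b \<times> 'k) set)" using open_uext[OF s] U by simp
  have st: "uret (ustep s (?A (x, y, t))) = x + s t y" for x y t
    by (simp add: ustep_def uscale_def uret_def uemb_def pair_scale_def fun_ops)
  have "cont_linear (dq_scale s) s (\<lambda>p. fst (snd p))" "cont_linear (dq_scale s) (*) (\<lambda>p. snd (snd p))"
    by (intro cont_linear_comp[OF cont_linear_snd] cont_linear_fst cont_linear_snd)+
  then have A: "cont_linear (dq_scale s) (uscale s) ?A"
    by (intro cont_linear_uinc[OF s] cont_linear_comp[OF _ cont_linear_uemb] cont_linear_fst)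
  have "usmooth (dq_scale s) s' (uret -` dq_domain s U) (\<lambda>z. ?g (uret z))"
    using f unfolding C_infinity_on_iff_usmooth[OF s U]
    by (intro usmooth_precompose_linear[OF tv s _ o _ _ usmooth_udq, where A = "\<lambda>z. ?A (uret z)"]
        cont_linear_comp[OF cont_linear_uret A] open_uret_vimage open_dq_domain[OF s U])
      (auto simp: in_uext_iff st[simplified] dq_domain_def)
  then show "C_infinity_on (dq_scale s) s' (dq_domain s U) ?g"
    by (simp add: C_infinity_on_iff_usmooth[OF tv open_dq_domain[OF s U]])
  show "?g (x, y, t) = s' (1 / t) (f (x + s t y) - f x)" if "t \<noteq> 0" for x y t
    using that st[of x y t] by (simp add: udq_nonzero)
qed

section \<open>Local fields\<close>

locale valued_local_field =
  fixes v :: "'k::local_field \<Rightarrow> real"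
  assumes ultrametric: "ultrametric_absolute_value v" and topology: "defines_topology v"
begin

lemma v_nonneg [simp]: "0 \<le> v x" and v_eq_0 [simp]: "v x = 0 \<longleftrightarrow> x = 0"
  and v_mult: "v (x * y) = v x * v y" and v_add: "v (x + y) \<le> max (v x) (v y)"
  using ultrametric unfolding ultrametric_absolute_value_def by auto

lemma v_0 [simp]: "v 0 = 0" by simp

lemma v_pos [simp]: "0 < v x \<longleftrightarrow> x \<noteq> 0"
  using v_nonneg[of x] v_eq_0[of x] by linarith

lemma v_1 [simp]: "v 1 = 1"
  using v_mult[of 1 1] by simp

lemma v_minus [simp]: "v (- x) = v x"
proof -
  have "v (- 1) * v (- 1) = 1" using v_mult[of "- 1" "- 1"] by simp
  then have "v (- 1) = 1"
    using v_nonneg[of "- 1"] by (metis abs_of_nonneg real_sqrt_abs2 real_sqrt_one)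
  then show ?thesis using v_mult[of "- 1" x] by simp
qed

lemma v_diff: "v (x - y) \<le> max (v x) (v y)"
  using v_add[of x "- y"] by simp

lemma v_diff_commute: "v (x - y) = v (y - x)"
  using v_minus[of "x - y"] by simp

lemma v_inverse: "v (1 / x) = 1 / v x"
proof (cases "x = 0")
  case False
  then have "v (1 / x) * v x = 1" by (simp flip: v_mult)
  then show ?thesis using False by (simp add: field_simps)
qed simp

lemma v_power: "v (x ^ n) = v x ^ n"
  by (induction n) (auto simp: v_mult)

lemma v_triangle: "v (x - y) < r \<Longrightarrow> v (y - z) < r \<Longrightarrow> v (x - z) < r"
  using v_add[of "x - y" "y - z"] by simp

lemma open_iff: "open S \<longleftrightarrow> (\<forall>x\<in>S. \<exists>e>0. \<forall>y. v (y - x) < e \<longrightarrow> y \<in> S)"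
  using topology unfolding defines_topology_def by blast

lemma open_ball: "open {x. v (x - a) < r}"
  unfolding open_iff
proof safe
  fix x assume *: "v (x - a) < r"
  then have "0 < r" using v_nonneg[of "x - a"] by linarith
  then show "\<exists>e>0. \<forall>y. v (y - x) < e \<longrightarrow> y \<in> {x. v (x - a) < r}"
    using * v_triangle by blast
qed

lemma open_cball: "0 < r \<Longrightarrow> open {x. v (x - a) \<le> r}"
  unfolding open_iff
proof safe
  fix x assume *: "v (x - a) \<le> r" and "0 < r"
  have "v (y - a) \<le> r" if "v (y - x) < r" for y
    using that * v_add[of "y - x" "x - a"] by simp
  then show "\<exists>e>0. \<forall>y. v (y - x) < e \<longrightarrow> y \<in> {x. v (x - a) \<le> r}"
    using \<open>0 < r\<close> by blast
qed

text \<open>The isosceles principle of ultrametrics: a perturbation smaller than the distance to a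
  leaves that distance unchanged. Hence spheres are open and balls are clopen.\<close>

lemma v_eq_of_near: "v (y - x) < v (x - a) \<Longrightarrow> v (y - a) = v (x - a)"
  using v_add[of "y - x" "x - a"] v_diff[of "y - a" "y - x"] by (simp add: max_def split: if_splits)

lemma open_outside_cball: "open {x. v (x - a) > r}"
  unfolding open_iff
proof safe
  fix x assume *: "v (x - a) > r"
  show "\<exists>e>0. \<forall>y. v (y - x) < e \<longrightarrow> y \<in> {x. v (x - a) > r}"
  proof (cases "x = a")
    case True
    then have "r < 0" using * by simp
    then have "\<forall>y. v (y - x) < 1 \<longrightarrow> y \<in> {x. v (x - a) > r}"
      using v_nonneg less_le_trans by blast
    then show ?thesis by (intro exI[of _ 1]) auto
  next
    case False
    then show ?thesis using * by (intro exI[of _ "v (x - a)"]) (auto dest: v_eq_of_near)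
  qed
qed

lemma open_outside_ball: "0 < r \<Longrightarrow> open {x. v (x - a) \<ge> r}"
  unfolding open_iff
proof safe
  fix x assume *: "v (x - a) \<ge> r" "0 < r"
  then have "0 < v (x - a)" by linarith
  then show "\<exists>e>0. \<forall>y. v (y - x) < e \<longrightarrow> y \<in> {x. v (x - a) \<ge> r}"
    using * by (intro exI[of _ "v (x - a)"]) (auto dest: v_eq_of_near)
qed

lemma closed_cball: "closed {x. v (x - a) \<le> r}"
proof -
  have "- {x. v (x - a) \<le> r} = {x. v (x - a) > r}" by auto
  then show ?thesis unfolding closed_def by (simp add: open_outside_cball)
qed

lemma tendsto_v_iff: "(f \<longlongrightarrow> a) F \<longleftrightarrow> (\<forall>e>0. \<forall>\<^sub>F x in F. v (f x - a) < e)"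
proof
  assume f: "(f \<longlongrightarrow> a) F"
  show "\<forall>e>0. \<forall>\<^sub>F x in F. v (f x - a) < e"
    using topological_tendstoD[OF f open_ball[of a]] by simp
next
  assume *: "\<forall>e>0. \<forall>\<^sub>F x in F. v (f x - a) < e"
  show "(f \<longlongrightarrow> a) F"
  proof (rule topological_tendstoI)
    fix S assume "open S" "a \<in> S"
    then obtain e where "e > 0" "\<forall>y. v (y - a) < e \<longrightarrow> y \<in> S" unfolding open_iff by blast
    moreover have "\<forall>\<^sub>F x in F. v (f x - a) < e" using * \<open>e > 0\<close> by blast
    ultimately show "\<forall>\<^sub>F x in F. f x \<in> S" by (auto elim: eventually_mono)
  qed
qed

lemma nhds_0_iff: "(\<forall>\<^sub>F x in nhds 0. P x) \<longleftrightarrow> (\<exists>e>0. \<forall>x. v x < e \<longrightarrow> P x)"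
proof
  assume "\<forall>\<^sub>F x in nhds 0. P x"
  then obtain S where "open S" "0 \<in> S" "\<forall>x\<in>S. P x" unfolding eventually_nhds by blast
  then obtain e where "e > 0" "\<forall>y. v (y - 0) < e \<longrightarrow> y \<in> S" unfolding open_iff by blast
  then show "\<exists>e>0. \<forall>x. v x < e \<longrightarrow> P x" using \<open>\<forall>x\<in>S. P x\<close> by auto
next
  assume "\<exists>e>0. \<forall>x. v x < e \<longrightarrow> P x"
  then obtain e where "e > 0" "\<forall>x. v x < e \<longrightarrow> P x" by blast
  then show "\<forall>\<^sub>F x in nhds 0. P x"
    unfolding eventually_nhds using open_ball[of 0 e] by (intro exI[of _ "{x. v (x - 0) < e}"]) auto
qed

lemma ex_pi: "\<exists>p. 0 < v p \<and> v p < 1"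
proof (rule ccontr)
  assume *: "\<nexists>p. 0 < v p \<and> v p < 1"
  have "\<forall>\<^sub>F x in nhds 0. x = (0::'k)"
    unfolding nhds_0_iff using * by (intro exI[of _ 1]) auto
  then have "at (0::'k) = bot"
    by (metis (mono_tags, lifting) at_eq_bot_iff eventually_nhds open_subopen singletonD singletonI subsetI)
  then show False by simp
qed

text \<open>Its powers serve as a null sequence of nonzero scalars and as the radii of the annuli
  below.\<close>

definition p :: 'k where "p = (SOME p. 0 < v p \<and> v p < 1)"

lemma v_p: "0 < v p" "v p < 1"
  using someI_ex[OF ex_pi] unfolding p_def by auto

lemma p_nonzero [simp]: "p \<noteq> 0" using v_p(1) by simp

lemma tendsto_p_power: "(\<lambda>n. p ^ n) \<longlonglongrightarrow> 0"
  unfolding tendsto_v_iff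
proof safe
  fix e :: real assume "e > 0"
  have "(\<lambda>n. v p ^ n) \<longlonglongrightarrow> 0" using v_p by (intro LIMSEQ_realpow_zero) auto
  from order_tendstoD(2)[OF this \<open>e > 0\<close>] show "\<forall>\<^sub>F n in sequentially. v (p ^ n - 0) < e"
    by (simp add: v_power)
qed

lemma ex_small: "0 < e \<Longrightarrow> \<exists>a. a \<noteq> 0 \<and> v a < e"
proof -
  assume "0 < e"
  then obtain n where "v p ^ n < e" using real_arch_pow_inv v_p(2) by blast
  then show ?thesis by (intro exI[of _ "p ^ n"]) (simp add: v_power)
qed

lemma ex_large: "\<exists>a. a \<noteq> 0 \<and> v a > r"
proof -
  define m where "m = max r 1"
  have m: "0 < m" "r \<le> m" by (auto simp: m_def)
  obtain a where a: "a \<noteq> 0" "v a < 1 / m" using ex_small[of "1 / m"] m by auto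
  have "m < v (1 / a)"
    using a v_pos[of a] m by (simp add: v_inverse field_simps)
  then show ?thesis using a m by (intro exI[of _ "1 / a"]) auto
qed

text \<open>Multiplication by a sufficiently small b carries the ball into a compact neighbourhood
  of 0; division by b brings it back.\<close>

lemma compact_cball_0: "compact {x. v x \<le> r}"
proof -
  obtain V C where VC: "open V" "compact C" "(0::'k) \<in> V" "V \<subseteq> C"
    using locally_compact[of 0] by auto
  then obtain e where e: "e > 0" "\<forall>y. v (y - 0) < e \<longrightarrow> y \<in> V" unfolding open_iff by blast
  obtain b where b: "b \<noteq> 0" "v b < e / (max r 0 + 1)" using ex_small[of "e / (max r 0 + 1)"] e by auto
  have "v b * r < e"
  proof -
    have "v b * r \<le> v b * (max r 0 + 1)" by (intro mult_left_mono) auto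
    also have "\<dots> < e" using b by (simp add: field_simps)
    finally show ?thesis .
  qed
  let ?D = "{y. v (y - 0) \<le> v b * r}"
  have "?D \<subseteq> C" using e \<open>v b * r < e\<close> VC(4) by auto
  then have "compact ?D"
    using compact_Int_closed[OF VC(2) closed_cball[of 0 "v b * r"]] by (simp add: Int_absorb1)
  then have "compact ((\<lambda>y. (1 / b) * y) ` ?D)"
    by (intro compact_continuous_image continuous_intros)
  moreover have "(\<lambda>y. (1 / b) * y) ` ?D = {x. v x \<le> r}"
  proof (intro equalityI subsetI)
    fix x assume "x \<in> {x. v x \<le> r}"
    then have "b * x \<in> ?D" "x = (1 / b) * (b * x)" using b by (auto simp: v_mult mult_left_mono)
    then show "x \<in> (\<lambda>y. (1 / b) * y) ` ?D" by blast
  next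
    fix x assume "x \<in> (\<lambda>y. (1 / b) * y) ` ?D"
    then show "x \<in> {x. v x \<le> r}" using b by (auto simp: v_mult v_inverse field_simps)
  qed
  ultimately show ?thesis by simp
qed

lemma compact_cball: "compact {x. v (x - a) \<le> r}"
proof -
  have "compact ((\<lambda>x. x + a) ` {x. v x \<le> r})"
    by (intro compact_continuous_image continuous_intros compact_cball_0)
  moreover have "(\<lambda>x. x + a) ` {x. v x \<le> r} = {x. v (x - a) \<le> r}"
  proof (intro equalityI subsetI)
    fix x assume "x \<in> {x. v (x - a) \<le> r}"
    then show "x \<in> (\<lambda>x. x + a) ` {x. v x \<le> r}" by (intro image_eqI[of _ _ "x - a"]) auto
  qed auto
  ultimately show ?thesis by simp
qed

lemma compact_v_bounded:
  assumes "compact C"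
  shows "\<exists>r. \<forall>x\<in>C. v x \<le> r"
proof -
  have "C \<subseteq> (\<Union>n::nat\<in>UNIV. {x. v (x - 0) < real n})"
    using reals_Archimedean2 by auto
  from compactE_image[OF assms open_ball this]
  obtain N where N: "finite N" "C \<subseteq> (\<Union>n::nat\<in>N. {x. v (x - 0) < real n})" by metis
  have "v x \<le> real (Max N)" if "x \<in> C" for x
  proof -
    have "x \<in> (\<Union>n\<in>N. {x. v (x - 0) < real n})" using N(2) that by (rule subsetD)
    then obtain n where "n \<in> N" "v x < real n" by auto
    moreover have "n \<le> Max N" using N \<open>n \<in> N\<close> by simp
    ultimately show ?thesis by linarith
  qed
  then show ?thesis by blast
qed

text \<open>The hypothesis puts the centre of the smaller of any two balls into the larger one.
  Among finitely many balls the centre of a smallest one is therefore a common point, and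
  compactness passes to the whole family.\<close>

lemma spherical_completeness:
  assumes "\<And>i j. i \<in> I \<Longrightarrow> j \<in> I \<Longrightarrow> v (c i - c j) \<le> max (r i) (r j)"
  shows "\<exists>x. \<forall>i\<in>I. v (x - c i) \<le> r i"
proof (cases "I = {}")
  case False
  then obtain i0 where i0: "i0 \<in> I" by blast
  let ?B = "\<lambda>i. {x. v (x - c i) \<le> r i}"
  have "?B i0 \<inter> \<Inter> (?B ` I) \<noteq> {}"
  proof (rule compact_imp_fip)
    show "compact (?B i0)" by (rule compact_cball)
    show "closed T" if "T \<in> ?B ` I" for T using that closed_cball by blast
    fix F' assume "finite F'" "F' \<subseteq> ?B ` I"
    then obtain J where J: "finite J" "J \<subseteq> I" "F' = ?B ` J" by (meson finite_subset_image)
    define m where "m = arg_min_on r (insert i0 J)"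
    have m: "m \<in> insert i0 J" "\<And>i. i \<in> insert i0 J \<Longrightarrow> r m \<le> r i"
      unfolding m_def using J(1) arg_min_if_finite(1)[of "insert i0 J" r] arg_min_least[of "insert i0 J" _ r] by auto
    have "v (c m - c i) \<le> r i" if "i \<in> insert i0 J" for i
      using assms[of m i] that m i0 J(2) by (metis insert_subset max.absorb2 subsetD)
    then have "c m \<in> ?B i0 \<inter> \<Inter> F'" unfolding J(3) by auto
    then show "?B i0 \<inter> \<Inter> F' \<noteq> {}" by blast
  qed
  then show ?thesis by auto
qed auto

lemma metrizable_local_field: "metrizable_space (euclidean :: 'k topology)"
proof -
  interpret M: Metric_space "UNIV :: 'k set" "\<lambda>x y. v (x - y)"
  proof
    fix x y z
    show "v (x - z) \<le> v (x - y) + v (y - z)"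
    proof -
      have "max (v (x - y)) (v (y - z)) \<le> v (x - y) + v (y - z)" by simp
      moreover have "x - y + (y - z) = x - z" by simp
      ultimately show ?thesis using v_add[of "x - y" "y - z"] by (metis order_trans)
    qed
  qed (auto simp: v_diff_commute)
  have "openin M.mtopology S \<longleftrightarrow> openin euclidean S" for S
    unfolding M.openin_mtopology open_openin[symmetric] open_iff
    by (simp only: subset_iff M.in_mball UNIV_I simp_thms v_diff_commute) auto
  then have "M.mtopology = euclidean" by (simp add: topology_eq)
  then show ?thesis unfolding metrizable_space_def using M.Metric_space_axioms by metis
qed

text \<open>A countable product of metrizable spaces is metrizable. The assumption on E thus
  survives the passage to iterated domains.\<close>

lemma metrizable_universal_space:
  assumes "metrizable_space (euclidean :: 'e::topological_space topology)"
  shows "metrizable_space (euclidean :: (nat \<Rightarrow> 'e \<times> 'k) topology)"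
proof -
  have "metrizable_space (prod_topology euclidean euclidean :: ('e \<times> 'k) topology)"
    unfolding metrizable_space_prod_topology using assms metrizable_local_field by blast
  then show ?thesis
    unfolding euclidean_product_topology[symmetric] metrizable_space_product_topology by simp
qed

text \<open>Continuity of the scalar multiplication at (0, 0) settles scalars of absolute value
  below some e. Writing a q as (a b)(q / b) with b small reduces the bound r to this case.\<close>

lemma tvs_absorbing_bounded:
  fixes s :: "'k \<Rightarrow> 'e::{topological_ab_group_add,t2_space} \<Rightarrow> 'e"
  assumes s: "topological_vector_space s" and S: "open S" "0 \<in> S"
  shows "\<exists>T. open T \<and> 0 \<in> T \<and> (\<forall>q\<in>T. \<forall>a. v a \<le> r \<longrightarrow> s a q \<in> S)"
proof -
  have "isCont (\<lambda>p. s (fst p) (snd p)) (0, 0)"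
    using topological_vector_space.continuous_on_scale[OF s]
    by (simp add: continuous_on_eq_continuous_at case_prod_beta')
  then have "((\<lambda>p. s (fst p) (snd p)) \<longlongrightarrow> 0) (nhds 0 \<times>\<^sub>F nhds 0)"
    by (simp add: isCont_def tendsto_nhds_iff nhds_prod tvs_algebra[OF s] flip: nhds_prod)
  from topological_tendstoD[OF this S] obtain A N where
    A: "\<forall>\<^sub>F a in nhds 0. A a" and N: "\<forall>\<^sub>F x in nhds 0. N x" and AN: "\<And>a x. A a \<Longrightarrow> N x \<Longrightarrow> s a x \<in> S"
    unfolding eventually_prod_filter by auto
  obtain T where T: "open T" "0 \<in> T" "\<And>x. x \<in> T \<Longrightarrow> N x" using N unfolding eventually_nhds by blast
  obtain e where e: "e > 0" "\<And>x. v x < e \<Longrightarrow> A x" using A unfolding nhds_0_iff by blast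
  \<comment> \<open>The denominator is positive even for negative r, and at least r.\<close>
  obtain b where b: "b \<noteq> 0" "v b < e / (max r 0 + 1)" using ex_small[of "e / (max r 0 + 1)"] e by auto
  define T' where "T' = s (1 / b) -` T"
  have "open T'"
    unfolding T'_def by (rule open_vimage[OF T(1)]) (intro tvs_continuous_on[OF s] continuous_intros)
  moreover have "0 \<in> T'" using T(2) by (simp add: T'_def tvs_algebra[OF s])
  moreover have "s a q \<in> S" if "q \<in> T'" "v a \<le> r" for q a
  proof -
    have "v a * v b \<le> (max r 0 + 1) * v b" using that by (intro mult_right_mono) auto
    also have "\<dots> < e" using b by (simp add: field_simps)
    finally have "s (a * b) (s (1 / b) q) \<in> S"
      using that by (intro AN e T) (auto simp: v_mult T'_def)
    then show ?thesis using b by (simp add: tvs_algebra[OF s])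
  qed
  ultimately show ?thesis by blast
qed

end

section \<open>Neighbourhood bases of zero in metrizable groups\<close>

lemma metrizable_nhds_0_base:
  assumes "metrizable_space (euclidean :: ('e::{topological_space,zero}) topology)"
  obtains W :: "nat \<Rightarrow> ('e::{topological_space,zero}) set" where "\<And>n. open (W n)" "\<And>n. 0 \<in> W n"
    "\<And>S. open S \<Longrightarrow> 0 \<in> S \<Longrightarrow> \<exists>m. \<forall>n\<ge>m. W n \<subseteq> S"
proof -
  have "\<exists>B :: 'e set set. countable B \<and> (\<forall>V\<in>B. openin euclidean V) \<and>
      (\<forall>U. openin euclidean U \<and> 0 \<in> U \<longrightarrow> (\<exists>V\<in>B. 0 \<in> V \<and> V \<subseteq> U))"
    using metrizable_imp_first_countable[OF assms] unfolding first_countable_def by (elim ballE[of _ _ 0]) auto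
  then obtain B :: "'e set set" where B: "countable B" "\<forall>V\<in>B. open V"
    "\<forall>U. open U \<and> 0 \<in> U \<longrightarrow> (\<exists>V\<in>B. 0 \<in> V \<and> V \<subseteq> U)"
    unfolding open_openin[symmetric] by (elim exE conjE)
  define B' where "B' = {V\<in>B. 0 \<in> V}"
  have "B' \<noteq> {}" "countable B'" using B(1) B(3)[rule_format, of UNIV] by (auto simp: B'_def)
  have f: "open (from_nat_into B' i)" "0 \<in> from_nat_into B' i" for i
    using from_nat_into[OF \<open>B' \<noteq> {}\<close>, of i] B(2) by (auto simp: B'_def)
  show ?thesis
  proof (rule that[of "\<lambda>n. \<Inter>i\<le>n. from_nat_into B' i"])
    fix S :: "'e set" assume "open S" "0 \<in> S"
    then obtain V where V: "V \<in> B'" "V \<subseteq> S" using B(3)[rule_format, of S] by (auto simp: B'_def)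
    from from_nat_into_surj[OF \<open>countable B'\<close> V(1)] obtain m where "from_nat_into B' m = V" by blast
    then have "from_nat_into B' m \<subseteq> S" using V by simp
    then show "\<exists>m. \<forall>n\<ge>m. (\<Inter>i\<le>n. from_nat_into B' i) \<subseteq> S" by (intro exI[of _ m]) fastforce
  qed (use f in auto)
qed

lemma nhds_0_halving:
  fixes S :: "'e::topological_ab_group_add set"
  assumes "open S" "0 \<in> S"
  obtains T where "open T" "0 \<in> T" "\<And>x y. x \<in> T \<Longrightarrow> y \<in> T \<Longrightarrow> x + y \<in> S"
proof -
  have "LIM x (nhds 0 \<times>\<^sub>F nhds 0). fst x + snd x :> nhds (0 + 0 :: 'e)" by (rule tendsto_add_Pair)
  then have "\<forall>\<^sub>F x in nhds 0 \<times>\<^sub>F nhds 0. fst x + snd x \<in> S"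
    using topological_tendstoD[OF _ assms(1), of _ 0] assms(2) by simp
  then obtain A B where "\<forall>\<^sub>F x in nhds 0. A x" "\<forall>\<^sub>F x in nhds 0. B x" "\<And>x y. A x \<Longrightarrow> B y \<Longrightarrow> x + y \<in> S"
    unfolding eventually_prod_filter by auto
  moreover from this(1,2) have "\<forall>\<^sub>F x in nhds 0. A x \<and> B x" by eventually_elim auto
  ultimately show ?thesis using that unfolding eventually_nhds by metis
qed

lemma nhds_0_halving_base:
  assumes "metrizable_space (euclidean :: 'e::topological_ab_group_add topology)"
  obtains W :: "nat \<Rightarrow> ('e::topological_ab_group_add) set" where "\<And>n. open (W n)" "\<And>n. 0 \<in> W n"
    "\<And>S. open S \<Longrightarrow> 0 \<in> S \<Longrightarrow> \<exists>m. \<forall>n\<ge>m. W n \<subseteq> S"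
    "\<And>n x y. x \<in> W (Suc n) \<Longrightarrow> y \<in> W (Suc n) \<Longrightarrow> x + y \<in> W n"
proof -
  obtain B :: "nat \<Rightarrow> 'e set" where B: "\<And>n. open (B n)" "\<And>n. 0 \<in> B n"
    "\<And>S. open S \<Longrightarrow> 0 \<in> S \<Longrightarrow> \<exists>m. \<forall>n\<ge>m. B n \<subseteq> S" by (rule metrizable_nhds_0_base[OF assms]) blast
  have "\<exists>W. \<forall>n. (open (W n) \<and> 0 \<in> W n \<and> W n \<subseteq> B n) \<and> (\<forall>x\<in>W (Suc n). \<forall>y\<in>W (Suc n). x + y \<in> W n)"
  proof (rule dependent_nat_choice)
    fix S n assume S: "open S \<and> 0 \<in> S \<and> S \<subseteq> B n"
    then obtain T where "open T" "0 \<in> T" "\<And>x y. x \<in> T \<Longrightarrow> y \<in> T \<Longrightarrow> x + y \<in> S"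
      using nhds_0_halving[of S] by blast
    then show "\<exists>T. (open T \<and> 0 \<in> T \<and> T \<subseteq> B (Suc n)) \<and> (\<forall>x\<in>T. \<forall>y\<in>T. x + y \<in> S)"
      using B by (intro exI[of _ "T \<inter> B (Suc n)"]) auto
  qed (use B in blast)
  then obtain W where "\<forall>n. (open (W n) \<and> 0 \<in> W n \<and> W n \<subseteq> B n) \<and>
      (\<forall>x\<in>W (Suc n). \<forall>y\<in>W (Suc n). x + y \<in> W n)" by (rule exE)
  note W = this[rule_format]
  have "\<exists>m. \<forall>n\<ge>m. W n \<subseteq> S" if S: "open S" "0 \<in> S" for S
    using B(3)[OF S] W by (metis order_trans)
  then show ?thesis
    using W by (intro that[of W]) blast+
qed

text \<open>Peel off the index m + 1: its term and, inductively, the sum of all later terms lie in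
  \<open>W (Suc m)\<close>, so their sum lies in \<open>W m\<close>. This takes the place of a
  geometric series estimate.\<close>

lemma sum_in_halving_base:
  fixes x :: "nat \<Rightarrow> 'e::comm_monoid_add"
  assumes W: "\<And>n x y. x \<in> W (Suc n) \<Longrightarrow> y \<in> W (Suc n) \<Longrightarrow> x + y \<in> W n" "\<And>n. 0 \<in> W n"
    and "finite A" "A \<subseteq> {Suc m..}" "\<And>n. n \<in> A \<Longrightarrow> x n \<in> W n"
  shows "sum x A \<in> W m"
proof -
  have "sum x A \<in> W m" if "A \<subseteq> {Suc m..<Suc m + l}" "\<And>n. n \<in> A \<Longrightarrow> x n \<in> W n" for l A
    using that
  proof (induction l arbitrary: m A)
    case 0
    then show ?case using W(2) by simp
  next
    case (Suc l)
    have "sum x (A - {Suc m}) \<in> W (Suc m)"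
    proof (rule Suc.IH)
      show "A - {Suc m} \<subseteq> {Suc (Suc m)..<Suc (Suc m) + l}" using Suc.prems(1) by force
    qed (use Suc.prems in auto)
    moreover have "finite A" using Suc.prems(1) finite_subset by blast
    ultimately show ?case
      using W(1)[of "x (Suc m)" m "sum x (A - {Suc m})"] W(1)[of 0 m "sum x (A - {Suc m})"] W(2) Suc.prems(2)
      by (cases "Suc m \<in> A") (auto simp: sum.remove)
  qed
  moreover have "A \<subseteq> {Suc m..<Suc m + Suc (Max A)}"
  proof
    fix n assume "n \<in> A"
    then have "n \<le> Max A" "Suc m \<le> n" using assms(3,4) by auto
    then show "n \<in> {Suc m..<Suc m + Suc (Max A)}" by simp
  qed
  ultimately show ?thesis using assms(5) by blast
qed

section \<open>Curves through rapidly converging sequences\<close>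

lemma uext_UNIV [simp]: "uext s UNIV = UNIV" "(uext s ^^ k) UNIV = UNIV"
proof -
  show "uext s UNIV = UNIV" by (simp add: uext_def)
  then show "(uext s ^^ k) UNIV = UNIV" by (induction k) auto
qed

text \<open>Points with nonzero parameter are dense, so open conditions at parameter 0 can be moved
  to points where the quotient is explicit.\<close>

lemma ex_upar_nonzero:
  fixes z :: "nat \<Rightarrow> 'b::{topological_ab_group_add,t2_space} \<times> 'k::local_field"
  assumes "open S" "z \<in> S"
  shows "\<exists>w\<in>S. upar w \<noteq> 0"
proof (cases "upar z = 0")
  case True
  define c :: "'k \<Rightarrow> nat \<Rightarrow> 'b \<times> 'k" where "c t = z + uinc 0 0 t" for t
  have "continuous_on UNIV c"
    unfolding c_def by (intro continuous_on_add continuous_on_uinc continuous_intros)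
  then have "(c \<longlongrightarrow> c 0) (at 0)"
    by (simp add: continuous_on_def)
  moreover have "c 0 = z" by (auto simp: c_def uinc_def fun_eq_iff zero_prod_def fun_ops)
  ultimately have "\<forall>\<^sub>F t in at 0. c t \<in> S"
    using topological_tendstoD assms by metis
  then have "\<forall>\<^sub>F t in at 0. c t \<in> S \<and> t \<noteq> 0"
    using eventually_neq_at_within[of "0::'k" 0 UNIV] by eventually_elim simp
  then obtain t where "c t \<in> S" "t \<noteq> 0"
    using eventually_happens[of _ "at (0::'k)"] at_0_neq_bot by blast
  moreover have "upar (c t) = t" using True by (simp add: c_def cont_linearD[OF cont_linear_upar])
  ultimately show ?thesis by (intro bexI[of _ "c t"]) simp_all
qed (use assms in auto)

text \<open>This is \<open>tree_emb\<close> after \<open>tree_ret k\<close>: it keeps only the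
  coordinates that a k-th difference quotient depends on. Over K its image is finite-dimensional,
  which provides compact sets that X itself has no room for in bounded form.\<close>

primrec uproj :: "nat \<Rightarrow> (nat \<Rightarrow> 'b::zero \<times> 'k::zero) \<Rightarrow> nat \<Rightarrow> 'b \<times> 'k" where
  "uproj 0 z = uemb (uret z)"
| "uproj (Suc k) z = uinc (uproj k (ubase z)) (uproj k (udir z)) (upar z)"

lemma cont_linear_uproj:
  assumes s: "topological_vector_space s"
  shows "cont_linear (uscale s) (uscale s) (uproj k)"
proof (induction k)
  case 0
  show ?case unfolding uproj.simps by (rule cont_linear_comp[OF cont_linear_uret cont_linear_uemb])
next
  case (Suc k)
  show ?case unfolding uproj.simps
    by (intro cont_linear_uinc[OF s] cont_linear_comp[OF cont_linear_ubase Suc]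
        cont_linear_comp[OF cont_linear_udir Suc] cont_linear_upar)
qed

text \<open>The increment quotients at z and at its projection agree as functions of t; hence so do
  their limits, including the default value where no limit exists.\<close>

lemma funpow_udq_uproj:
  assumes s: "topological_vector_space s"
  shows "(udq s s' ^^ k) (\<lambda>z. f (uret z)) (uproj k z) = (udq s s' ^^ k) (\<lambda>z. f (uret z)) z"
proof (induction k arbitrary: z)
  case (Suc k)
  have "udq s s' g (uproj (Suc k) z) = udq s s' g z" if g: "\<And>x. g (uproj k x) = g x" for g
  proof -
    have "g (uproj k x + uscale s t (uproj k y)) = g (x + uscale s t y)" for x y t
      using g[of "x + uscale s t y"] cont_linearD[OF cont_linear_uproj[OF s, of k]] by metis
    then show ?thesis by (simp add: udq_def g)
  qed
  from this[of "(udq s s' ^^ k) (\<lambda>z. f (uret z))", OF Suc] show ?case by simp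
qed simp

context valued_local_field
begin

text \<open>The boxes are open and exhaust X as r grows, but they constrain only the coordinates
  seen by \<open>uproj k\<close>. Their images under \<open>uproj k\<close> lie in the compact sets
  \<open>ucompact k r\<close>.\<close>

primrec ubox :: "nat \<Rightarrow> real \<Rightarrow> (nat \<Rightarrow> 'k \<times> 'k) set" where
  "ubox 0 r = {z. v (uret z) < r}"
| "ubox (Suc k) r = {z. ubase z \<in> ubox k r \<and> udir z \<in> ubox k r \<and> v (upar z) < r}"

primrec ucompact :: "nat \<Rightarrow> real \<Rightarrow> (nat \<Rightarrow> 'k \<times> 'k) set" where
  "ucompact 0 r = uemb ` {x. v x \<le> r}"
| "ucompact (Suc k) r = (\<lambda>(x, y, t). uinc x y t) ` (ucompact k r \<times> ucompact k r \<times> {x. v x \<le> r})"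

lemma compact_ucompact: "compact (ucompact k r)"
proof (induction k)
  case 0
  have "continuous_on {x. v x \<le> r} (uemb :: 'k \<Rightarrow> nat \<Rightarrow> 'k \<times> 'k)"
    using cont_linearD(3)[OF cont_linear_uemb[of "(*)"]] .
  from compact_continuous_image[OF this compact_cball_0] show ?case by simp
next
  case (Suc k)
  let ?C = "ucompact k r \<times> ucompact k r \<times> {x. v x \<le> r}"
  have "continuous_on ?C (\<lambda>p. uinc (fst p) (fst (snd p)) (snd (snd p)))"
    by (intro continuous_on_uinc continuous_intros)
  from compact_continuous_image[OF this compact_Times[OF Suc compact_Times[OF Suc compact_cball_0]]]
  show ?case by (simp add: case_prod_beta')
qed

lemma uproj_ubox: "z \<in> ubox k r \<Longrightarrow> uproj k z \<in> ucompact k r"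
proof (induction k arbitrary: z)
  case (Suc k)
  then have "uproj (Suc k) z = (\<lambda>(x, y, t). uinc x y t) (uproj k (ubase z), uproj k (udir z), upar z)"
    "(uproj k (ubase z), uproj k (udir z), upar z) \<in> ucompact k r \<times> ucompact k r \<times> {x. v x \<le> r}" by simp_all
  then show ?case unfolding ucompact.simps by (rule image_eqI)
qed simp

lemma open_ubox: "open (ubox k r)"
proof (induction k)
  case 0
  have "ubox 0 r = uret -` {x. v (x - 0) < r}" by auto
  then show ?case by (simp only: open_uret_vimage[OF open_ball])
next
  case (Suc k)
  have "ubox (Suc k) r = ubase -` ubox k r \<inter> udir -` ubox k r \<inter> upar -` {x. v (x - 0) < r}" by auto
  then show ?case
    by (simp only:) (intro open_Int open_vimage Suc open_ball cont_linearD(3)[OF cont_linear_ubase[of "(*)"]]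
        cont_linearD(3)[OF cont_linear_udir[of "(*)"]] cont_linearD(3)[OF cont_linear_upar[of "(*)"]])
qed

lemma ubox_mono: "r \<le> r' \<Longrightarrow> ubox k r \<subseteq> ubox k r'"
  by (induction k) auto

lemma ex_ubox: "\<exists>r::nat. z \<in> ubox k (real r)"
proof (induction k arbitrary: z)
  case 0
  then show ?case using reals_Archimedean2 by auto
next
  case (Suc k)
  obtain a b c :: nat where "ubase z \<in> ubox k (real a)" "udir z \<in> ubox k (real b)" "v (upar z) < real c"
    using Suc[of "ubase z"] Suc[of "udir z"] reals_Archimedean2 by blast
  then have "z \<in> ubox (Suc k) (real (a + b + c))"
    using ubox_mono[of "real a" "real (a + b + c)" k] ubox_mono[of "real b" "real (a + b + c)" k] by auto
  then show ?case by blast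
qed

text \<open>Half-open shells: they are clopen, disjoint, cover all u with 0 < |u| <= 1, and the n-th
  contains \<open>p ^ n\<close>.\<close>

definition annulus :: "nat \<Rightarrow> 'k set" where
  "annulus n = {u. v p ^ Suc n < v u \<and> v u \<le> v p ^ n}"

lemma annulus_disjoint: "u \<in> annulus n \<Longrightarrow> u \<in> annulus m \<Longrightarrow> n = m"
proof (rule ccontr)
  have *: False if "u \<in> annulus n" "u \<in> annulus m" "n < m" for n m
  proof -
    have "v p ^ m \<le> v p ^ Suc n" using that(3) v_p by (intro power_decreasing) auto
    then show False using that by (simp add: annulus_def)
  qed
  assume "u \<in> annulus n" "u \<in> annulus m" "n \<noteq> m"
  then show False using *[of n m] *[of m n] by (cases "n < m") auto
qed

lemma p_power_in_annulus: "p ^ n \<in> annulus n"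
  using v_p by (simp add: annulus_def v_power)

lemma open_annulus: "open (annulus n)" "open (- annulus n)"
proof -
  have pos: "0 < v p ^ m" for m using v_p by simp
  have "annulus n = {u. v (u - 0) > v p ^ Suc n} \<inter> {u. v (u - 0) \<le> v p ^ n}" by (auto simp: annulus_def)
  then show "open (annulus n)"
    by (simp only:) (intro open_Int open_outside_cball open_cball pos)
  have "- annulus n = {u. v (u - 0) \<le> v p ^ Suc n} \<union> {u. v (u - 0) > v p ^ n}" by (auto simp: annulus_def)
  then show "open (- annulus n)"
    by (simp only:) (intro open_Un open_outside_cball open_cball pos)
qed

text \<open>The annulus and its complement are open, so the indicator is locally constant.\<close>

lemma smooth_annulus_indicator: "C_infinity_on (*) (*) UNIV (indicator (annulus n) :: 'k \<Rightarrow> 'k)"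
proof (rule C_infinity_on_local[OF tvs_mult tvs_mult open_UNIV])
  fix u
  have c: "C_infinity_on (*) (*) (annulus n) (indicator (annulus n) :: 'k \<Rightarrow> 'k)"
    by (subst C_infinity_on_cong[OF tvs_mult tvs_mult open_annulus(1), where g = "\<lambda>_. 1"])
      (auto intro: C_infinity_on_const[OF tvs_mult tvs_mult open_annulus(1)])
  have c': "C_infinity_on (*) (*) (- annulus n) (indicator (annulus n) :: 'k \<Rightarrow> 'k)"
    by (subst C_infinity_on_cong[OF tvs_mult tvs_mult open_annulus(2), where g = "\<lambda>_. 0"])
      (auto intro: C_infinity_on_const[OF tvs_mult tvs_mult open_annulus(2)])
  show "\<exists>W. open W \<and> u \<in> W \<and> W \<subseteq> UNIV \<and> C_infinity_on (*) (*) W (indicator (annulus n) :: 'k \<Rightarrow> 'k)"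
    using c c' open_annulus by (cases "u \<in> annulus n") (intro exI conjI; (assumption | simp))+
qed

definition annulus_dq :: "nat \<Rightarrow> nat \<Rightarrow> (nat \<Rightarrow> 'k \<times> 'k) \<Rightarrow> 'k" where
  "annulus_dq n k = (udq (*) (*) ^^ k) (\<lambda>z. indicator (annulus n) (uret z))"

lemma continuous_annulus_dq: "continuous_on S (annulus_dq n k)"
proof -
  have "usmooth (*) (*) UNIV (\<lambda>z. indicator (annulus n) (uret z) :: 'k)"
    using smooth_annulus_indicator[of n]
    unfolding C_infinity_on_iff_usmooth[OF tvs_mult open_UNIV] by simp
  then have "continuous_on UNIV (annulus_dq n k)"
    unfolding usmooth_def annulus_dq_def by simp
  then show ?thesis by (rule continuous_on_subset) simp
qed

lemma annulus_dq_bounded: "\<exists>r. \<forall>z\<in>ubox k R. v (annulus_dq n k z) \<le> r"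
proof -
  from compact_v_bounded[OF compact_continuous_image[OF continuous_annulus_dq compact_ucompact]]
  obtain r where "\<forall>x\<in>annulus_dq n k ` ucompact k R. v x \<le> r" by (rule exE)
  moreover have "annulus_dq n k z = annulus_dq n k (uproj k z)" for z
    unfolding annulus_dq_def by (rule funpow_udq_uproj[OF tvs_mult, symmetric])
  ultimately have "\<forall>z\<in>ubox k R. v (annulus_dq n k z) \<le> r"
    using uproj_ubox by (metis imageI)
  then show ?thesis by blast
qed

lemma annulus_dq_Suc:
  "upar z \<noteq> 0 \<Longrightarrow>
   annulus_dq n (Suc k) z = (1 / upar z) * (annulus_dq n k (ustep (*) z) - annulus_dq n k (ubase z))"
  by (simp add: annulus_dq_def udq_nonzero)

text \<open>Disjoint annuli give the bound 1 for k = 0. A quotient with nonzero parameter can be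
  nonzero only if one of its two end values is, so each order at most doubles the count. At
  parameter 0 the quotient is a limit; but non-vanishing of finitely many continuous functions is an
  open condition, which moves the claim to a nonzero parameter.\<close>

lemma annulus_dq_card_le:
  assumes "finite S" "\<And>n. n \<in> S \<Longrightarrow> annulus_dq n k z \<noteq> 0"
  shows "card S \<le> 2 ^ k"
  using assms
proof (induction k arbitrary: z S)
  case 0
  have "\<exists>m. S \<subseteq> {m}"
  proof (cases "S = {}")
    case False
    then obtain m where "m \<in> S" by blast
    have "uret z \<in> annulus n" if "n \<in> S" for n
      using 0(2)[OF that] by (simp add: annulus_dq_def indicator_def split: if_splits)
    then have "S \<subseteq> {m}" using \<open>m \<in> S\<close> annulus_disjoint by blast
    then show ?thesis by blast
  qed simp
  then obtain m where "S \<subseteq> {m}" by (rule exE)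
  then have "card S \<le> card {m}" by (intro card_mono) auto
  then show ?case by simp
next
  case (Suc k)
  have nz: "card S \<le> 2 ^ Suc k" if "\<And>n. n \<in> S \<Longrightarrow> annulus_dq n (Suc k) z \<noteq> 0" "upar z \<noteq> 0" for z
  proof -
    let ?A = "{n\<in>S. annulus_dq n k (ustep (*) z) \<noteq> 0}" and ?B = "{n\<in>S. annulus_dq n k (ubase z) \<noteq> 0}"
    have "S \<subseteq> ?A \<union> ?B"
    proof
      fix n assume "n \<in> S"
      then have "annulus_dq n k (ustep (*) z) - annulus_dq n k (ubase z) \<noteq> 0"
        using that(1)[OF \<open>n \<in> S\<close>] unfolding annulus_dq_Suc[OF that(2)] mult_eq_0_iff by simp
      then have "annulus_dq n k (ustep (*) z) \<noteq> 0 \<or> annulus_dq n k (ubase z) \<noteq> 0" by (metis diff_self)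
      then show "n \<in> ?A \<union> ?B" using \<open>n \<in> S\<close> by simp
    qed
    then have "card S \<le> card (?A \<union> ?B)" using Suc.prems(1) by (intro card_mono) auto
    also have "\<dots> \<le> card ?A + card ?B" by (rule card_Un_le)
    also have "\<dots> \<le> 2 ^ k + 2 ^ k"
    proof (rule add_mono)
      show "card ?A \<le> 2 ^ k" by (rule Suc.IH[of _ "ustep (*) z"]) (use Suc.prems(1) in simp_all)
      show "card ?B \<le> 2 ^ k" by (rule Suc.IH[of _ "ubase z"]) (use Suc.prems(1) in simp_all)
    qed
    finally show ?thesis by simp
  qed
  define N where "N = (\<Inter>n\<in>S. annulus_dq n (Suc k) -` (- {0}))"
  have "open N"
    unfolding N_def using Suc.prems(1) by (intro open_INT ballI open_vimage continuous_annulus_dq) auto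
  moreover have "z \<in> N" using Suc.prems(2) by (auto simp: N_def)
  ultimately obtain w where w: "w \<in> N" "upar w \<noteq> 0" using ex_upar_nonzero by blast
  show ?case by (rule nz[OF _ w(2)]) (use w(1) in \<open>auto simp: N_def\<close>)
qed

lemma finite_annulus_dq: "finite {n. annulus_dq n k z \<noteq> 0}"
proof (rule ccontr)
  assume "infinite {n. annulus_dq n k z \<noteq> 0}"
  then obtain S where S: "S \<subseteq> {n. annulus_dq n k z \<noteq> 0}" "finite S" "card S = Suc (2 ^ k)"
    using infinite_arbitrarily_large by blast
  then show False using annulus_dq_card_le[OF S(2), of k z] by auto
qed

lemma nhds_0_add_diff:
  fixes S :: "'e::topological_ab_group_add set"
  assumes "open S" "0 \<in> S"
  obtains T where "open T" "0 \<in> T" "\<And>x y w. x \<in> T \<Longrightarrow> y \<in> T \<Longrightarrow> w \<in> T \<Longrightarrow> x + (y - w) \<in> S"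
proof -
  obtain A where A: "open A" "0 \<in> A" "\<And>x y. x \<in> A \<Longrightarrow> y \<in> A \<Longrightarrow> x + y \<in> S"
    using nhds_0_halving[OF assms] by metis
  obtain B where B: "open B" "0 \<in> B" "\<And>x y. x \<in> B \<Longrightarrow> y \<in> B \<Longrightarrow> x + y \<in> A"
    using nhds_0_halving[OF A(1,2)] by metis
  have "open (uminus -` B)" by (rule open_vimage[OF B(1)]) (intro continuous_intros)
  then show ?thesis
    using A B by (intro that[of "A \<inter> B \<inter> uminus -` B"]) (auto simp: diff_conv_add_uminus simp del: add_uminus_conv_diff)
qed

text \<open>
  The curve takes the value \<open>q n\<close> on the \<open>n\<close>-th annulus. It is smooth if \<open>q n\<close> decays fast compared to
  the bounds for the difference quotients of the indicator functions of the annuli; the values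
  of its difference quotients are finite sums, so that no completeness is needed.
\<close>

lemma ex_smooth_curve:
  fixes s :: "'k \<Rightarrow> 'e::{topological_ab_group_add,t2_space} \<Rightarrow> 'e"
  assumes s: "topological_vector_space s" and metr: "metrizable_space (euclidean :: 'e topology)"
    and Q: "\<And>S. open S \<Longrightarrow> 0 \<in> S \<Longrightarrow> \<exists>q\<in>S. Q q"
  shows "\<exists>c. C_infinity_on (*) s UNIV c \<and> c 0 = 0 \<and> (\<forall>u. c u = 0 \<or> Q (c u)) \<and> (\<forall>n. Q (c (p ^ n)))"
proof -
  obtain W where W: "\<And>n. open (W n)" "\<And>n. (0::'e) \<in> W n"
    "\<And>S. open S \<Longrightarrow> 0 \<in> S \<Longrightarrow> \<exists>m. \<forall>n\<ge>m. W n \<subseteq> S"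
    "\<And>n x y. x \<in> W (Suc n) \<Longrightarrow> y \<in> W (Suc n) \<Longrightarrow> x + y \<in> W n"
    using nhds_0_halving_base[OF metr] by metis
  \<comment> \<open>One constant for all orders up to n on boxes of radius n: for fixed k and z the
    bound then holds for all late n.\<close>
  have "\<exists>r. \<forall>k\<le>n. \<forall>z\<in>ubox k (real n). v (annulus_dq n k z) \<le> r" for n
  proof -
    have "\<forall>k. \<exists>r. \<forall>z\<in>ubox k (real n). v (annulus_dq n k z) \<le> r"
      by (intro allI annulus_dq_bounded)
    from choice[OF this] obtain b where b: "\<forall>k. \<forall>z\<in>ubox k (real n). v (annulus_dq n k z) \<le> b k"
      by (rule exE)
    have "\<forall>k\<le>n. \<forall>z\<in>ubox k (real n). v (annulus_dq n k z) \<le> Max (b ` {..n})"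
    proof safe
      fix k z assume "k \<le> n" "z \<in> ubox k (real n)"
      then have "v (annulus_dq n k z) \<le> b k" using b by blast
      also have "\<dots> \<le> Max (b ` {..n})" using \<open>k \<le> n\<close> by simp
      finally show "v (annulus_dq n k z) \<le> Max (b ` {..n})" .
    qed
    then show ?thesis by blast
  qed
  then obtain r where r: "\<And>n k z. k \<le> n \<Longrightarrow> z \<in> ubox k (real n) \<Longrightarrow> v (annulus_dq n k z) \<le> r n"
    by metis
  have "\<exists>q. Q q \<and> (\<forall>a. v a \<le> r n \<longrightarrow> s a q \<in> W n)" for n
    using tvs_absorbing_bounded[OF s W(1,2)[of n], of "r n"] Q by metis
  then obtain q where q: "\<And>n. Q (q n)" "\<And>n a. v a \<le> r n \<Longrightarrow> s a (q n) \<in> W n" by metis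
  define N where "N k z = {n. annulus_dq n k z \<noteq> 0}" for k z
  \<comment> \<open>The candidate for the k-th quotient of the curve, formed term by term;
    \<open>G 0\<close> is the curve itself. By the cardinality bound each sum is finite.\<close>
  define G where "G k z = (\<Sum>n\<in>N k z. s (annulus_dq n k z) (q n))" for k z
  have G: "G k z = (\<Sum>n\<in>A. s (annulus_dq n k z) (q n))" if "finite A" "N k z \<subseteq> A" for A k z
    unfolding G_def using that
    by (intro sum.mono_neutral_left) (auto simp: N_def tvs_algebra[OF s])
  have N_finite [simp]: "finite (N k z)" for k z
    unfolding N_def by (rule finite_annulus_dq)
  \<comment> \<open>The head has a fixed index set and is continuous; the tail is uniformly small on
    a box, although its index set varies with z.\<close>
  define hd where "hd M k z = (\<Sum>n<M. s (annulus_dq n k z) (q n))" for M k z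
  define tl where "tl M k z = (\<Sum>n\<in>N k z - {..<M}. s (annulus_dq n k z) (q n))" for M k z
  have split: "G k z = hd M k z + tl M k z" for M k z
  proof -
    have "G k z = (\<Sum>n\<in>{..<M} \<union> (N k z - {..<M}). s (annulus_dq n k z) (q n))" by (intro G) auto
    also have "\<dots> = hd M k z + tl M k z"
      unfolding hd_def tl_def by (intro sum.union_disjoint) auto
    finally show ?thesis .
  qed
  have tail: "tl (Suc m) k z \<in> W m" if "k \<le> Suc m" "z \<in> ubox k (real (Suc m))" for m k z
    unfolding tl_def
  proof (rule sum_in_halving_base[where W = W])
    fix n assume "n \<in> N k z - {..<Suc m}"
    then have "k \<le> n" "z \<in> ubox k (real n)"
      using that ubox_mono[of "real (Suc m)" "real n" k] by auto
    then show "s (annulus_dq n k z) (q n) \<in> W n" by (intro q(2) r)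
  qed (use W(2,4) in auto)
  have cont: "continuous_on UNIV (G k)" for k
    unfolding continuous_on_def
  proof safe
    fix z
    show "(G k \<longlongrightarrow> G k z) (at z)"
    proof (rule topological_tendstoI)
      fix S assume S: "open S" "G k z \<in> S"
      have "open ((\<lambda>x. G k z + x) -` S)" by (rule open_vimage[OF S(1)]) (intro continuous_intros)
      moreover have "0 \<in> (\<lambda>x. G k z + x) -` S" using S(2) by simp
      ultimately obtain T where T: "open T" "0 \<in> T"
        "\<And>x y w. x \<in> T \<Longrightarrow> y \<in> T \<Longrightarrow> w \<in> T \<Longrightarrow> x + (y - w) \<in> (\<lambda>x. G k z + x) -` S"
        using nhds_0_add_diff by metis
      obtain m0 where m0: "\<forall>n\<ge>m0. W n \<subseteq> T" using W(3)[OF T(1,2)] by blast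
      obtain R where R: "z \<in> ubox k (real R)" using ex_ubox by blast
      \<comment> \<open>Large enough for three purposes: \<open>W m\<close> lies in T, z lies in the
        box of radius m + 1, and k is at most m + 1.\<close>
      define m where "m = m0 + R + k"
      have z: "z \<in> ubox k (real (Suc m))" using R ubox_mono[of "real R" "real (Suc m)" k] by (auto simp: m_def)
      have "continuous_on UNIV (hd (Suc m) k)"
        unfolding hd_def
        by (intro continuous_on_sum tvs_continuous_on[OF s] continuous_annulus_dq continuous_on_const)
      then have "((\<lambda>w. hd (Suc m) k w - hd (Suc m) k z) \<longlongrightarrow> hd (Suc m) k z - hd (Suc m) k z) (at z)"
        by (intro tendsto_diff tendsto_const) (simp add: continuous_on_def)
      then have e1: "\<forall>\<^sub>F w in at z. hd (Suc m) k w - hd (Suc m) k z \<in> T"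
        using topological_tendstoD T(1,2) by (metis diff_self)
      have "\<forall>\<^sub>F w in nhds z. w \<in> ubox k (real (Suc m))"
        using z open_ubox eventually_nhds by blast
      then have e2: "\<forall>\<^sub>F w in at z. w \<in> ubox k (real (Suc m))"
        by (simp add: eventually_at_filter eventually_mono)
      show "\<forall>\<^sub>F w in at z. G k w \<in> S"
        using e1 e2
      proof eventually_elim
        case (elim w)
        have "tl (Suc m) k w \<in> T" "tl (Suc m) k z \<in> T"
          using tail[of k m w, OF _ elim(2)] tail[of k m z, OF _ z] m0[rule_format, of m]
          by (auto simp: m_def)
        from T(3)[OF elim(1) this] show "G k w \<in> S"
          using split[of k w "Suc m"] split[of k z "Suc m"] by (simp add: algebra_simps)
      qed
    qed
  qed
  have step: "G (Suc k) z = s (1 / upar z) (G k (ustep (*) z) - G k (ubase z))" if "upar z \<noteq> 0" for k z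
  proof -
    \<comment> \<open>One finite index set for all three sums, so that the quotient can be formed
      termwise.\<close>
    define A where "A = N (Suc k) z \<union> N k (ustep (*) z) \<union> N k (ubase z)"
    have "G (Suc k) z = (\<Sum>n\<in>A. s (annulus_dq n (Suc k) z) (q n))"
      "G k (ustep (*) z) = (\<Sum>n\<in>A. s (annulus_dq n k (ustep (*) z)) (q n))"
      "G k (ubase z) = (\<Sum>n\<in>A. s (annulus_dq n k (ubase z)) (q n))"
      by (intro G; auto simp: A_def)+
    then show ?thesis
      by (simp only: annulus_dq_Suc[OF that] tvs_algebra(3,9,10,11)[OF s] right_diff_distrib sum_subtractf)
  qed
  define c where "c u = G 0 (uemb u)" for u
  have c: "G 0 z = c (uret z)" for z
    by (simp add: c_def G_def N_def annulus_dq_def)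
  have "usmooth (*) s UNIV (G 0)"
  proof (rule usmooth_coinduct[OF tvs_mult, where R = "\<lambda>V f. V = UNIV \<and> f \<in> range G"])
    fix V :: "(nat \<Rightarrow> 'k \<times> 'k) set" and f assume "V = UNIV \<and> f \<in> range G"
    then obtain k where k: "V = UNIV" "f = G k" by (elim conjE imageE) simp
    have "\<forall>z\<in>UNIV. upar z \<noteq> 0 \<longrightarrow> G (Suc k) z = s (1 / upar z) (G k (ustep (*) z) - G k (ubase z))"
      by (intro ballI impI step)
    then show "open V \<and> continuous_on V f \<and> (\<exists>g. (uext (*) V = UNIV \<and> g \<in> range G) \<and>
      (\<forall>z\<in>uext (*) V. upar z \<noteq> 0 \<longrightarrow> g z = s (1 / upar z) (f (ustep (*) z) - f (ubase z))))"
      unfolding k uext_UNIV by (intro conjI exI[of _ "G (Suc k)"] open_UNIV cont refl rangeI)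
  qed (intro conjI refl rangeI)
  then have "C_infinity_on (*) s UNIV c"
    unfolding C_infinity_on_iff_usmooth[OF tvs_mult open_UNIV] c[symmetric] by simp
  moreover have in_annulus: "c u = q n" if "u \<in> annulus n" for u n
  proof -
    have *: "u \<in> annulus m \<longleftrightarrow> m = n" for m
      using annulus_disjoint[OF that, of m] that by (cases "m = n") auto
    have "N 0 (uemb u) = {n}"
      unfolding N_def annulus_dq_def indicator_def by (simp add: *)
    then show ?thesis using that by (simp add: c_def G_def annulus_dq_def tvs_algebra[OF s])
  qed
  moreover have outside: "c u = 0" if "\<And>n. u \<notin> annulus n" for u
  proof -
    have "N 0 (uemb u) = {}" unfolding N_def annulus_dq_def indicator_def by (simp add: that)
    then show ?thesis by (simp add: c_def G_def)
  qed
  moreover have "c 0 = 0"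
  proof (rule outside)
    show "0 \<notin> annulus n" for n using v_p by (simp add: annulus_def not_less)
  qed
  moreover have "Q (c (p ^ n))" for n
    using in_annulus[OF p_power_in_annulus] q(1) by simp
  moreover have "c u = 0 \<or> Q (c u)" for u
    using in_annulus outside q(1) by metis
  ultimately show ?thesis by blast
qed

end

section \<open>Boman's theorem for scalar functions\<close>

definition curve_smooth_on ::
  "('k::topological_field \<Rightarrow> 'e::{ab_group_add, topological_space} \<Rightarrow> 'e) \<Rightarrow>
   ('k \<Rightarrow> 'f::{ab_group_add, topological_space} \<Rightarrow> 'f) \<Rightarrow> 'e set \<Rightarrow> ('e \<Rightarrow> 'f) \<Rightarrow> bool" where
  "curve_smooth_on s s' U f \<longleftrightarrow> (\<forall>c. smooth_curve_in s U c \<longrightarrow> C_infinity_on (*) s' UNIV (\<lambda>u. f (c u)))"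

lemma curve_smooth_onD:
  assumes "curve_smooth_on s s' U f" "C_infinity_on (*) s UNIV c" "\<And>u. c u \<in> U"
  shows "C_infinity_on (*) s' UNIV (\<lambda>u. f (c u))"
  using assms unfolding curve_smooth_on_def smooth_curve_in_def by blast

lemma curve_smooth_onI:
  assumes "\<And>c. C_infinity_on (*) s UNIV c \<Longrightarrow> (\<And>u. c u \<in> U) \<Longrightarrow> C_infinity_on (*) s' UNIV (\<lambda>u. f (c u))"
  shows "curve_smooth_on s s' U f"
  using assms unfolding curve_smooth_on_def smooth_curve_in_def by blast

lemma curve_smooth_on_compose_linear:
  fixes s :: "'k::local_field \<Rightarrow> 'b::{topological_ab_group_add,t2_space} \<Rightarrow> 'b"
    and r :: "'k \<Rightarrow> 'c::{topological_ab_group_add,t2_space} \<Rightarrow> 'c"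
  assumes s: "topological_vector_space s" and r: "topological_vector_space r"
    and A: "cont_linear r s A" and f: "curve_smooth_on s s' U f" and V: "\<And>x. x \<in> V \<Longrightarrow> A x \<in> U"
  shows "curve_smooth_on r s' V (\<lambda>x. f (A x))"
proof (rule curve_smooth_onI)
  fix c assume c: "C_infinity_on (*) r UNIV c" "\<And>u. c u \<in> V"
  show "C_infinity_on (*) s' UNIV (\<lambda>u. f (A (c u)))"
    by (rule curve_smooth_onD[OF f C_infinity_on_postcompose_linear[OF tvs_mult r s open_UNIV c(1) A] V[OF c(2)]])
qed

context valued_local_field
begin

text \<open>The ball is clopen. Thus a curve known only near a becomes a global one by a constant
  value elsewhere, chosen by the caller so as to stay in U.\<close>

lemma C_infinity_on_cutoff:
  fixes s :: "'k \<Rightarrow> 'e::{topological_ab_group_add,t2_space} \<Rightarrow> 'e"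
  assumes s: "topological_vector_space s" and c: "C_infinity_on (*) s {u. v (u - a) < r} c" and "0 < r"
  shows "C_infinity_on (*) s UNIV (\<lambda>u. if v (u - a) < r then c u else w)"
proof (rule C_infinity_on_local[OF tvs_mult s open_UNIV])
  fix u
  let ?g = "\<lambda>u. if v (u - a) < r then c u else w"
  have o: "open {u. v (u - a) < r}" "open {u. v (u - a) \<ge> r}"
    using open_ball open_outside_ball[OF \<open>0 < r\<close>] by auto
  show "\<exists>W. open W \<and> u \<in> W \<and> W \<subseteq> UNIV \<and> C_infinity_on (*) s W ?g"
  proof (cases "v (u - a) < r")
    case True
    have "C_infinity_on (*) s {u. v (u - a) < r} ?g"
      by (subst C_infinity_on_cong[OF tvs_mult s o(1), where g = c]) (use c in auto)
    then show ?thesis using o(1) True by (intro exI[of _ "{u. v (u - a) < r}"]) auto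
  next
    case False
    have "C_infinity_on (*) s {u. v (u - a) \<ge> r} ?g"
      by (subst C_infinity_on_cong[OF tvs_mult s o(2), where g = "\<lambda>_. w"])
        (auto intro: C_infinity_on_const[OF tvs_mult s o(2)])
    then show ?thesis using o(2) False by (intro exI[of _ "{u. v (u - a) \<ge> r}"]) auto
  qed
qed

text \<open>At a discontinuity x, arbitrarily small increments q lead to points of U with f (x + q)
  outside S. A smooth curve whose only values are 0 and such increments, with bad values at all
  \<open>p ^ n\<close> and value 0 at 0, contradicts continuity of f along it.\<close>

lemma curve_smooth_on_continuous:
  fixes s :: "'k \<Rightarrow> 'e::{topological_ab_group_add,t2_space} \<Rightarrow> 'e"
    and s' :: "'k \<Rightarrow> 'f::{topological_ab_group_add,t2_space} \<Rightarrow> 'f"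
  assumes s: "topological_vector_space s" and s': "topological_vector_space s'"
    and metr: "metrizable_space (euclidean :: 'e topology)"
    and f: "curve_smooth_on s s' U f"
  shows "continuous_on U f"
  unfolding continuous_on_def
proof
  fix x assume x: "x \<in> U"
  show "(f \<longlongrightarrow> f x) (at x within U)"
  proof (rule topological_tendstoI)
    fix S assume S: "open S" "f x \<in> S"
    have "\<exists>N. open N \<and> 0 \<in> N \<and> (\<forall>q\<in>N. \<not> (x + q \<in> U \<and> f (x + q) \<notin> S))"
    proof (rule ccontr)
      assume "\<not> ?thesis"
      then have "\<And>N. open N \<Longrightarrow> 0 \<in> N \<Longrightarrow> \<exists>q\<in>N. x + q \<in> U \<and> f (x + q) \<notin> S" by auto
      from ex_smooth_curve[OF s metr this] obtain c where c: "C_infinity_on (*) s UNIV c" "c 0 = 0"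
        "\<And>u. c u = 0 \<or> x + c u \<in> U \<and> f (x + c u) \<notin> S" "\<And>n. f (x + c (p ^ n)) \<notin> S" by auto
      have "C_infinity_on (*) s' UNIV (\<lambda>u. f (x + c u))"
      proof (rule curve_smooth_onD[OF f])
        show "C_infinity_on (*) s UNIV (\<lambda>u. x + c u)"
          by (intro C_infinity_on_add[OF tvs_mult s open_UNIV] C_infinity_on_const[OF tvs_mult s open_UNIV] c(1))
        show "x + c u \<in> U" for u using c(3)[of u] x by auto
      qed
      then have "continuous_on UNIV (\<lambda>u. f (x + c u))"
        by (rule C_infinity_on_continuous[OF tvs_mult s' open_UNIV])
      from continuous_on_tendsto_compose[OF this tendsto_p_power]
      have "(\<lambda>n. f (x + c (p ^ n))) \<longlonglongrightarrow> f x" by (simp add: c(2))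
      from topological_tendstoD[OF this S] have "\<exists>n. f (x + c (p ^ n)) \<in> S"
        by (meson eventually_happens sequentially_bot)
      then show False using c(4) by blast
    qed
    then obtain N where N: "open N" "0 \<in> N" "\<And>q. q \<in> N \<Longrightarrow> x + q \<in> U \<Longrightarrow> f (x + q) \<in> S" by auto
    have "open ((\<lambda>y. y - x) -` N)" by (rule open_vimage[OF N(1)]) (intro continuous_intros)
    then show "\<forall>\<^sub>F y in at x within U. f y \<in> S"
      unfolding eventually_at_topological
      using N(2) N(3)[of "_ - x"] by (intro exI[of _ "(\<lambda>y. y - x) -` N"]) auto
  qed
qed

end

locale boman_plane = valued_local_field v for v :: "'k::local_field \<Rightarrow> real" +
  assumes boman: "\<And>g :: 'k \<times> 'k \<Rightarrow> 'k. curve_smooth_on (pair_scale (*) (*)) (*) UNIV g \<Longrightarrow>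
    C_infinity_on (pair_scale (*) (*)) (*) UNIV g"
begin

definition dir_dq :: "('k \<Rightarrow> 'e \<Rightarrow> 'e) \<Rightarrow> ('e::plus \<Rightarrow> 'k) \<Rightarrow> 'e \<times> 'e \<times> 'k \<Rightarrow> 'k" where
  "dir_dq s f = (\<lambda>(x, y, t). let q = \<lambda>t. (1 / t) * (f (x + s t y) - f x) in if t \<noteq> 0 then q t else Lim (at 0) q)"

text \<open>
  Near a parameter where the third component vanishes, the composition of a smooth curve \<open>(a, b, t)\<close>
  with the difference quotient of \<open>f\<close> is obtained from the difference quotient of the function
  \<open>(u, t) \<mapsto> f (a u + t b u)\<close> on the plane, cut off outside of a ball.
\<close>

lemma curve_smooth_on_dir_dq:
  fixes s :: "'k \<Rightarrow> 'e::{topological_ab_group_add,t2_space} \<Rightarrow> 'e"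
  assumes s: "topological_vector_space s" and U: "open U" and f: "curve_smooth_on s (*) U f"
  shows "curve_smooth_on (dq_scale s) (*) (dq_domain s U) (dir_dq s f)"
proof (rule curve_smooth_onI)
  fix c assume c: "C_infinity_on (*) (dq_scale s) UNIV c" and cU: "\<And>u. c u \<in> dq_domain s U"
  define a where "a u = fst (c u)" for u
  define b where "b u = fst (snd (c u))" for u
  define \<tau> where "\<tau> u = snd (snd (c u))" for u
  have c_eq: "c u = (a u, b u, \<tau> u)" for u by (simp add: a_def b_def \<tau>_def)
  note m = tvs_mult[where 'k='k]
  note mm = tvs_pair[OF m m]
  note tv = tvs_pair[OF s tvs_pair[OF s m]]
  have a: "C_infinity_on (*) s UNIV a"
    unfolding a_def by (rule C_infinity_on_postcompose_linear[OF m tv s open_UNIV c cont_linear_fst])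
  have b: "C_infinity_on (*) s UNIV b"
    unfolding b_def by (rule C_infinity_on_postcompose_linear[OF m tv s open_UNIV c
          cont_linear_comp[OF cont_linear_snd cont_linear_fst]])
  have \<tau>: "C_infinity_on (*) (*) UNIV \<tau>"
    unfolding \<tau>_def by (rule C_infinity_on_postcompose_linear[OF m tv m open_UNIV c
          cont_linear_comp[OF cont_linear_snd cont_linear_snd]])
  have aU: "a u \<in> U" "a u + s (\<tau> u) (b u) \<in> U" for u
    using cU[of u] by (auto simp: c_eq dq_domain_def)
  note cont = C_infinity_on_continuous[OF m _ open_UNIV]
  have "\<exists>W. open W \<and> u0 \<in> W \<and> W \<subseteq> UNIV \<and> C_infinity_on (*) (*) W (\<lambda>u. dir_dq s f (c u))" for u0
  proof (cases "\<tau> u0 = 0")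
    case False
    define W where "W = \<tau> -` (- {0})"
    have W: "open W" unfolding W_def by (rule open_vimage[OF _ cont[OF m \<tau>]]) auto
    have "C_infinity_on (*) (*) UNIV (\<lambda>u. f (a u + s (\<tau> u) (b u)) - f (a u))"
      by (intro C_infinity_on_diff[OF m m open_UNIV] curve_smooth_onD[OF f]
          C_infinity_on_add[OF m s open_UNIV] C_infinity_on_scale[OF m s open_UNIV] a b \<tau> aU)
    then have "C_infinity_on (*) (*) W (\<lambda>u. (1 / \<tau> u) * (f (a u + s (\<tau> u) (b u)) - f (a u)))"
      by (intro C_infinity_on_divide[OF m m W] C_infinity_on_subset[OF m m open_UNIV _ W] \<tau>)
        (auto simp: W_def)
    then have "C_infinity_on (*) (*) W (\<lambda>u. dir_dq s f (c u))"
      by (subst C_infinity_on_cong[OF m m W, where g = "\<lambda>u. (1 / \<tau> u) * (f (a u + s (\<tau> u) (b u)) - f (a u))"])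
        (auto simp: W_def c_eq dir_dq_def)
    then show ?thesis using W False by (intro exI[of _ W]) (auto simp: W_def)
  next
    case True
    have "continuous_on UNIV (\<lambda>q. a (fst q) + s (snd q) (b (fst q)))"
      by (intro continuous_on_add tvs_continuous_on[OF s] continuous_on_compose2[OF cont[OF s a]]
          continuous_on_compose2[OF cont[OF s b]] continuous_intros) auto
    then have "open ((\<lambda>q. a (fst q) + s (snd q) (b (fst q))) -` U)" by (rule open_vimage[OF U])
    moreover have "(u0, 0) \<in> (\<lambda>q. a (fst q) + s (snd q) (b (fst q))) -` U"
      using aU(1) by (simp add: tvs_algebra[OF s])
    ultimately obtain A B where "open A" "open B" "(u0, 0) \<in> A \<times> B"
      and AB: "A \<times> B \<subseteq> (\<lambda>q. a (fst q) + s (snd q) (b (fst q))) -` U"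
      by (rule open_prod_elim)
    then have AB': "open A" "open B" "u0 \<in> A" "0 \<in> B" by simp_all
    obtain e1 where e1: "e1 > 0" "\<forall>u. v (u - u0) < e1 \<longrightarrow> u \<in> A" using AB'(1,3) unfolding open_iff by auto
    obtain e2 where e2: "e2 > 0" "\<forall>t. v (t - 0) < e2 \<longrightarrow> t \<in> B" using AB'(2,4) unfolding open_iff by blast
    define e where "e = min e1 e2"
    have e: "e > 0" using e1 e2 by (simp add: e_def)
    have inU: "a u + s t (b u) \<in> U" if "v (u - u0) < e" "v t < e" for u t
      using subsetD[OF AB, of "(u, t)"] e1(2) e2(2) that by (simp add: e_def)
    \<comment> \<open>Boman's theorem on the plane concerns functions on all of it. The polydisc is
      clopen, so extension by zero does not spoil smoothness along curves.\<close>
    define H where "H q = (if v (fst q - u0) < e \<and> v (snd q) < e then f (a (fst q) + s (snd q) (b (fst q))) else 0)"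
      for q
    have "curve_smooth_on (pair_scale (*) (*)) (*) UNIV H"
    proof (rule curve_smooth_onI)
      fix g :: "'k \<Rightarrow> 'k \<times> 'k" assume g: "C_infinity_on (*) (pair_scale (*) (*)) UNIV g"
      define \<alpha> where "\<alpha> r = fst (g r)" for r
      define \<beta> where "\<beta> r = snd (g r)" for r
      have \<alpha>: "C_infinity_on (*) (*) UNIV \<alpha>" and \<beta>: "C_infinity_on (*) (*) UNIV \<beta>"
        unfolding \<alpha>_def \<beta>_def
        using C_infinity_on_postcompose_linear[OF m mm m open_UNIV g cont_linear_fst]
          C_infinity_on_postcompose_linear[OF m mm m open_UNIV g cont_linear_snd] by auto
      define D where "D = {r. v (\<alpha> r - u0) < e \<and> v (\<beta> r) < e}"
      have "D = \<alpha> -` {x. v (x - u0) < e} \<inter> \<beta> -` {x. v (x - 0) < e}" by (auto simp: D_def)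
      then have D: "open D"
        by (simp only:) (intro open_Int open_vimage open_ball cont[OF m] \<alpha> \<beta>)
      have "- D = \<alpha> -` {x. v (x - u0) \<ge> e} \<union> \<beta> -` {x. v (x - 0) \<ge> e}" by (auto simp: D_def)
      then have D': "open (- D)"
        by (simp only:) (intro open_Un open_vimage open_outside_ball e cont[OF m] \<alpha> \<beta>)
      show "C_infinity_on (*) (*) UNIV (\<lambda>r. H (g r))"
      proof (rule C_infinity_on_local[OF m m open_UNIV])
        fix r0
        show "\<exists>W. open W \<and> r0 \<in> W \<and> W \<subseteq> UNIV \<and> C_infinity_on (*) (*) W (\<lambda>r. H (g r))"
        proof (cases "r0 \<in> D")
          case False
          have "C_infinity_on (*) (*) (- D) (\<lambda>r. H (g r))"
            using C_infinity_on_const[OF m m D', of 0]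
            by (subst C_infinity_on_cong[OF m m D', where g = "\<lambda>_. 0"]) (auto simp: D_def H_def \<alpha>_def \<beta>_def)
          then show ?thesis using D' False by (intro exI[of _ "- D"]) auto
        next
          case True
          then obtain \<delta> where \<delta>: "\<delta> > 0" "\<forall>r. v (r - r0) < \<delta> \<longrightarrow> r \<in> D" using D unfolding open_iff by blast
          \<comment> \<open>Near r0 the curve runs through the region where the point is known to
            lie in U; elsewhere it rests at the point \<open>a u0\<close> of U.\<close>
          let ?d = "\<lambda>r. if v (r - r0) < \<delta> then a (\<alpha> r) + s (\<beta> r) (b (\<alpha> r)) else a u0"
          note o = open_ball[of r0 \<delta>]
          have *: "C_infinity_on (*) s UNIV (\<lambda>r. a (\<alpha> r))" "C_infinity_on (*) s UNIV (\<lambda>r. b (\<alpha> r))"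
            by (rule C_infinity_on_compose[OF m s open_UNIV m open_UNIV \<alpha> UNIV_I], rule a b)+
          have "C_infinity_on (*) s UNIV (\<lambda>r. a (\<alpha> r) + s (\<beta> r) (b (\<alpha> r)))"
            by (intro C_infinity_on_add[OF m s open_UNIV] C_infinity_on_scale[OF m s open_UNIV] * \<beta>)
          then have "C_infinity_on (*) s UNIV ?d"
            by (intro C_infinity_on_cutoff[OF s _ \<delta>(1)] C_infinity_on_subset[OF m s open_UNIV _ o]) auto
          then have "C_infinity_on (*) (*) UNIV (\<lambda>r. f (?d r))"
            by (rule curve_smooth_onD[OF f]) (use \<delta>(2) inU aU(1) in \<open>auto simp: D_def\<close>)
          from C_infinity_on_subset[OF m m open_UNIV this o]
          have "C_infinity_on (*) (*) {r. v (r - r0) < \<delta>} (\<lambda>r. H (g r))"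
            by (subst C_infinity_on_cong[OF m m o, where g = "\<lambda>r. f (?d r)"])
              (use \<delta>(2) in \<open>auto simp: D_def H_def \<alpha>_def \<beta>_def\<close>)
          then show ?thesis using o \<delta>(1) by (intro exI[of _ "{r. v (r - r0) < \<delta>}"]) auto
        qed
      qed
    qed
    then have "C_infinity_on (pair_scale (*) (*)) (*) UNIV H" by (rule boman)
    then obtain h where h: "C_infinity_on (dq_scale (pair_scale (*) (*))) (*) (dq_domain (pair_scale (*) (*)) UNIV) h"
      "\<And>x y t. t \<noteq> 0 \<Longrightarrow> h (x, y, t) = (1 / t) * (H (x + pair_scale (*) (*) t y) - H x)"
      using C_infinity_on_difference_quotient[OF mm m open_UNIV] by (auto simp: dq_domain_def)
    note m5 = tvs_pair[OF mm tvs_pair[OF mm m]]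
    have dU: "dq_domain (pair_scale (*) (*)) UNIV = (UNIV :: (('k \<times> 'k) \<times> ('k \<times> 'k) \<times> 'k) set)"
      by (auto simp: dq_domain_def)
    define W where "W = {u. v (u - u0) < e} \<inter> \<tau> -` {t. v (t - 0) < e}"
    have W: "open W" "u0 \<in> W"
      unfolding W_def using e True by (intro open_Int open_ball open_vimage[OF open_ball cont[OF m \<tau>]], simp)
    \<comment> \<open>Base point (u, 0), direction (0, 1), increment t: this plane quotient of H is
      the quotient of f in direction \<open>b u\<close> at \<open>a u\<close>.\<close>
    have dq: "h ((u, 0), (0, 1), t) = (1 / t) * (f (a u + s t (b u)) - f (a u))"
      if "v (u - u0) < e" "v t < e" "t \<noteq> 0" for u t
      using that e by (simp add: h(2) H_def pair_scale_def tvs_algebra[OF s])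
    have hc: "continuous_on UNIV h"
      using C_infinity_on_continuous[OF m5 m _ h(1)] dU by simp
    have eq: "dir_dq s f (c u) = h ((u, 0), (0, 1), \<tau> u)" if u: "u \<in> W" for u
    proof (cases "\<tau> u = 0")
      case False
      then show ?thesis using u dq[of u "\<tau> u"] by (simp add: W_def c_eq dir_dq_def)
    next
      \<comment> \<open>Continuity of h shows that the limit in \<open>dir_dq\<close> exists here
        and identifies it.\<close>
      case True
      have "((\<lambda>t. h ((u, 0), (0, 1), t)) \<longlongrightarrow> h ((u, 0), (0, 1), 0)) (at 0)"
        by (rule continuous_on_tendsto_compose[OF hc]) (auto intro!: tendsto_intros)
      moreover have "\<forall>\<^sub>F t in nhds 0. v t < e" unfolding nhds_0_iff using e by blast
      then have "\<forall>\<^sub>F t in at 0. h ((u, 0), (0, 1), t) = (1 / t) * (f (a u + s t (b u)) - f (a u))"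
        unfolding eventually_at_filter by (rule eventually_mono) (use u dq in \<open>auto simp: W_def\<close>)
      ultimately have "((\<lambda>t. (1 / t) * (f (a u + s t (b u)) - f (a u))) \<longlongrightarrow> h ((u, 0), (0, 1), 0)) (at 0)"
        using tendsto_cong by fast
      from tendsto_Lim[OF at_0_neq_bot this] show ?thesis using True by (simp add: c_eq dir_dq_def)
    qed
    have "C_infinity_on (*) (dq_scale (pair_scale (*) (*))) W (\<lambda>u. ((u, 0), (0, 1), \<tau> u))"
      by (intro C_infinity_on_Pair[OF m _ _ W(1)] mm m tvs_pair C_infinity_on_const[OF m _ W(1)]
          C_infinity_on_subset[OF m m open_UNIV \<tau> W(1)] C_infinity_on_linear[OF m m W(1)] cont_linearI)
        auto
    from C_infinity_on_compose[OF m m W(1) m5 _ this _ h(1)]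
    have "C_infinity_on (*) (*) W (\<lambda>u. h ((u, 0), (0, 1), \<tau> u))" by (simp add: dU)
    then have "C_infinity_on (*) (*) W (\<lambda>u. dir_dq s f (c u))"
      by (subst C_infinity_on_cong[OF m m W(1) eq])
    then show ?thesis using W by blast
  qed
  then show "C_infinity_on (*) (*) UNIV (\<lambda>u. dir_dq s f (c u))"
    by (intro C_infinity_on_local[OF m m open_UNIV]) blast
qed

text \<open>Smoothness along curves is itself the coinductive invariant: it gives continuity, and by
  Boman's theorem on the plane it passes to the extended difference quotient.\<close>

theorem scalar_boman:
  fixes s :: "'k \<Rightarrow> 'e::{topological_ab_group_add,t2_space} \<Rightarrow> 'e"
  assumes s: "topological_vector_space s" and metr: "metrizable_space (euclidean :: 'e topology)"
    and U: "open U" and f: "curve_smooth_on s (*) U f"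
  shows "usmooth s (*) (uret -` U) (\<lambda>z. f (uret z))"
proof (rule usmooth_coinduct[OF s, where R = "\<lambda>V f. open V \<and> curve_smooth_on (uscale s) (*) V f"])
  show "open (uret -` U :: (nat \<Rightarrow> 'e \<times> 'k) set) \<and> curve_smooth_on (uscale s) (*) (uret -` U) (\<lambda>z. f (uret z))"
    by (intro conjI open_uret_vimage U curve_smooth_on_compose_linear[OF s tvs_uscale[OF s] cont_linear_uret f]) simp
next
  fix V :: "(nat \<Rightarrow> 'e \<times> 'k) set" and f assume "open V \<and> curve_smooth_on (uscale s) (*) V f"
  then have V: "open V" and f: "curve_smooth_on (uscale s) (*) V f" by auto
  note us = tvs_uscale[OF s]
  \<comment> \<open>The linear projection of X onto triples; precomposition turns the quotient on
    triples into a function on X.\<close>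
  let ?A = "\<lambda>z :: nat \<Rightarrow> 'e \<times> 'k. (ubase z, udir z, upar z)"
  have A: "cont_linear (uscale s) (dq_scale (uscale s)) ?A"
  proof (rule cont_linearI)
    show "continuous_on UNIV ?A"
      by (intro continuous_on_Pair cont_linearD(3)[OF cont_linear_ubase] cont_linearD(3)[OF cont_linear_udir]
          cont_linearD(3)[OF cont_linear_upar])
  qed (simp_all add: pair_scale_def cont_linearD[OF cont_linear_ubase] cont_linearD[OF cont_linear_udir]
      cont_linearD[OF cont_linear_upar])
  have "curve_smooth_on (uscale s) (*) (uext s V) (\<lambda>z. dir_dq (uscale s) f (?A z))"
    by (rule curve_smooth_on_compose_linear[OF tvs_pair[OF us tvs_pair[OF us tvs_mult]] us A
          curve_smooth_on_dir_dq[OF us V f]])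
      (simp add: dq_domain_def uext_def ustep_def)
  moreover have "dir_dq (uscale s) f (?A z) = (1 / upar z) * (f (ustep s z) - f (ubase z))" if "upar z \<noteq> 0" for z
    using that by (simp add: dir_dq_def ustep_def)
  moreover have "continuous_on V f"
    by (rule curve_smooth_on_continuous[OF us tvs_mult metrizable_universal_space[OF metr] f])
  ultimately show "open V \<and> continuous_on V f \<and> (\<exists>g. (open (uext s V) \<and> curve_smooth_on (uscale s) (*) (uext s V) g) \<and>
      (\<forall>z\<in>uext s V. upar z \<noteq> 0 \<longrightarrow> g z = (1 / upar z) * (f (ustep s z) - f (ubase z))))"
    using V open_uext[OF s V] by (intro conjI exI[of _ "\<lambda>z. dir_dq (uscale s) f (?A z)"]) simp_all
qed

end

section \<open>Continuous linear functionals\<close>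

context valued_local_field
begin

lemma v_divide: "v (x / y) = v x / v y"
  using v_mult[of x "1 / y"] by (simp add: v_inverse)

lemma tvs_absorbing:
  fixes s :: "'k \<Rightarrow> 'f::{topological_ab_group_add,t2_space} \<Rightarrow> 'f"
  assumes s: "topological_vector_space s" and S: "open S" "0 \<in> S"
  shows "\<exists>a. a \<noteq> 0 \<and> s a x \<in> S"
proof -
  have "((\<lambda>n. s (p ^ n) x) \<longlongrightarrow> s 0 x) sequentially"
    by (intro tvs_tendsto[OF s] tendsto_p_power tendsto_const)
  then have "(\<lambda>n. s (p ^ n) x) \<longlonglongrightarrow> 0" by (simp add: tvs_algebra[OF s])
  from topological_tendstoD[OF this S] obtain n where "s (p ^ n) x \<in> S"
    by (meson eventually_happens sequentially_bot)
  then show ?thesis by (intro exI[of _ "p ^ n"]) simp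
qed

lemma cont_linear_bounded:
  fixes s :: "'k \<Rightarrow> 'f::{topological_ab_group_add,t2_space} \<Rightarrow> 'f"
  assumes s: "topological_vector_space s" and M: "open M" "0 \<in> M"
    and add: "\<And>x y. l (x + y) = l x + l y" and scale: "\<And>a x. l (s a x) = a * l x"
    and bound: "\<And>x. x \<in> M \<Longrightarrow> v (l x) \<le> 1"
  shows "cont_linear s (*) l"
proof (rule cont_linearI)
  have diff: "l (x - y) = l x - l y" for x y using add[of "x - y" y] by simp
  show "continuous_on UNIV l"
    unfolding continuous_on_def
  proof
    fix x :: 'f
    show "(l \<longlongrightarrow> l x) (at x within UNIV)"
      unfolding tendsto_v_iff
    proof (intro allI impI)
      fix e :: real assume "e > 0"
      then obtain a where a: "a \<noteq> 0" "v a < e" using ex_small by blast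
      let ?N = "(\<lambda>y. s (1 / a) (y - x)) -` M"
      have "open ?N"
        by (rule open_vimage[OF M(1)]) (intro tvs_continuous_on[OF s] continuous_intros)
      moreover have "x \<in> ?N" using M by (simp add: tvs_algebra[OF s])
      moreover have "v (l y - l x) < e" if "y \<in> ?N" for y
      proof -
        have "v (1 / a * (l y - l x)) \<le> 1" using that bound[of "s (1 / a) (y - x)"] by (simp add: scale diff)
        then have "v (l y - l x) \<le> v a" using a(1) by (simp add: v_divide field_simps)
        then show ?thesis using a(2) by simp
      qed
      ultimately show "\<forall>\<^sub>F y in at x. v (l y - l x) < e"
        unfolding eventually_at_topological by (intro exI[of _ ?N]) simp
    qed
  qed
qed (simp_all add: add scale)

lemma submodule_simps:
  assumes "valuation_submodule v s M"
  shows "0 \<in> M" "x \<in> M \<Longrightarrow> y \<in> M \<Longrightarrow> x + y \<in> M" "v a \<le> 1 \<Longrightarrow> x \<in> M \<Longrightarrow> s a x \<in> M"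
  using assms by (auto simp: valuation_submodule_def valuation_ring_def)

definition polar :: "('k \<Rightarrow> 'f::{plus,topological_space} \<Rightarrow> 'f) \<Rightarrow> 'f set \<Rightarrow> ('f \<Rightarrow> 'k) set" where
  "polar s M = {l. cont_linear s (*) l \<and> (\<forall>x\<in>M. v (l x) \<le> 1)}"

text \<open>
  The members are graphs of partial linear functionals: they are single-valued by the last condition,
  as \<open>0 \<in> M\<close> and the values at \<open>0\<close> form a subspace of the field.
\<close>

definition hb_graphs :: "('k \<Rightarrow> 'f::ab_group_add \<Rightarrow> 'f) \<Rightarrow> 'f set \<Rightarrow> 'f \<Rightarrow> ('f \<times> 'k) set set" where
  "hb_graphs s M x = {G. (x, 1) \<in> G \<and> (\<forall>g\<in>G. \<forall>h\<in>G. g + h \<in> G) \<and>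
     (\<forall>a. \<forall>g\<in>G. pair_scale s (*) a g \<in> G) \<and> (\<forall>g\<in>G. fst g \<in> M \<longrightarrow> v (snd g) \<le> 1)}"

text \<open>A value c at y is admissible if it lies in a family of balls, one for each way in which
  a multiple of some point plus y falls into M. Spherical completeness supplies a common
  point.\<close>

lemma hb_extend:
  fixes s :: "'k \<Rightarrow> 'f::{topological_ab_group_add,t2_space} \<Rightarrow> 'f"
  assumes s: "topological_vector_space s" and M: "valuation_submodule v s M"
    and G: "G \<in> hb_graphs s M x"
  shows "\<exists>G'\<in>hb_graphs s M x. G \<subseteq> G' \<and> (\<exists>c. (y, c) \<in> G')"
proof -
  note M' = submodule_simps[OF M]
  note ps = tvs_pair[OF s tvs_mult]
  have G': "(x, 1) \<in> G" "\<And>g h. g \<in> G \<Longrightarrow> h \<in> G \<Longrightarrow> g + h \<in> G"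
    "\<And>a g. g \<in> G \<Longrightarrow> pair_scale s (*) a g \<in> G" "\<And>g. g \<in> G \<Longrightarrow> fst g \<in> M \<Longrightarrow> v (snd g) \<le> 1"
    using G unfolding hb_graphs_def by blast+
  \<comment> \<open>If \<open>s a (fst g + y)\<close> is in M, then |a (snd g + c)| <= 1 is
    required: c must lie in the ball around \<open>- snd g\<close> of radius 1 / |a|.\<close>
  define I where "I = {(g, a). g \<in> G \<and> a \<noteq> 0 \<and> s a (fst g + y) \<in> M}"
  \<comment> \<open>Since |a / b| <= 1, both a(g + y) and a(h + y) belong to M; their difference a(g
    - h) lies in M and in the domain of the graph, where the values are bounded by 1.\<close>
  have key: "v (snd g - snd h) \<le> 1 / v a"
    if "(g, a) \<in> I" "(h, b) \<in> I" "v a \<le> v b" for g h a b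
  proof -
    have I: "g \<in> G" "h \<in> G" "a \<noteq> 0" "b \<noteq> 0" "s a (fst g + y) \<in> M" "s b (fst h + y) \<in> M"
      using that(1,2) by (auto simp: I_def)
    have "v (a * (1 / b)) \<le> 1" using that(3) I(4) by (simp add: v_divide field_simps)
    from M'(3)[OF this I(6)] have "s a (fst h + y) \<in> M" using I(4) by (simp add: tvs_algebra(3)[OF s])
    then have "s (- 1) (s a (fst h + y)) \<in> M" by (rule M'(3)[rotated]) simp
    from M'(2)[OF I(5) this] have "s a (fst g - fst h) \<in> M"
      by (simp add: tvs_algebra[OF s])
    moreover have "pair_scale s (*) a (g + pair_scale s (*) (- 1) h) \<in> G"
      by (intro G'(2,3) I)
    ultimately have "v (a * (snd g - snd h)) \<le> 1"
      using G'(4)[of "pair_scale s (*) a (g + pair_scale s (*) (- 1) h)"]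
      by (simp add: pair_scale_def tvs_algebra[OF s])
    then have "v a * v (snd g - snd h) \<le> 1" by (simp only: v_mult)
    then show ?thesis using I(3) by (simp add: pos_le_divide_eq mult.commute)
  qed
  have "v ((\<lambda>(g, a). - snd g) i - (\<lambda>(g, a). - snd g) j) \<le> max ((\<lambda>(g, a). 1 / v a) i) ((\<lambda>(g, a). 1 / v a) j)"
    if "i \<in> I" "j \<in> I" for i j
  proof -
    obtain g a h b where ij: "i = (g, a)" "j = (h, b)" by (cases i, cases j)
    show ?thesis
    proof (cases "v a \<le> v b")
      case True
      then show ?thesis using key[of g a h b] that v_diff_commute[of "snd h" "snd g"]
        by (simp add: ij le_max_iff_disj)
    next
      case False
      then show ?thesis using key[of h b g a] that by (simp add: ij le_max_iff_disj)
    qed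
  qed
  from spherical_completeness[OF this] obtain c
    where c: "\<forall>i\<in>I. v (c - (\<lambda>(g, a). - snd g) i) \<le> (\<lambda>(g, a). 1 / v a) i" by (rule exE)
  have c': "v (c + snd g) \<le> 1 / v a" if "g \<in> G" "a \<noteq> 0" "s a (fst g + y) \<in> M" for g a
    using c[rule_format, of "(g, a)"] that by (simp add: I_def)
  define H where "H = {g + pair_scale s (*) a (y, c) | g a. g \<in> G}"
  have "G \<subseteq> H"
  proof
    fix g assume "g \<in> G"
    then have "g + pair_scale s (*) 0 (y, c) \<in> H" unfolding H_def by blast
    then show "g \<in> H" by (simp add: tvs_algebra[OF ps])
  qed
  moreover have "(y, c) \<in> H"
  proof -
    have "pair_scale s (*) 0 (x, 1) \<in> G" using G' by blast
    then have "pair_scale s (*) 0 (x, 1) + pair_scale s (*) 1 (y, c) \<in> H" unfolding H_def by blast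
    then show ?thesis by (simp add: tvs_algebra[OF ps])
  qed
  moreover have "H \<in> hb_graphs s M x"
  proof -
    have "g + h \<in> H" if "g \<in> H" "h \<in> H" for g h
    proof -
      obtain g1 a h1 b where "g = g1 + pair_scale s (*) a (y, c)" "h = h1 + pair_scale s (*) b (y, c)"
        and "g1 \<in> G" "h1 \<in> G" using \<open>g \<in> H\<close> \<open>h \<in> H\<close> unfolding H_def by blast
      then have "g + h = (g1 + h1) + pair_scale s (*) (a + b) (y, c)" "g1 + h1 \<in> G"
        using G'(2) by (simp_all only: tvs_algebra(2)[OF ps] add_ac)
      then show ?thesis unfolding H_def by blast
    qed
    moreover have "pair_scale s (*) b g \<in> H" if "g \<in> H" for b g
    proof -
      obtain g1 a where "g = g1 + pair_scale s (*) a (y, c)" "g1 \<in> G"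
        using \<open>g \<in> H\<close> unfolding H_def by blast
      then have "pair_scale s (*) b g = pair_scale s (*) b g1 + pair_scale s (*) (b * a) (y, c)"
        "pair_scale s (*) b g1 \<in> G"
        using G'(3) by (simp_all only: tvs_algebra(1,3)[OF ps])
      then show ?thesis unfolding H_def by blast
    qed
    moreover have "v (snd g) \<le> 1" if g: "g \<in> H" "fst g \<in> M" for g
    proof -
      obtain g1 a where g1: "g = g1 + pair_scale s (*) a (y, c)" "g1 \<in> G"
        using \<open>g \<in> H\<close> unfolding H_def by blast
      show ?thesis
      proof (cases "a = 0")
        case True
        then show ?thesis using g1 g G'(4)[of g1] by (simp add: tvs_algebra[OF ps])
      next
        case False
        have "s a (fst (pair_scale s (*) (1 / a) g1) + y) \<in> M"
          using g(2) g1(1) False by (simp add: pair_scale_def tvs_algebra[OF s])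
        from c'[OF G'(3)[OF g1(2)] False this] have "v (c + snd g1 / a) \<le> 1 / v a" by (simp add: pair_scale_def)
        then have "v a * v (c + snd g1 / a) \<le> v a * (1 / v a)" by (intro mult_left_mono) auto
        then have "v (a * (c + snd g1 / a)) \<le> 1" using False by (simp only: v_mult) simp
        moreover have "a * (c + snd g1 / a) = snd g"
          using g1(1) False by (simp add: pair_scale_def distrib_left add.commute)
        ultimately show ?thesis by simp
      qed
    qed
    ultimately show ?thesis using \<open>G \<subseteq> H\<close> G'(1) unfolding hb_graphs_def by blast
  qed
  ultimately show ?thesis by blast
qed

text \<open>On the line through x, a x is sent to a. If a x were in M with |a| > 1, dividing by a
  would put x into M, so the bound by 1 on M holds on the line. A maximal graph with this bound is
  total by \<open>hb_extend\<close>.\<close>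

lemma hahn_banach:
  fixes s :: "'k \<Rightarrow> 'f::{topological_ab_group_add,t2_space} \<Rightarrow> 'f"
  assumes s: "topological_vector_space s" and oM: "open M" and M: "valuation_submodule v s M"
    and x: "x \<notin> M"
  shows "\<exists>l\<in>polar s M. l x = 1"
proof -
  note M' = submodule_simps[OF M]
  note ps = tvs_pair[OF s tvs_mult]
  have G0: "{pair_scale s (*) a (x, 1) | a. True} \<in> hb_graphs s M x"
  proof -
    let ?G = "{pair_scale s (*) a (x, 1) | a. True}"
    have "pair_scale s (*) 1 (x, 1) = (x, 1)" by (simp add: tvs_algebra[OF ps])
    then have "(x, 1) \<in> ?G" by (metis (mono_tags, lifting) mem_Collect_eq)
    moreover have "g + h \<in> ?G" if "g \<in> ?G" "h \<in> ?G" for g h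
      using that by (auto simp flip: tvs_algebra(2)[OF ps])
    moreover have "pair_scale s (*) b g \<in> ?G" if "g \<in> ?G" for b g
      using that by (auto simp: tvs_algebra(3)[OF ps])
    moreover have "v (snd g) \<le> 1" if "g \<in> ?G" "fst g \<in> M" for g
    proof (rule ccontr)
      obtain a where a: "g = pair_scale s (*) a (x, 1)" using \<open>g \<in> ?G\<close> by auto
      assume "\<not> v (snd g) \<le> 1"
      then have "v a > 1" using a by (simp add: pair_scale_def)
      then have "a \<noteq> 0" "v (1 / a) \<le> 1" by (auto simp: v_inverse divide_le_eq_1)
      then have "s (1 / a) (s a x) \<in> M" using that(2) a by (intro M'(3)[of "1 / a" "s a x"]) (auto simp: pair_scale_def)
      then show False using x \<open>a \<noteq> 0\<close> by (simp add: tvs_algebra[OF s])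
    qed
    ultimately show ?thesis unfolding hb_graphs_def by blast
  qed
  have "\<exists>G\<in>hb_graphs s M x. \<forall>H\<in>hb_graphs s M x. G \<subseteq> H \<longrightarrow> H = G"
  proof (rule subset_Zorn_nonempty)
    show "hb_graphs s M x \<noteq> {}" using G0 by blast
    fix C assume C: "C \<noteq> {}" "subset.chain (hb_graphs s M x) C"
    have CD: "C \<subseteq> hb_graphs s M x" "\<And>G H. G \<in> C \<Longrightarrow> H \<in> C \<Longrightarrow> G \<subseteq> H \<or> H \<subseteq> G"
      using C(2) unfolding subset.chain_def by auto
    have "g + h \<in> \<Union>C" if gh: "g \<in> \<Union>C" "h \<in> \<Union>C" for g h
    proof -
      obtain G H where GH: "G \<in> C" "g \<in> G" "H \<in> C" "h \<in> H" using gh by blast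
      define K where "K = (if G \<subseteq> H then H else G)"
      have "K \<in> C" "g \<in> K" "h \<in> K" using GH CD(2)[OF GH(1,3)] by (auto simp: K_def)
      then have "g + h \<in> K" using CD(1) unfolding hb_graphs_def by blast
      then show ?thesis using \<open>K \<in> C\<close> by blast
    qed
    then show "\<Union>C \<in> hb_graphs s M x"
      using C(1) CD(1) unfolding hb_graphs_def by blast
  qed
  then obtain G where G: "G \<in> hb_graphs s M x" "\<And>H. H \<in> hb_graphs s M x \<Longrightarrow> G \<subseteq> H \<Longrightarrow> H = G" by blast
  have G': "(x, 1) \<in> G" "\<And>g h. g \<in> G \<Longrightarrow> h \<in> G \<Longrightarrow> g + h \<in> G"
    "\<And>a g. g \<in> G \<Longrightarrow> pair_scale s (*) a g \<in> G" "\<And>g. g \<in> G \<Longrightarrow> fst g \<in> M \<Longrightarrow> v (snd g) \<le> 1"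
    using G(1) unfolding hb_graphs_def by blast+
  have total: "\<exists>c. (y, c) \<in> G" for y
    using hb_extend[OF s M G(1), of y] G(2) by metis
  \<comment> \<open>Otherwise all (0, a (c - d)) belong to G; since 0 is in M, these unbounded
    values would have to be bounded by 1.\<close>
  have unique: "c = d" if "(y, c) \<in> G" "(y, d) \<in> G" for y c d
  proof (rule ccontr)
    assume "c \<noteq> d"
    obtain a where a: "v a > 1 / v (c - d)" using ex_large by blast
    have "pair_scale s (*) a ((y, c) + pair_scale s (*) (- 1) (y, d)) \<in> G"
      using that by (intro G'(2,3))
    then have "v (a * (c - d)) \<le> 1"
      using G'(4)[of "(0, a * (c - d))"] M'(1) by (simp add: pair_scale_def tvs_algebra[OF s])
    then have "v a * v (c - d) \<le> 1" by (simp only: v_mult)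
    moreover have "v a * v (c - d) > 1" using a \<open>c \<noteq> d\<close> by (simp add: pos_divide_less_eq)
    ultimately show False by simp
  qed
  define l where "l y = (THE c. (y, c) \<in> G)" for y
  have l: "(y, l y) \<in> G" for y
    unfolding l_def by (rule theI') (use total unique in blast)
  have l_eq: "l y = c" if "(y, c) \<in> G" for y c using unique[OF l that] .
  have "cont_linear s (*) l"
  proof (rule cont_linear_bounded[OF s oM M'(1)])
    show "l (y + z) = l y + l z" for y z
      using G'(2)[OF l[of y] l[of z]] by (intro l_eq) simp
    show "l (s a y) = a * l y" for a y
      using G'(3)[OF l[of y], of a] by (intro l_eq) (simp add: pair_scale_def)
    show "v (l y) \<le> 1" if "y \<in> M" for y using G'(4)[OF l[of y]] that by simp
  qed
  then have "l \<in> polar s M" using G'(4)[OF l] by (simp add: polar_def)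
  then show ?thesis using l_eq[OF G'(1)] by blast
qed

lemma tendsto_imp_v_bounded:
  assumes "X \<longlonglongrightarrow> a"
  shows "\<exists>r. \<forall>n::nat. v (X n) \<le> r"
proof -
  have "\<forall>\<^sub>F n in sequentially. v (X n - a) < 1" using assms unfolding tendsto_v_iff by simp
  then obtain N where N: "\<And>n. n \<ge> N \<Longrightarrow> v (X n - a) < 1" unfolding eventually_sequentially by blast
  let ?r = "Max (insert (max 1 (v a)) ((\<lambda>n. v (X n)) ` {..<N}))"
  have "v (X n) \<le> ?r" for n
  proof (cases "n < N")
    case True
    then show ?thesis by (intro Max_ge) auto
  next
    case False
    then have "v (X n) \<le> max 1 (v a)" using N[of n] v_add[of "X n - a" a] by simp
    also have "\<dots> \<le> ?r" by (intro Max_ge) auto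
    finally show ?thesis .
  qed
  then show ?thesis by blast
qed

text \<open>
  If the values of the functionals in the polar of \<open>M\<close> on \<open>B\<close> were unbounded, a gliding hump argument
  would yield a functional in the polar which is unbounded on \<open>B\<close>.
\<close>

lemma polar_uniformly_bounded:
  fixes s :: "'k \<Rightarrow> 'f::{topological_ab_group_add,t2_space} \<Rightarrow> 'f"
  assumes s: "topological_vector_space s" and oM: "open M" and M: "valuation_submodule v s M"
    and B: "\<And>l. cont_linear s (*) l \<Longrightarrow> \<exists>r. \<forall>x\<in>B. v (l x) \<le> r"
  shows "\<exists>r. \<forall>l\<in>polar s M. \<forall>x\<in>B. v (l x) \<le> r"
proof (rule ccontr)
  assume "\<not> ?thesis"
  then have unb: "\<exists>l\<in>polar s M. \<exists>x\<in>B. v (l x) > r" for r by (meson not_less)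
  note M' = submodule_simps[OF M]
  \<comment> \<open>The polar is pointwise bounded: if b x is in M, then |l x| <= 1 / |b|.\<close>
  have "\<exists>r. \<forall>l\<in>polar s M. v (l x) \<le> r" for x
  proof -
    obtain b where b: "b \<noteq> 0" "s b x \<in> M" using tvs_absorbing[OF s oM M'(1)] by blast
    have "v (l x) \<le> 1 / v b" if "l \<in> polar s M" for l
    proof -
      have "v (l (s b x)) \<le> 1" "l (s b x) = b * l x" using that b by (auto simp: polar_def cont_linear_def)
      then show ?thesis using b(1) v_pos[of b] by (simp add: v_mult field_simps)
    qed
    then show ?thesis by blast
  qed
  then obtain C where C: "\<And>x l. l \<in> polar s M \<Longrightarrow> v (l x) \<le> C x" by metis
  have zero: "(\<lambda>x. 0) \<in> polar s M" by (auto simp: polar_def intro: cont_linearI)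
  have C0: "C x \<ge> 0" for x using C[OF zero, of x] by simp
  \<comment> \<open>The new functional exceeds n somewhere on B. The factor |p|^n makes the sequence
    pointwise Cauchy. The number R' dominates C at the new witness, so all later steps change the
    value there by at most 1.\<close>
  define step where "step n \<sigma> R \<sigma>' R' \<longleftrightarrow> R \<le> R' \<and> (\<exists>x\<in>B. v (\<sigma>' x) > real n \<and> C x \<le> R') \<and>
     (\<forall>y. v (\<sigma>' y - \<sigma> y) \<le> v p ^ n * C y) \<and> (\<forall>y. C y \<le> R \<longrightarrow> v (\<sigma>' y - \<sigma> y) \<le> 1)" for n \<sigma> R \<sigma>' R'
  have ex: "\<exists>\<sigma>' R'. \<sigma>' \<in> polar s M \<and> step n \<sigma> R \<sigma>' R'" if \<sigma>: "\<sigma> \<in> polar s M" for n \<sigma> R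
  proof -
    obtain m where m: "\<And>x. x \<in> B \<Longrightarrow> v (\<sigma> x) \<le> m" using B[of \<sigma>] \<sigma> by (auto simp: polar_def)
    have "max R 0 + 1 > 0" by (rule add_nonneg_pos) auto
    then obtain k0 where k0: "v p ^ k0 < 1 / (max R 0 + 1)"
      using real_arch_pow_inv[OF _ v_p(2), of "1 / (max R 0 + 1)"] by auto
    \<comment> \<open>\<open>k0\<close> keeps the change at most 1 wherever C <= R, and n supplies
      the decay |p|^n.\<close>
    define k where "k = k0 + n"
    have vp: "0 \<le> v p" "v p \<le> 1" using v_p by auto
    have pk: "v p ^ k \<le> v p ^ k0" "v p ^ k \<le> v p ^ n" "0 < v p ^ k"
      using vp v_p by (auto simp: k_def intro: power_decreasing)
    \<comment> \<open>After multiplication by p^k the value at x still exceeds both n and the bound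
      m of \<sigma> on B, so it dominates the sum.\<close>
    obtain l x where lx: "l \<in> polar s M" "x \<in> B" "v (l x) > max (real n) m / v p ^ k" using unb by blast
    define \<sigma>' where "\<sigma>' y = \<sigma> y + p ^ k * l y" for y
    have diff: "v (\<sigma>' y - \<sigma> y) = v p ^ k * v (l y)" for y by (simp add: \<sigma>'_def v_mult v_power)
    have "\<sigma>' \<in> polar s M"
    proof -
      have "cont_linear s (*) \<sigma>'"
        using \<sigma> lx(1) unfolding polar_def \<sigma>'_def
        by (intro cont_linearI) (auto simp: cont_linear_def algebra_simps intro!: continuous_intros)
      moreover have "v (\<sigma>' y) \<le> 1" if "y \<in> M" for y
      proof -
        have "v (\<sigma> y) \<le> 1" "v (l y) \<le> 1" using \<sigma> lx(1) that by (auto simp: polar_def)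
        moreover have "v p ^ k \<le> 1" using vp by (simp add: power_le_one)
        ultimately have "v (p ^ k * l y) \<le> 1" using vp by (simp add: v_mult v_power mult_le_one)
        with \<open>v (\<sigma> y) \<le> 1\<close> show ?thesis using v_add[of "\<sigma> y" "p ^ k * l y"] by (simp add: \<sigma>'_def)
      qed
      ultimately show ?thesis by (simp add: polar_def)
    qed
    moreover have "step n \<sigma> R \<sigma>' (max R (C x))"
      unfolding step_def
    proof (intro conjI allI impI)
      show "R \<le> max R (C x)" by simp
      have big: "v (p ^ k * l x) > max (real n) m"
        using lx(3) pk(3) by (simp add: v_mult v_power field_simps)
      have "v (p ^ k * l x) \<le> max (v (\<sigma>' x)) (v (\<sigma> x))" using v_diff[of "\<sigma>' x" "\<sigma> x"] by (simp add: \<sigma>'_def)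
      then have "v (\<sigma>' x) > real n" using big m[OF lx(2)] by (simp add: max_def split: if_splits)
      then show "\<exists>x'\<in>B. v (\<sigma>' x') > real n \<and> C x' \<le> max R (C x)" using lx(2) by (intro bexI[of _ x]) auto
      fix y
      show "v (\<sigma>' y - \<sigma> y) \<le> v p ^ n * C y"
        unfolding diff using C[OF lx(1)] pk vp by (intro mult_mono) auto
      assume "C y \<le> R"
      have "v p ^ k * v (l y) \<le> 1 / (max R 0 + 1) * (max R 0 + 1)"
        using C[OF lx(1), of y] \<open>C y \<le> R\<close> pk(1) k0 by (intro mult_mono) auto
      then show "v (\<sigma>' y - \<sigma> y) \<le> 1" unfolding diff using \<open>max R 0 + 1 > 0\<close> by simp
    qed
    ultimately show ?thesis by blast
  qed
  have "\<exists>f. \<forall>n. fst (f n) \<in> polar s M \<and> step n (fst (f n)) (snd (f n)) (fst (f (Suc n))) (snd (f (Suc n)))"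
  proof (rule dependent_nat_choice)
    show "\<exists>f :: ('f \<Rightarrow> 'k) \<times> real. fst f \<in> polar s M" using zero by (intro exI[of _ "((\<lambda>x. 0), 0)"]) simp
    fix f :: "('f \<Rightarrow> 'k) \<times> real" and n assume "fst f \<in> polar s M"
    from ex[OF this, of n "snd f"]
    show "\<exists>g. fst g \<in> polar s M \<and> step n (fst f) (snd f) (fst g) (snd g)" by auto
  qed
  then obtain f where f: "\<forall>n. fst (f n) \<in> polar s M \<and> step n (fst (f n)) (snd (f n)) (fst (f (Suc n))) (snd (f (Suc n)))"
    by (rule exE)
  define \<sigma> where "\<sigma> n = fst (f n)" for n
  define R where "R n = snd (f n)" for n
  have \<sigma>: "\<sigma> n \<in> polar s M" for n using f by (simp add: \<sigma>_def)
  have st: "step n (\<sigma> n) (R n) (\<sigma> (Suc n)) (R (Suc n))" for n using f by (simp add: \<sigma>_def R_def)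
  have R_mono: "R m \<le> R n" if "m \<le> n" for m n
    using lift_Suc_mono_le[of R m n] st that by (auto simp: step_def)
  have cauchy: "v (\<sigma> (n + i) y - \<sigma> n y) \<le> v p ^ n * C y" for n i y
  proof (induction i)
    case 0
    then show ?case using C0[of y] v_p by simp
  next
    case (Suc i)
    have "v (\<sigma> (Suc (n + i)) y - \<sigma> (n + i) y) \<le> v p ^ (n + i) * C y" using st unfolding step_def by blast
    also have "\<dots> \<le> v p ^ n * C y"
      using v_p C0 by (intro mult_right_mono power_decreasing) auto
    finally show ?case
      using Suc v_add[of "\<sigma> (Suc (n + i)) y - \<sigma> (n + i) y" "\<sigma> (n + i) y - \<sigma> n y"] by simp
  qed
  \<comment> \<open>The limit is taken as a common point of the nested balls around the
    values.\<close>
  have "\<exists>c. \<forall>n\<in>UNIV. v (c - \<sigma> n y) \<le> v p ^ n * C y" for y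
  proof (rule spherical_completeness)
    fix m n :: nat
    have "v (\<sigma> m y - \<sigma> n y) \<le> v p ^ n * C y" if "n \<le> m" for m n using cauchy[of n "m - n" y] that by simp
    from this[of m n] this[of n m] show "v (\<sigma> m y - \<sigma> n y) \<le> max (v p ^ m * C y) (v p ^ n * C y)"
      by (cases "n \<le> m") (simp_all add: v_diff_commute le_max_iff_disj)
  qed
  then obtain L where L: "\<And>n y. v (L y - \<sigma> n y) \<le> v p ^ n * C y" by (metis UNIV_I)
  have small: "\<exists>N. \<forall>n\<ge>N. v (L y - \<sigma> n y) < e" if "e > 0" for y e
  proof -
    have "(\<lambda>n. v p ^ n * C y) \<longlonglongrightarrow> 0 * C y"
      using v_p by (intro tendsto_intros LIMSEQ_realpow_zero) auto
    then have "(\<lambda>n. v p ^ n * C y) \<longlonglongrightarrow> 0" by simp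
    from order_tendstoD(2)[OF this that] show ?thesis
      unfolding eventually_sequentially using L le_less_trans by blast
  qed
  have lim: "(\<lambda>n. \<sigma> n y) \<longlonglongrightarrow> L y" for y
    unfolding tendsto_v_iff eventually_sequentially using small[of _ y] v_diff_commute by simp
  have \<sigma>_lin: "\<sigma> n (x + y) = \<sigma> n x + \<sigma> n y" "\<sigma> n (s a x) = a * \<sigma> n x" for n x y a
    using \<sigma>[of n] by (auto simp: polar_def cont_linear_def)
  have "cont_linear s (*) L"
  proof (rule cont_linear_bounded[OF s oM M'(1)])
    show "L (x + y) = L x + L y" for x y
      using tendsto_add[OF lim[of x] lim[of y]] lim[of "x + y"] LIMSEQ_unique by (simp add: \<sigma>_lin)
    show "L (s a x) = a * L x" for a x
      using tendsto_mult[OF tendsto_const lim[of x], of a] lim[of "s a x"] LIMSEQ_unique by (simp add: \<sigma>_lin)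
    show "v (L x) \<le> 1" if "x \<in> M" for x
    proof -
      obtain n where "v (L x - \<sigma> n x) < 1" using small[of 1 x] by auto
      moreover have "v (\<sigma> n x) \<le> 1" using \<sigma>[of n] that by (simp add: polar_def)
      ultimately show ?thesis using v_add[of "L x - \<sigma> n x" "\<sigma> n x"] by simp
    qed
  qed
  then obtain r where r: "\<forall>x\<in>B. v (L x) \<le> r" using B by blast
  \<comment> \<open>L differs by at most 1 from the n-th hump at its witness, so a hump above max r
    1 contradicts the bound r of L on B.\<close>
  obtain n where n: "real n > max r 1" using reals_Archimedean2 by blast
  obtain x where x: "x \<in> B" "v (\<sigma> (Suc n) x) > real n" "C x \<le> R (Suc n)" using st[of n] unfolding step_def by blast
  have near: "v (\<sigma> (Suc n + i) x - \<sigma> (Suc n) x) \<le> 1" for i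
  proof (induction i)
    case (Suc i)
    have "C x \<le> R (Suc n + i)" using x(3) R_mono[of "Suc n" "Suc n + i"] by simp
    then have "v (\<sigma> (Suc (Suc n + i)) x - \<sigma> (Suc n + i) x) \<le> 1" using st[of "Suc n + i"] unfolding step_def by blast
    then show ?case
      using Suc v_add[of "\<sigma> (Suc (Suc n + i)) x - \<sigma> (Suc n + i) x" "\<sigma> (Suc n + i) x - \<sigma> (Suc n) x"] by simp
  qed simp
  obtain N where N: "\<forall>m\<ge>N. v (L x - \<sigma> m x) < 1" using small[of 1 x] by auto
  have "v (L x - \<sigma> (Suc n) x) \<le> 1"
    using N[rule_format, of "Suc n + N"] near[of N]
      v_add[of "L x - \<sigma> (Suc n + N) x" "\<sigma> (Suc n + N) x - \<sigma> (Suc n) x"] by simp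
  then have "v (\<sigma> (Suc n) x) \<le> max r 1"
    using r x(1) v_diff[of "L x" "L x - \<sigma> (Suc n) x"] by fastforce
  then show False using x(2) n by simp
qed

text \<open>Take |a| above the uniform bound of the polar on B. If x / a were outside M, Hahn-Banach
  would give l in the polar with l x = a, exceeding that bound.\<close>

lemma weakly_bounded_absorbed:
  fixes s :: "'k \<Rightarrow> 'f::{topological_ab_group_add,t2_space} \<Rightarrow> 'f"
  assumes s: "topological_vector_space s" and oM: "open M" and M: "valuation_submodule v s M"
    and B: "\<And>l. cont_linear s (*) l \<Longrightarrow> \<exists>r. \<forall>x\<in>B. v (l x) \<le> r"
  shows "\<exists>a. a \<noteq> 0 \<and> (\<forall>x\<in>B. s (1 / a) x \<in> M)"
proof -
  obtain r where r: "\<forall>l\<in>polar s M. \<forall>x\<in>B. v (l x) \<le> r"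
    using polar_uniformly_bounded[OF assms] by blast
  obtain a where a: "a \<noteq> 0" "v a > r" using ex_large by blast
  have "s (1 / a) x \<in> M" if "x \<in> B" for x
  proof (rule ccontr)
    assume "s (1 / a) x \<notin> M"
    from hahn_banach[OF s oM M this] obtain l where l: "l \<in> polar s M" "l (s (1 / a) x) = 1" by blast
    then have "1 / a * l x = 1" by (simp add: polar_def cont_linear_def)
    then have "l x = a" using a(1) by simp
    then show False using r l(1) that a(2) by fastforce
  qed
  then show ?thesis using a(1) by blast
qed

lemma bounded_tvs_of_weakly_bounded:
  fixes s :: "'k \<Rightarrow> 'f::{topological_ab_group_add,t2_space} \<Rightarrow> 'f"
  assumes s: "topological_vector_space s" and lc: "locally_convex_tvs v s"
    and B: "\<And>l. cont_linear s (*) l \<Longrightarrow> \<exists>r. \<forall>x\<in>B. v (l x) \<le> r"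
  shows "bounded_tvs s B"
  unfolding bounded_tvs_def
proof (intro allI impI)
  fix W :: "'f set" assume "open W \<and> 0 \<in> W"
  then obtain M where M: "open M" "valuation_submodule v s M" "M \<subseteq> W"
    using lc unfolding locally_convex_tvs_def by blast
  obtain a where a: "a \<noteq> 0" "\<forall>x\<in>B. s (1 / a) x \<in> M"
    using weakly_bounded_absorbed[OF s M(1,2) B] by blast
  have "B \<subseteq> s a ` W"
  proof
    fix x assume "x \<in> B"
    then have "s (1 / a) x \<in> W" "x = s a (s (1 / a) x)" using a M(3) by (auto simp: tvs_algebra[OF s])
    then show "x \<in> s a ` W" by (rule rev_image_eqI)
  qed
  then show "\<exists>a. B \<subseteq> s a ` W" by blast
qed


section \<open>Weakly smooth maps are smooth\<close>

definition weakly_usmooth ::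
  "('k \<Rightarrow> 'b \<Rightarrow> 'b) \<Rightarrow> ('k \<Rightarrow> 'f \<Rightarrow> 'f) \<Rightarrow> (nat \<Rightarrow> 'b::{plus,topological_space} \<times> 'k) set
    \<Rightarrow> ((nat \<Rightarrow> 'b \<times> 'k) \<Rightarrow> 'f::{plus,topological_space}) \<Rightarrow> bool" where
  "weakly_usmooth s s' V f \<longleftrightarrow> (\<forall>l. cont_linear s' (*) l \<longrightarrow> usmooth s (*) V (\<lambda>z. l (f z)))"

text \<open>A discontinuity yields y_n tending to 0 such that f (x + p^n y_n) - f x avoids a fixed
  submodule M. Scalar quotients are continuous at (x, 0, 0), so dividing these differences by p^n
  leaves a weakly bounded set, which M absorbs; multiplying by p^n again puts late differences into
  M.\<close>

lemma weakly_usmooth_continuous: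
  fixes s :: "'k \<Rightarrow> 'b::{topological_ab_group_add,t2_space} \<Rightarrow> 'b"
    and s' :: "'k \<Rightarrow> 'f::{topological_ab_group_add,t2_space} \<Rightarrow> 'f"
  assumes s: "topological_vector_space s" and metr: "metrizable_space (euclidean :: 'b topology)"
    and s': "topological_vector_space s'" and lc: "locally_convex_tvs v s'"
    and V: "open V" and f: "weakly_usmooth s s' V f"
  shows "continuous_on V f"
  unfolding continuous_on_def
proof
  note us = tvs_uscale[OF s]
  fix x assume x: "x \<in> V"
  show "(f \<longlongrightarrow> f x) (at x within V)"
  proof (rule topological_tendstoI)
    fix S assume S: "open S" "f x \<in> S"
    have "open ((\<lambda>y. f x + y) -` S)" by (rule open_vimage[OF S(1)]) (intro continuous_intros)
    moreover have "0 \<in> (\<lambda>y. f x + y) -` S" using S(2) by simp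
    ultimately obtain M where M: "open M" "valuation_submodule v s' M" "M \<subseteq> (\<lambda>y. f x + y) -` S"
      using lc unfolding locally_convex_tvs_def by blast
    have "\<exists>N. open N \<and> 0 \<in> N \<and> (\<forall>q\<in>N. x + q \<in> V \<longrightarrow> f (x + q) - f x \<in> M)"
    proof (rule ccontr)
      assume neg: "\<not> ?thesis"
      obtain W :: "nat \<Rightarrow> (nat \<Rightarrow> 'b \<times> 'k) set" where W: "\<And>n. open (W n)" "\<And>n. 0 \<in> W n"
        "\<And>S. open S \<Longrightarrow> 0 \<in> S \<Longrightarrow> \<exists>m. \<forall>n\<ge>m. W n \<subseteq> S"
        by (rule metrizable_nhds_0_base[OF metrizable_universal_space[OF metr]]) blast
      \<comment> \<open>The condition on q / p^n makes the rescaled increments a null sequence as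
        well.\<close>
      have "\<exists>q. uscale s (1 / p ^ n) q \<in> W n \<and> x + q \<in> V \<and> f (x + q) - f x \<notin> M" for n
      proof -
        have "open (uscale s (1 / p ^ n) -` W n)"
          by (rule open_vimage[OF W(1)]) (intro tvs_continuous_on[OF us] continuous_intros)
        moreover have "0 \<in> uscale s (1 / p ^ n) -` W n" using W(2) by (simp add: tvs_algebra[OF us])
        ultimately have "\<exists>q\<in>uscale s (1 / p ^ n) -` W n. x + q \<in> V \<and> f (x + q) - f x \<notin> M"
          using neg by meson
        then show ?thesis by auto
      qed
      then obtain q where q: "\<And>n. uscale s (1 / p ^ n) (q n) \<in> W n" "\<And>n. x + q n \<in> V"
        "\<And>n. f (x + q n) - f x \<notin> M" by metis
      define y where "y n = uscale s (1 / p ^ n) (q n)" for n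
      have qy: "q n = uscale s (p ^ n) (y n)" for n by (simp add: y_def tvs_algebra[OF us])
      have y0: "y \<longlonglongrightarrow> 0"
      proof (rule topological_tendstoI)
        fix S :: "(nat \<Rightarrow> 'b \<times> 'k) set" assume "open S" "0 \<in> S"
        then obtain m where "\<forall>n\<ge>m. W n \<subseteq> S" using W(3) by blast
        then show "\<forall>\<^sub>F n in sequentially. y n \<in> S"
          unfolding eventually_sequentially y_def using q(1) by blast
      qed
      define B where "B = range (\<lambda>n. s' (1 / p ^ n) (f (x + q n) - f x))"
      have "\<exists>r. \<forall>b\<in>B. v (l b) \<le> r" if l: "cont_linear s' (*) l" for l
      proof -
        let ?g = "udq s (*) (\<lambda>z. l (f z))"
        have "usmooth s (*) V (\<lambda>z. l (f z))" using f l unfolding weakly_usmooth_def by blast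
        from usmooth_continuous[OF usmooth_udq[OF this]] have g: "continuous_on (uext s V) ?g" .
        have "continuous_on UNIV (\<lambda>w. uinc x (fst w) (snd w) :: nat \<Rightarrow> 'b \<times> 'k)"
          by (intro continuous_on_uinc continuous_intros)
        from continuous_on_tendsto_compose[OF this tendsto_Pair[OF y0 tendsto_p_power]]
        have 1: "(\<lambda>n. uinc x (y n) (p ^ n)) \<longlonglongrightarrow> uinc x 0 0" by simp
        have "(\<lambda>n. ?g (uinc x (y n) (p ^ n))) \<longlonglongrightarrow> ?g (uinc x 0 0)"
        proof (rule continuous_on_tendsto_compose[OF g 1])
          show "uinc x 0 0 \<in> uext s V" using x by (simp add: in_uext_iff ustep_def tvs_algebra[OF us])
          show "\<forall>\<^sub>F n in sequentially. uinc x (y n) (p ^ n) \<in> uext s V"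
            using x q(2) by (simp add: in_uext_iff ustep_def flip: qy)
        qed
        from tendsto_imp_v_bounded[OF this] obtain r where r: "\<forall>n. v (?g (uinc x (y n) (p ^ n))) \<le> r" by (rule exE)
        have "?g (uinc x (y n) (p ^ n)) = l (s' (1 / p ^ n) (f (x + q n) - f x))" for n
          by (simp add: udq_nonzero ustep_def cont_linearD(2)[OF l] cont_linear_diff[OF l] flip: qy)
        then show ?thesis using r unfolding B_def by (intro exI[of _ r]) auto
      qed
      from weakly_bounded_absorbed[OF s' M(1,2) this]
      obtain a where a: "a \<noteq> 0" "\<forall>b\<in>B. s' (1 / a) b \<in> M" by auto
      \<comment> \<open>As soon as |p^n a| <= 1, the module M is stable under p^n a, which undoes
        the division by a and by p^n.\<close>
      have "(\<lambda>n. p ^ n * a) \<longlonglongrightarrow> 0 * a" by (intro tendsto_mult tendsto_p_power tendsto_const)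
      then have "\<forall>\<^sub>F n in sequentially. v (p ^ n * a - 0 * a) < 1" unfolding tendsto_v_iff by simp
      then obtain n where n: "v (p ^ n * a) \<le> 1"
        by (metis (no_types, lifting) eventually_happens sequentially_bot less_imp_le mult_zero_left diff_zero)
      have "s' (p ^ n * a) (s' (1 / a) (s' (1 / p ^ n) (f (x + q n) - f x))) \<in> M"
        using a(2) unfolding B_def by (intro submodule_simps(3)[OF M(2) n]) blast
      then show False using q(3)[of n] a(1) by (simp add: tvs_algebra[OF s'])
    qed
    then obtain N where N: "open N" "0 \<in> N" "\<And>q. q \<in> N \<Longrightarrow> x + q \<in> V \<Longrightarrow> f (x + q) - f x \<in> M" by auto
    have "open ((\<lambda>y. y - x) -` N)" by (rule open_vimage[OF N(1)]) (intro continuous_intros)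
    moreover have "f y \<in> S" if "y - x \<in> N" "y \<in> V" for y
      using N(3)[OF that(1)] that(2) M(3) by auto
    ultimately show "\<forall>\<^sub>F y in at x within V. f y \<in> S"
      unfolding eventually_at_topological
      using N(2) by (intro exI[of _ "(\<lambda>y. y - x) -` N"]) auto
  qed
qed

text \<open>
  The difference quotients along \<open>t = p ^ n\<close> form a Mackey-Cauchy sequence, because second order
  difference quotients are bounded on compact sets.
\<close>

lemma weakly_usmooth_convergent_dq:
  fixes s :: "'k \<Rightarrow> 'b::{topological_ab_group_add,t2_space} \<Rightarrow> 'b"
    and s' :: "'k \<Rightarrow> 'f::{topological_ab_group_add,t2_space} \<Rightarrow> 'f"
  assumes s: "topological_vector_space s"
    and s': "topological_vector_space s'" and lc: "locally_convex_tvs v s'" and mc: "Mackey_complete s'"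
    and V: "open V" and f: "weakly_usmooth s s' V f" and x: "x \<in> V"
  shows "convergent (\<lambda>n. s' (1 / p ^ n) (f (x + uscale s (p ^ n) y) - f x))"
proof -
  note us = tvs_uscale[OF s]
  define q where "q t = s' (1 / t) (f (x + uscale s t y) - f x)" for t
  have "open ((\<lambda>t. x + uscale s t y) -` V)"
    by (rule open_vimage[OF V]) (intro continuous_intros tvs_continuous_on[OF us])
  moreover have "0 \<in> (\<lambda>t. x + uscale s t y) -` V" using x by (simp add: tvs_algebra[OF us])
  ultimately have "\<exists>e>0. \<forall>t. v (t - 0) < e \<longrightarrow> t \<in> (\<lambda>t. x + uscale s t y) -` V" unfolding open_iff by blast
  then obtain e where e: "e > 0" "\<And>t. v t < e \<Longrightarrow> x + uscale s t y \<in> V" by auto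
  \<comment> \<open>Starting at p^N keeps x + t y inside V for all t in the compact ball D.\<close>
  obtain N where N: "v p ^ N < e" using real_arch_pow_inv[OF e(1) v_p(2)] by blast
  define D where "D = {t. v t \<le> v p ^ N}"
  have pD: "p ^ (n + N) \<in> D" for n
    using v_p by (simp add: D_def v_power power_decreasing)
  define \<mu> where "\<mu> n m = p ^ (n + N) - p ^ (m + N)" for n m
  have \<mu>: "\<mu> n m \<noteq> 0" if "n \<noteq> m" for n m
  proof
    assume "\<mu> n m = 0"
    then have "v (p ^ (n + N)) = v (p ^ (m + N))" by (simp add: \<mu>_def)
    then have "v p ^ (n + N) = v p ^ (m + N)" by (simp only: v_power)
    then show False using that v_p power_inject_exp' by (metis add_right_cancel less_irrefl)
  qed
  define B where "B = {s' (1 / \<mu> n m) (q (p ^ (n + N)) - q (p ^ (m + N))) | n m. True}"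
  have "bounded_tvs s' B"
  proof (rule bounded_tvs_of_weakly_bounded[OF s' lc])
    fix l assume l: "cont_linear s' (*) l"
    define g where "g = udq s (*) (\<lambda>z. l (f z))"
    have "usmooth s (*) V (\<lambda>z. l (f z))" using f l unfolding weakly_usmooth_def by blast
    then have g: "usmooth s (*) (uext s V) g" unfolding g_def by (rule usmooth_udq)
    \<comment> \<open>For w = (t, t') this is ((x, y, t'), (0, 0, 1), t - t'). The second order
      quotient there is the difference of the first order quotients at t and t', divided by t -
      t'.\<close>
    define P where "P w = uinc (uinc x y (snd w)) (uinc 0 0 1) (fst w - snd w)" for w :: "'k \<times> 'k"
    have stP: "ustep s (P w) = uinc x y (fst w)" "ubase (P w) = uinc x y (snd w)" "upar (P w) = fst w - snd w" for w
      by (simp_all add: P_def ustep_def uinc_scale[OF s] uinc_add tvs_algebra[OF us])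
    have stu: "ustep s (uinc x y t) = x + uscale s t y" for t by (simp add: ustep_def)
    have "continuous_on (D \<times> D) (\<lambda>w. udq s (*) g (P w))"
    proof (rule continuous_on_compose2[OF usmooth_continuous[OF usmooth_udq[OF g]]])
      show "continuous_on (D \<times> D) P" unfolding P_def by (intro continuous_on_uinc continuous_intros)
      show "P ` (D \<times> D) \<subseteq> uext s (uext s V)"
      proof
        fix z assume "z \<in> P ` (D \<times> D)"
        then obtain w where "z = P w" "fst w \<in> D" "snd w \<in> D" by auto
        then show "z \<in> uext s (uext s V)"
          using x e(2)[of "fst w"] e(2)[of "snd w"] N by (simp add: in_uext_iff stP stu D_def)
      qed
    qed
    moreover have "compact (D \<times> D)" unfolding D_def by (intro compact_Times compact_cball_0)
    ultimately have "\<exists>r. \<forall>a\<in>(\<lambda>w. udq s (*) g (P w)) ` (D \<times> D). v a \<le> r"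
      by (intro compact_v_bounded compact_continuous_image)
    then obtain r where r: "\<And>w. w \<in> D \<times> D \<Longrightarrow> v (udq s (*) g (P w)) \<le> r" by auto
    have gq: "g (uinc x y t) = l (q t)" if "t \<noteq> 0" for t
      using that by (simp add: g_def udq_nonzero stu q_def cont_linearD(2)[OF l] cont_linear_diff[OF l])
    have "v (l b) \<le> max r 0" if bB: "b \<in> B" for b
    proof -
      obtain n m where b: "b = s' (1 / \<mu> n m) (q (p ^ (n + N)) - q (p ^ (m + N)))" using bB unfolding B_def by blast
      show ?thesis
      proof (cases "n = m")
        \<comment> \<open>Here the divisor is 0 and so is the difference; the element of B is 0,
          which explains the bound max r 0.\<close>
        case True
        then show ?thesis using b by (simp add: tvs_algebra[OF s'] cont_linear_diff[OF l])
      next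
        case False
        let ?w = "(p ^ (n + N), p ^ (m + N))"
        have "l b = (1 / \<mu> n m) * (g (uinc x y (p ^ (n + N))) - g (uinc x y (p ^ (m + N))))"
          by (simp add: b cont_linearD(2)[OF l] cont_linear_diff[OF l] gq)
        also have "\<dots> = udq s (*) g (P ?w)"
          using \<mu>[OF False] by (simp add: udq_nonzero stP \<mu>_def)
        finally have "v (l b) \<le> r" using r[of ?w] pD by simp
        then show ?thesis by simp
      qed
    qed
    then show "\<exists>r. \<forall>b\<in>B. v (l b) \<le> r" by blast
  qed
  moreover have "q (p ^ (n + N)) - q (p ^ (m + N)) \<in> s' (\<mu> n m) ` B" for n m
  proof (rule image_eqI)
    show "s' (1 / \<mu> n m) (q (p ^ (n + N)) - q (p ^ (m + N))) \<in> B" unfolding B_def by blast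
    show "q (p ^ (n + N)) - q (p ^ (m + N)) = s' (\<mu> n m) (s' (1 / \<mu> n m) (q (p ^ (n + N)) - q (p ^ (m + N))))"
      using \<mu>[of n m] by (cases "n = m") (simp_all add: tvs_algebra(3,4,6)[OF s'])
  qed
  moreover have "((\<lambda>(n, m). \<mu> n m) \<longlongrightarrow> 0) (sequentially \<times>\<^sub>F sequentially)"
  proof -
    have P: "(\<lambda>n. p ^ (n + N)) \<longlonglongrightarrow> 0" by (rule LIMSEQ_ignore_initial_segment[OF tendsto_p_power])
    have "((\<lambda>w. p ^ (fst w + N) - p ^ (snd w + N)) \<longlongrightarrow> 0 - 0) (sequentially \<times>\<^sub>F sequentially)"
      by (intro tendsto_diff filterlim_compose[OF P] filterlim_fst filterlim_snd)
    then show ?thesis by (simp add: \<mu>_def case_prod_beta')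
  qed
  ultimately have "Mackey_Cauchy s' (\<lambda>n. q (p ^ (n + N)))" unfolding Mackey_Cauchy_def by blast
  then have "convergent (\<lambda>n. q (p ^ (n + N)))" using mc unfolding Mackey_complete_def by blast
  then have "convergent (\<lambda>n. q (p ^ n))" by (rule convergent_ignore_initial_segment[THEN iffD1])
  then show ?thesis by (simp only: q_def)
qed

text \<open>Weak smoothness is the coinductive invariant. The limits at parameter 0 are taken in F,
  and every functional maps them to the scalar limits, so the extended quotient is again weakly
  smooth.\<close>

theorem usmooth_of_weakly_usmooth:
  fixes s :: "'k \<Rightarrow> 'b::{topological_ab_group_add,t2_space} \<Rightarrow> 'b"
    and s' :: "'k \<Rightarrow> 'f::{topological_ab_group_add,t2_space} \<Rightarrow> 'f"
  assumes s: "topological_vector_space s" and metr: "metrizable_space (euclidean :: 'b topology)"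
    and s': "topological_vector_space s'" and lc: "locally_convex_tvs v s'" and mc: "Mackey_complete s'"
    and "open V" and "weakly_usmooth s s' V f"
  shows "usmooth s s' V f"
proof (rule usmooth_coinduct[OF s, where R = "\<lambda>V f. open V \<and> weakly_usmooth s s' V f"])
  fix V and f :: "_ \<Rightarrow> 'f" assume "open V \<and> weakly_usmooth s s' V f"
  then have V: "open V" and f: "weakly_usmooth s s' V f" by auto
  note us = tvs_uscale[OF s]
  define q where "q z t = s' (1 / t) (f (ubase z + uscale s t (udir z)) - f (ubase z))" for z t
  \<comment> \<open>Mackey completeness gives convergence along \<open>p ^ n\<close>, so the value
    at parameter 0 is this sequential limit; continuity of the scalar quotients shows that it is the
    right one.\<close>
  define g where "g z = (if upar z \<noteq> 0 then q z (upar z) else lim (\<lambda>n. q z (p ^ n)))" for z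
  have eq: "l (g z) = udq s (*) (\<lambda>z. l (f z)) z" if l: "cont_linear s' (*) l" and z: "z \<in> uext s V" for l z
  proof -
    let ?h = "udq s (*) (\<lambda>z. l (f z))"
    have h: "?h (uinc (ubase z) (udir z) t) = l (q z t)" if "t \<noteq> 0" for t
      using that by (simp add: udq_nonzero ustep_def q_def cont_linearD(2)[OF l] cont_linear_diff[OF l])
    have hz: "?h (uinc (ubase z) (udir z) (upar z)) = ?h z" by (simp add: udq_def)
    show ?thesis
    proof (cases "upar z = 0")
      case False
      then show ?thesis using h[OF False] hz by (simp add: g_def)
    next
      case True
      have b: "ubase z \<in> V" using z by (simp add: in_uext_iff)
      have "(\<lambda>n. q z (p ^ n)) \<longlonglongrightarrow> lim (\<lambda>n. q z (p ^ n))"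
        using weakly_usmooth_convergent_dq[OF s s' lc mc V f b, of "udir z"]
        unfolding q_def by (simp only: convergent_LIMSEQ_iff)
      from cont_linear_tendsto[OF l this] have 1: "(\<lambda>n. l (q z (p ^ n))) \<longlonglongrightarrow> l (g z)"
        using True by (simp add: g_def)
      have "usmooth s (*) V (\<lambda>z. l (f z))" using f l unfolding weakly_usmooth_def by blast
      from usmooth_continuous[OF usmooth_udq[OF this]] have hc: "continuous_on (uext s V) ?h" .
      have "continuous_on UNIV (\<lambda>t. uinc (ubase z) (udir z) t)"
        by (intro continuous_on_uinc continuous_intros)
      from continuous_on_tendsto_compose[OF this tendsto_p_power]
      have 2: "(\<lambda>n. uinc (ubase z) (udir z) (p ^ n)) \<longlonglongrightarrow> uinc (ubase z) (udir z) 0" by simp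
      have u0: "uinc (ubase z) (udir z) 0 \<in> uext s V"
        using b by (simp add: in_uext_iff ustep_def tvs_algebra[OF us])
      have "(\<lambda>n. ?h (uinc (ubase z) (udir z) (p ^ n))) \<longlonglongrightarrow> ?h (uinc (ubase z) (udir z) 0)"
        by (rule continuous_on_tendsto_compose[OF hc 2 u0 topological_tendstoD[OF 2 open_uext[OF s V] u0]])
      then have "(\<lambda>n. l (q z (p ^ n))) \<longlonglongrightarrow> ?h z" using hz True by (simp add: h)
      with 1 show ?thesis by (rule LIMSEQ_unique)
    qed
  qed
  have "weakly_usmooth s s' (uext s V) g"
    unfolding weakly_usmooth_def
  proof (intro allI impI)
    fix l assume l: "cont_linear s' (*) l"
    then have "usmooth s (*) (uext s V) (udq s (*) (\<lambda>z. l (f z)))"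
      using f unfolding weakly_usmooth_def by (intro usmooth_udq) blast
    moreover have "usmooth s (*) (uext s V) (\<lambda>z. l (g z)) \<longleftrightarrow>
        usmooth s (*) (uext s V) (udq s (*) (\<lambda>z. l (f z)))"
      by (rule usmooth_cong[OF s open_uext[OF s V]]) (rule eq[OF l])
    ultimately show "usmooth s (*) (uext s V) (\<lambda>z. l (g z))" by blast
  qed
  moreover have "g z = s' (1 / upar z) (f (ustep s z) - f (ubase z))" if "upar z \<noteq> 0" for z
    using that by (simp add: g_def q_def ustep_def)
  moreover have "continuous_on V f" by (rule weakly_usmooth_continuous[OF s metr s' lc V f])
  ultimately show "open V \<and> continuous_on V f \<and> (\<exists>g. (open (uext s V) \<and> weakly_usmooth s s' (uext s V) g) \<and>
      (\<forall>z\<in>uext s V. upar z \<noteq> 0 \<longrightarrow> g z = s' (1 / upar z) (f (ustep s z) - f (ubase z))))"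
    using V open_uext[OF s V] by blast
qed (use assms in blast)

end

theorem theoremE2:
  fixes absv :: "'k::local_field \<Rightarrow> real"
    and scaleE :: "'k \<Rightarrow> 'e::{topological_ab_group_add, t2_space} \<Rightarrow> 'e"
    and scaleF :: "'k \<Rightarrow> 'f::{topological_ab_group_add, t2_space} \<Rightarrow> 'f"
    and U :: "'e set"
    and f :: "'e \<Rightarrow> 'f"
  assumes "ultrametric_absolute_value absv" and "defines_topology absv"
    and Boman_plane:
      "\<And>g :: 'k \<times> 'k \<Rightarrow> 'k.
         (\<And>\<gamma>. smooth_curve_in scale_plane UNIV \<gamma> \<Longrightarrow> C_infinity_on (*) (*) UNIV (g \<circ> \<gamma>))
         \<Longrightarrow> C_infinity_on scale_plane (*) UNIV g"
    and "topological_vector_space scaleE" and "metrizable_space (euclidean :: 'e topology)"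
    and "topological_vector_space scaleF" and "locally_convex_tvs absv scaleF"
    and "Mackey_complete scaleF"
    and "open U"
    and "\<And>\<gamma>. smooth_curve_in scaleE U \<gamma> \<Longrightarrow> C_infinity_on (*) scaleF UNIV (f \<circ> \<gamma>)"
  shows "C_infinity_on scaleE scaleF U f"
proof -
  interpret boman_plane absv
  proof
    fix g :: "'k \<times> 'k \<Rightarrow> 'k" assume "curve_smooth_on (pair_scale (*) (*)) (*) UNIV g"
    then show "C_infinity_on (pair_scale (*) (*)) (*) UNIV g"
      unfolding scale_plane_eq[symmetric] curve_smooth_on_def
      by (intro Boman_plane) (simp add: o_def)
  qed fact+
  have "weakly_usmooth scaleE scaleF (uret -` U) (\<lambda>z. f (uret z))"
    unfolding weakly_usmooth_def
  proof (intro allI impI)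
    fix l :: "'f \<Rightarrow> 'k" assume l: "cont_linear scaleF (*) l"
    have "curve_smooth_on scaleE (*) U (\<lambda>x. l (f x))"
      unfolding curve_smooth_on_def
    proof (intro allI impI)
      fix c assume "smooth_curve_in scaleE U c"
      then have "C_infinity_on (*) scaleF UNIV (\<lambda>u. f (c u))" using assms(10) by (simp add: o_def)
      from C_infinity_on_postcompose_linear[OF tvs_mult assms(6) tvs_mult open_UNIV this l]
      show "C_infinity_on (*) (*) UNIV (\<lambda>u. l (f (c u)))" .
    qed
    from scalar_boman[OF assms(4,5,9) this]
    show "usmooth scaleE (*) (uret -` U) (\<lambda>z. l (f (uret z)))" .
  qed
  from usmooth_of_weakly_usmooth[OF assms(4-8) open_uret_vimage[OF assms(9)] this]
  show ?thesis unfolding C_infinity_on_iff_usmooth[OF assms(4,9)] .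
qed

end
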